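(* Let $p$ be a prime, let $k$ be a perfect field of characteristic $p$, and let $G$ be a $p$-adic affine commutative group scheme over $k$, i.e. $G\in \mathrm{AbSch}_k^p$. Then the functor of points $G\colon \mathrm{Alg}_k\to \mathrm{Ab}$ factors through the polarization functor $\mathrm{pol}\colon \mathrm{Alg}_k\to \mathrm{Pol}_p(k)$, naturally in $G$: there is a functor $\tilde G\colon \mathrm{Pol}_p(k)\to \mathrm{Ab}$, functorial in $G\in \mathrm{AbSch}_k^p$, together with an isomorphism $G\cong \tilde G\circ \mathrm{pol}$ of functors $\mathrm{Alg}_k\to\mathrm{Ab}$, natural in $G$.
   Context: $\mathrm{Alg}_k$ is the category of commutative unital $k$-algebras and $\mathrm{Ab}$ the category of abelian groups. A $p$-polar $k$-algebra is a $k$-module $A$ with a symmetric $k$-multilinear map $\mu\colon A^{\otimes_k p}\to A$ such that $\mu(\mu(x_1,\dots,x_p),x_{p+1},\dots,x_{2p-1})$ is invariant under all permutations in $\Sigma_{2p-1}$ of $x_1,\dots,x_{2p-1}\in A$. Morphisms are $k$-linear maps compatible with $\mu$; the resulting category is $\mathrm{Pol}_p(k)$. The polarization functor $\mathrm{pol}\colon\mathrm{Alg}_k\to\mathrm{Pol}_p(k)$ sends a $k$-algebra $R$ to its underlying module with $\mu(x_1,\dots,x_p)=x_1\cdots x_p$. $\mathrm{AbSch}_k$ is the category of affine commutative group schemes over $k$ (anti-equivalent to bicommutative Hopf algebras over $k$). $\mathrm{AbSch}_k^p$ is its full subcategory of $p$-adic groups, i.e. those taking values in abelian pro-$p$-groups;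 equivalently those whose representing Hopf algebra $H$ satisfies $H\cong\operatorname{colim}_n H[p^n]$, where $H[p^n]$ is the kernel (in bicommutative Hopf algebras) of the endomorphism $[p^n]$ of $H$ representing multiplication by $p^n$; equivalently $G\cong\lim_n G/p^n$. *)

theory Defs
  imports "HOL-Computational_Algebra.Primes" "HOL-Library.Multiset" "HOL-Algebra.Module"
begin

section \<open>Commutative algebras over a commutative ring\<close>

definition has_characteristic :: "('k, 'r) ring_scheme \<Rightarrow> nat \<Rightarrow> bool" where
  "has_characteristic K p \<longleftrightarrow> (\<forall>n::nat. [n] \<cdot>\<^bsub>K\<^esub> \<one>\<^bsub>K\<^esub> = \<zero>\<^bsub>K\<^esub> \<longleftrightarrow> p dvd n)"

definition perfect_field_of_char :: "('k, 'r) ring_scheme \<Rightarrow> nat \<Rightarrow> bool" where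
  "perfect_field_of_char K p \<longleftrightarrow>
     field K \<and> prime p \<and> has_characteristic K p \<and>
     (\<lambda>x. x [^]\<^bsub>K\<^esub> p) ` carrier K = carrier K"

definition linear_map ::
    "('k, 'r) ring_scheme \<Rightarrow> ('k, 'm, 'x) module_scheme \<Rightarrow> ('k, 'n, 'y) module_scheme \<Rightarrow> ('m \<Rightarrow> 'n) set" where
  "linear_map K M N =
     {f. f \<in> carrier M \<rightarrow> carrier N \<and>
         (\<forall>x\<in>carrier M. \<forall>y\<in>carrier M. f (x \<oplus>\<^bsub>M\<^esub> y) = f x \<oplus>\<^bsub>N\<^esub> f y) \<and>
         (\<forall>a\<in>carrier K. \<forall>x\<in>carrier M. f (a \<odot>\<^bsub>M\<^esub> x) = a \<odot>\<^bsub>N\<^esub> f x)}"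

definition Alg :: "('k, 'r) ring_scheme \<Rightarrow> ('k, 'a) module set" where
  "Alg K = {R. algebra K R}"

text \<open>Morphisms are extensional functions, so that equality of morphisms is equality of functions;
  they compose by \<^const>\<open>compose\<close>.\<close>

definition alg_hom ::
    "('k, 'r) ring_scheme \<Rightarrow> ('k, 'm, 'x) module_scheme \<Rightarrow> ('k, 'n, 'y) module_scheme \<Rightarrow> ('m \<Rightarrow> 'n) set" where
  "alg_hom K R S = ring_hom R S \<inter> linear_map K R S \<inter> extensional (carrier R)"


section \<open>Polar algebras\<close>

text \<open>As for modules, the fields \<^const>\<open>mult\<close> and \<^const>\<open>one\<close>, which the record type of modules
  inherits from rings, are irrelevant. Only the values of \<open>mu\<close> on \<open>tuples p A\<close> matter.\<close>

record ('k, 'a) polar = "('k, 'a) module" +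
  mu :: "'a list \<Rightarrow> 'a"

definition tuples :: "nat \<Rightarrow> ('a, 'x) partial_object_scheme \<Rightarrow> 'a list set" where
  "tuples n A = {xs. length xs = n \<and> set xs \<subseteq> carrier A}"

locale polar_algebra = module K A
  for K :: "('k, 'r) ring_scheme" (structure) and p :: nat and A :: "('k, 'a) polar" (structure) +
  assumes mu_closed: "xs \<in> tuples p A \<Longrightarrow> mu A xs \<in> carrier A"
    and mu_add: "\<lbrakk>xs \<in> tuples p A; i < p; y \<in> carrier A; z \<in> carrier A\<rbrakk> \<Longrightarrow>
      mu A (xs[i := y \<oplus>\<^bsub>A\<^esub> z]) = mu A (xs[i := y]) \<oplus>\<^bsub>A\<^esub> mu A (xs[i := z])"
    and mu_smult: "\<lbrakk>xs \<in> tuples p A; i < p; a \<in> carrier K; y \<in> carrier A\<rbrakk> \<Longrightarrow>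
      mu A (xs[i := a \<odot>\<^bsub>A\<^esub> y]) = a \<odot>\<^bsub>A\<^esub> mu A (xs[i := y])"
    and mu_sym: "\<lbrakk>xs \<in> tuples p A; ys \<in> tuples p A; mset xs = mset ys\<rbrakk> \<Longrightarrow> mu A xs = mu A ys"
    and mu_assoc: "\<lbrakk>xs \<in> tuples (2 * p - 1) A; ys \<in> tuples (2 * p - 1) A; mset xs = mset ys\<rbrakk> \<Longrightarrow>
      mu A (mu A (take p xs) # drop p xs) = mu A (mu A (take p ys) # drop p ys)"

definition Pol :: "('k, 'r) ring_scheme \<Rightarrow> nat \<Rightarrow> ('k, 'a) polar set" where
  "Pol K p = {A. polar_algebra K p A}"

definition polar_hom ::
    "('k, 'r) ring_scheme \<Rightarrow> nat \<Rightarrow> ('k, 'a) polar \<Rightarrow> ('k, 'b) polar \<Rightarrow> ('a \<Rightarrow> 'b) set" where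
  "polar_hom K p A B =
     {f \<in> linear_map K A B \<inter> extensional (carrier A).
        \<forall>xs\<in>tuples p A. f (mu A xs) = mu B (map f xs)}"

text \<open>The polarization functor on objects; on morphisms it is the identity on underlying
  functions. It has to forget \<^const>\<open>mult\<close> and \<^const>\<open>one\<close>, and for the same reason \<open>mu\<close> must not
  carry information about the values of products of any length other than \<open>p\<close>.\<close>

definition pol :: "nat \<Rightarrow> ('k, 'a) module \<Rightarrow> ('k, 'a) polar" where
  "pol p R =
     \<lparr>carrier = carrier R, mult = undefined, one = undefined, zero = zero R, add = add R,
      smult = smult R, mu = (\<lambda>xs\<in>tuples p R. foldr (\<otimes>\<^bsub>R\<^esub>) xs \<one>\<^bsub>R\<^esub>)\<rparr>"


section \<open>Tensor products\<close>

text \<open>\<open>M \<otimes>\<^sub>K N\<close> consists of the formal sums \<open>m\<^sub>1 \<otimes> n\<^sub>1 + \<dots> + m\<^sub>r \<otimes> n\<^sub>r\<close>, given as the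
  lists of the pairs \<open>(m\<^sub>i, n\<^sub>i)\<close>, modulo the bilinear relations. No formal inverses or coefficients
  are needed because \<open>(a m) \<otimes> n\<close> serves as \<open>a (m \<otimes> n)\<close>. The rule \<open>zero\<close> says that \<open>0 \<otimes> n\<close> is the
  empty sum, which does not follow from the other rules in the absence of cancellation.\<close>

inductive tensor_rel ::
    "('k, 'r) ring_scheme \<Rightarrow> ('k, 'm, 'x) module_scheme \<Rightarrow> ('k, 'n, 'y) module_scheme
     \<Rightarrow> ('m \<times> 'n) list \<Rightarrow> ('m \<times> 'n) list \<Rightarrow> bool"
  for K M N where
    refl: "set ts \<subseteq> carrier M \<times> carrier N \<Longrightarrow> tensor_rel K M N ts ts"
  | sym: "tensor_rel K M N ts us \<Longrightarrow> tensor_rel K M N us ts"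
  | trans: "\<lbrakk>tensor_rel K M N ts us; tensor_rel K M N us vs\<rbrakk> \<Longrightarrow> tensor_rel K M N ts vs"
  | append: "\<lbrakk>tensor_rel K M N ts us; tensor_rel K M N ts' us'\<rbrakk> \<Longrightarrow>
      tensor_rel K M N (ts @ ts') (us @ us')"
  | commute: "\<lbrakk>set ts \<subseteq> carrier M \<times> carrier N; set us \<subseteq> carrier M \<times> carrier N\<rbrakk> \<Longrightarrow>
      tensor_rel K M N (ts @ us) (us @ ts)"
  | zero: "n \<in> carrier N \<Longrightarrow> tensor_rel K M N [(\<zero>\<^bsub>M\<^esub>, n)] []"
  | add_left: "\<lbrakk>m \<in> carrier M; m' \<in> carrier M; n \<in> carrier N\<rbrakk> \<Longrightarrow>
      tensor_rel K M N [(m \<oplus>\<^bsub>M\<^esub> m', n)] [(m, n), (m', n)]"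
  | add_right: "\<lbrakk>m \<in> carrier M; n \<in> carrier N; n' \<in> carrier N\<rbrakk> \<Longrightarrow>
      tensor_rel K M N [(m, n \<oplus>\<^bsub>N\<^esub> n')] [(m, n), (m, n')]"
  | balanced: "\<lbrakk>a \<in> carrier K; m \<in> carrier M; n \<in> carrier N\<rbrakk> \<Longrightarrow>
      tensor_rel K M N [(a \<odot>\<^bsub>M\<^esub> m, n)] [(m, a \<odot>\<^bsub>N\<^esub> n)]"

definition tensor_class ::
    "('k, 'r) ring_scheme \<Rightarrow> ('k, 'm, 'x) module_scheme \<Rightarrow> ('k, 'n, 'y) module_scheme
     \<Rightarrow> ('m \<times> 'n) list \<Rightarrow> ('m \<times> 'n) list set" where
  "tensor_class K M N ts = {us. tensor_rel K M N ts us}"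

text \<open>The tensor product of two modules, and of two algebras. The unions are over equal sets.\<close>

definition tensor ::
    "('k, 'r) ring_scheme \<Rightarrow> ('k, 'm, 'x) module_scheme \<Rightarrow> ('k, 'n, 'y) module_scheme
     \<Rightarrow> ('k, ('m \<times> 'n) list set) module" where
  "tensor K M N =
     \<lparr>carrier = tensor_class K M N ` {ts. set ts \<subseteq> carrier M \<times> carrier N},
      mult = (\<lambda>X Y. \<Union>ts\<in>X. \<Union>us\<in>Y.
        tensor_class K M N [(m \<otimes>\<^bsub>M\<^esub> m', n \<otimes>\<^bsub>N\<^esub> n'). (m, n) \<leftarrow> ts, (m', n') \<leftarrow> us]),
      one = tensor_class K M N [(\<one>\<^bsub>M\<^esub>, \<one>\<^bsub>N\<^esub>)],
      zero = tensor_class K M N [],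
      add = (\<lambda>X Y. \<Union>ts\<in>X. \<Union>us\<in>Y. tensor_class K M N (ts @ us)),
      smult = (\<lambda>a X. \<Union>ts\<in>X. tensor_class K M N [(a \<odot>\<^bsub>M\<^esub> m, n). (m, n) \<leftarrow> ts])\<rparr>"

text \<open>The linear map \<open>M \<otimes>\<^sub>K N \<rightarrow> P\<close> induced by a bilinear map \<open>\<beta>\<close>.\<close>

definition tensor_lift ::
    "('p, 'z) ring_scheme \<Rightarrow> ('m \<Rightarrow> 'n \<Rightarrow> 'p) \<Rightarrow> ('m \<times> 'n) list set \<Rightarrow> 'p" where
  "tensor_lift P \<beta> X =
     the_elem ((\<lambda>ts. foldr (\<oplus>\<^bsub>P\<^esub>) [\<beta> m n. (m, n) \<leftarrow> ts] \<zero>\<^bsub>P\<^esub>) ` X)"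

definition tensor_map ::
    "('k, 'r) ring_scheme \<Rightarrow> ('k, 'm, 'x) module_scheme \<Rightarrow> ('k, 'n, 'y) module_scheme
     \<Rightarrow> ('a \<Rightarrow> 'm) \<Rightarrow> ('b \<Rightarrow> 'n) \<Rightarrow> ('a \<times> 'b) list set \<Rightarrow> ('m \<times> 'n) list set" where
  "tensor_map K M N f g = tensor_lift (tensor K M N) (\<lambda>x y. tensor_class K M N [(f x, g y)])"

definition tensor_swap ::
    "('k, 'r) ring_scheme \<Rightarrow> ('k, 'm, 'x) module_scheme \<Rightarrow> ('k, 'n, 'y) module_scheme
     \<Rightarrow> ('m \<times> 'n) list set \<Rightarrow> ('n \<times> 'm) list set" where
  "tensor_swap K M N = tensor_lift (tensor K N M) (\<lambda>m n. tensor_class K N M [(n, m)])"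

text \<open>The associativity isomorphism \<open>(M \<otimes>\<^sub>K N) \<otimes>\<^sub>K P \<rightarrow> M \<otimes>\<^sub>K (N \<otimes>\<^sub>K P)\<close>.\<close>

definition tensor_assoc ::
    "('k, 'r) ring_scheme \<Rightarrow> ('k, 'm, 'x) module_scheme \<Rightarrow> ('k, 'n, 'y) module_scheme
     \<Rightarrow> ('k, 'p, 'z) module_scheme
     \<Rightarrow> (('m \<times> 'n) list set \<times> 'p) list set \<Rightarrow> ('m \<times> ('n \<times> 'p) list set) list set" where
  "tensor_assoc K M N P =
     (let T = tensor K M (tensor K N P) in
      tensor_lift T (\<lambda>X x. tensor_lift T
        (\<lambda>m n. tensor_class K M (tensor K N P) [(m, tensor_class K N P [(n, x)])]) X))"


section \<open>Affine commutative group schemes\<close>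

text \<open>An affine commutative group scheme \<open>G\<close>, that is, a commutative group object in the opposite
  of the category of commutative algebras, is represented by its coordinate ring \<open>H\<close>, a
  bicommutative Hopf algebra.\<close>

record ('k, 'h) hopf = "('k, 'h) module" +
  comult :: "'h \<Rightarrow> ('h \<times> 'h) list set"
  counit :: "'h \<Rightarrow> 'k"
  antipode :: "'h \<Rightarrow> 'h"

locale bicommutative_hopf_algebra = algebra K H
  for K :: "('k, 'r) ring_scheme" (structure) and H :: "('k, 'h) hopf" (structure) +
  assumes comult_hom: "comult H \<in> ring_hom H (tensor K H H) \<inter> linear_map K H (tensor K H H)"
    and counit_hom: "counit H \<in> ring_hom H K"
    and counit_linear: "\<lbrakk>a \<in> carrier K; h \<in> carrier H\<rbrakk> \<Longrightarrow> counit H (a \<odot>\<^bsub>H\<^esub> h) = a \<otimes>\<^bsub>K\<^esub> counit H h"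
    and antipode_linear: "antipode H \<in> linear_map K H H"
    and coassoc: "h \<in> carrier H \<Longrightarrow>
      tensor_assoc K H H H (tensor_map K (tensor K H H) H (comult H) (\<lambda>x. x) (comult H h))
      = tensor_map K H (tensor K H H) (\<lambda>x. x) (comult H) (comult H h)"
    and counit_left: "h \<in> carrier H \<Longrightarrow>
      tensor_lift H (\<lambda>x y. counit H x \<odot>\<^bsub>H\<^esub> y) (comult H h) = h"
    and counit_right: "h \<in> carrier H \<Longrightarrow>
      tensor_lift H (\<lambda>x y. counit H y \<odot>\<^bsub>H\<^esub> x) (comult H h) = h"
    and antipode_left: "h \<in> carrier H \<Longrightarrow>
      tensor_lift H (\<lambda>x y. antipode H x \<otimes>\<^bsub>H\<^esub> y) (comult H h) = counit H h \<odot>\<^bsub>H\<^esub> \<one>\<^bsub>H\<^esub>"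
    and antipode_right: "h \<in> carrier H \<Longrightarrow>
      tensor_lift H (\<lambda>x y. x \<otimes>\<^bsub>H\<^esub> antipode H y) (comult H h) = counit H h \<odot>\<^bsub>H\<^esub> \<one>\<^bsub>H\<^esub>"
    and cocomm: "h \<in> carrier H \<Longrightarrow> tensor_swap K H H (comult H h) = comult H h"

text \<open>The category of affine commutative group schemes is the opposite of that of bicommutative
  Hopf algebras: a morphism \<open>G \<rightarrow> G'\<close> is an element of \<open>hopf_hom K H' H\<close>.\<close>

definition hopf_hom ::
    "('k, 'r) ring_scheme \<Rightarrow> ('k, 'h) hopf \<Rightarrow> ('k, 'g) hopf \<Rightarrow> ('h \<Rightarrow> 'g) set" where
  "hopf_hom K H H' =
     {\<phi> \<in> alg_hom K H H'. \<forall>h\<in>carrier H.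
        comult H' (\<phi> h) = tensor_map K H' H' \<phi> \<phi> (comult H h) \<and>
        counit H' (\<phi> h) = counit H h \<and>
        antipode H' (\<phi> h) = \<phi> (antipode H h)}"

text \<open>The functor of points: the group \<open>G(R) = Hom(H, R)\<close> under convolution, and its action on
  algebra morphisms.\<close>

definition points ::
    "('k, 'r) ring_scheme \<Rightarrow> ('k, 'h) hopf \<Rightarrow> ('k, 'a, 'x) module_scheme \<Rightarrow> ('h \<Rightarrow> 'a) monoid" where
  "points K H R =
     \<lparr>carrier = alg_hom K H R,
      mult = (\<lambda>f g. \<lambda>h\<in>carrier H. tensor_lift R (\<lambda>x y. f x \<otimes>\<^bsub>R\<^esub> g y) (comult H h)),
      one = (\<lambda>h\<in>carrier H. counit H h \<odot>\<^bsub>R\<^esub> \<one>\<^bsub>R\<^esub>)\<rparr>"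

definition points_map :: "('k, 'h) hopf \<Rightarrow> ('a \<Rightarrow> 'b) \<Rightarrow> ('h \<Rightarrow> 'a) \<Rightarrow> ('h \<Rightarrow> 'b)" where
  "points_map H f x = compose (carrier H) f x"

text \<open>By Yoneda, the endomorphism of \<open>H\<close> representing multiplication by \<open>n\<close> on \<open>G\<close> is the \<open>n\<close>-fold
  multiple of the identity in \<open>G(H)\<close>.\<close>

definition hopf_mult_by :: "('k, 'r) ring_scheme \<Rightarrow> ('k, 'h) hopf \<Rightarrow> nat \<Rightarrow> 'h \<Rightarrow> 'h" where
  "hopf_mult_by K H n = (\<lambda>h\<in>carrier H. h) [^]\<^bsub>points K H H\<^esub> n"

text \<open>The kernel of \<open>\<phi>: H \<rightarrow> H'\<close> in the category of bicommutative Hopf algebras is the Hopf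
  subalgebra of all \<open>h\<close> such that \<open>(id \<otimes> \<phi>)(\<Delta> h) = h \<otimes> 1\<close>.\<close>

definition hopf_kernel ::
    "('k, 'r) ring_scheme \<Rightarrow> ('k, 'h) hopf \<Rightarrow> ('k, 'g) hopf \<Rightarrow> ('h \<Rightarrow> 'g) \<Rightarrow> 'h set" where
  "hopf_kernel K H H' \<phi> =
     {h \<in> carrier H. tensor_map K H H' (\<lambda>x. x) \<phi> (comult H h) = tensor_class K H H' [(h, \<one>\<^bsub>H'\<^esub>)]}"

text \<open>\<open>p\<close>-adic groups are those for which \<open>H\<close> is the colimit of the increasing sequence of Hopf
  subalgebras \<open>H[p\<^sup>n]\<close>, that is, their union.\<close>

definition AbSch_padic :: "('k, 'r) ring_scheme \<Rightarrow> nat \<Rightarrow> ('k, 'h) hopf set" where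
  "AbSch_padic K p =
     {H. bicommutative_hopf_algebra K H \<and>
         (\<Union>n. hopf_kernel K H H (hopf_mult_by K H (p ^ n))) = carrier H}"


section \<open>Functors to abelian groups\<close>

text \<open>The underlying type for the values of a functor from polar algebras over the type \<open>'a\<close>
  associated with a Hopf algebra over the type \<open>'h\<close>. An existential statement has to name such a
  type. While \<open>G(R) = Hom(H, R)\<close> lives in \<open>'h \<Rightarrow> 'a\<close>, values at polar algebras that are not of the
  form \<open>pol R\<close> may need more room, say for formal sums of monomials with factors in \<open>'a\<close>.\<close>

type_synonym ('h, 'a) polar_point = "'h \<Rightarrow> 'a list list set"

text \<open>A concrete category is given by a set of structures \<open>Ob\<close> and sets \<open>Hom A B\<close> of extensional
  functions; \<open>F\<close> and \<open>Fm\<close> are the effects of a functor on objects and on morphisms.\<close>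

definition ab_functor ::
    "('a, 'x) partial_object_scheme set
     \<Rightarrow> (('a, 'x) partial_object_scheme \<Rightarrow> ('a, 'x) partial_object_scheme \<Rightarrow> ('a \<Rightarrow> 'a) set)
     \<Rightarrow> (('a, 'x) partial_object_scheme \<Rightarrow> 'g monoid)
     \<Rightarrow> (('a, 'x) partial_object_scheme \<Rightarrow> ('a, 'x) partial_object_scheme \<Rightarrow> ('a \<Rightarrow> 'a) \<Rightarrow> 'g \<Rightarrow> 'g)
     \<Rightarrow> bool" where
  "ab_functor Ob Hom F Fm \<longleftrightarrow>
     (\<forall>A\<in>Ob. comm_group (F A)) \<and>
     (\<forall>A\<in>Ob. \<forall>B\<in>Ob. \<forall>f\<in>Hom A B. Fm A B f \<in> hom (F A) (F B)) \<and>
     (\<forall>A\<in>Ob. \<forall>x\<in>carrier (F A). Fm A A (\<lambda>y\<in>carrier A. y) x = x) \<and>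
     (\<forall>A\<in>Ob. \<forall>B\<in>Ob. \<forall>C\<in>Ob. \<forall>f\<in>Hom A B. \<forall>g\<in>Hom B C. \<forall>x\<in>carrier (F A).
        Fm A C (compose (carrier A) g f) x = Fm B C g (Fm A B f x))"

definition ab_nat_trans ::
    "('a, 'x) partial_object_scheme set
     \<Rightarrow> (('a, 'x) partial_object_scheme \<Rightarrow> ('a, 'x) partial_object_scheme \<Rightarrow> ('a \<Rightarrow> 'a) set)
     \<Rightarrow> (('a, 'x) partial_object_scheme \<Rightarrow> 'g monoid)
     \<Rightarrow> (('a, 'x) partial_object_scheme \<Rightarrow> ('a, 'x) partial_object_scheme \<Rightarrow> ('a \<Rightarrow> 'a) \<Rightarrow> 'g \<Rightarrow> 'g)
     \<Rightarrow> (('a, 'x) partial_object_scheme \<Rightarrow> 'h monoid)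
     \<Rightarrow> (('a, 'x) partial_object_scheme \<Rightarrow> ('a, 'x) partial_object_scheme \<Rightarrow> ('a \<Rightarrow> 'a) \<Rightarrow> 'h \<Rightarrow> 'h)
     \<Rightarrow> (('a, 'x) partial_object_scheme \<Rightarrow> 'g \<Rightarrow> 'h) \<Rightarrow> bool" where
  "ab_nat_trans Ob Hom F Fm F' Fm' \<eta> \<longleftrightarrow>
     ab_functor Ob Hom F Fm \<and> ab_functor Ob Hom F' Fm' \<and>
     (\<forall>A\<in>Ob. \<eta> A \<in> hom (F A) (F' A)) \<and>
     (\<forall>A\<in>Ob. \<forall>B\<in>Ob. \<forall>f\<in>Hom A B. \<forall>x\<in>carrier (F A). \<eta> B (Fm A B f x) = Fm' A B f (\<eta> A x))"

definition ab_nat_iso ::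
    "('a, 'x) partial_object_scheme set
     \<Rightarrow> (('a, 'x) partial_object_scheme \<Rightarrow> ('a, 'x) partial_object_scheme \<Rightarrow> ('a \<Rightarrow> 'a) set)
     \<Rightarrow> (('a, 'x) partial_object_scheme \<Rightarrow> 'g monoid)
     \<Rightarrow> (('a, 'x) partial_object_scheme \<Rightarrow> ('a, 'x) partial_object_scheme \<Rightarrow> ('a \<Rightarrow> 'a) \<Rightarrow> 'g \<Rightarrow> 'g)
     \<Rightarrow> (('a, 'x) partial_object_scheme \<Rightarrow> 'h monoid)
     \<Rightarrow> (('a, 'x) partial_object_scheme \<Rightarrow> ('a, 'x) partial_object_scheme \<Rightarrow> ('a \<Rightarrow> 'a) \<Rightarrow> 'h \<Rightarrow> 'h)
     \<Rightarrow> (('a, 'x) partial_object_scheme \<Rightarrow> 'g \<Rightarrow> 'h) \<Rightarrow> bool" where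
  "ab_nat_iso Ob Hom F Fm F' Fm' \<eta> \<longleftrightarrow>
     ab_nat_trans Ob Hom F Fm F' Fm' \<eta> \<and> (\<forall>A\<in>Ob. \<eta> A \<in> iso (F A) (F' A))"

end

theory Submission
  imports Defs "HOL-Number_Theory.Residues"
begin

text \<open>
  To a polar algebra \<open>A\<close> attach its envelope \<open>E(A)\<close>, the universal unital algebra with a linear
  map \<open>A \<rightarrow> E(A)\<close> turning \<open>\<mu>\<close> into the \<open>p\<close>-fold product. Since \<open>z ^ p = z\<close> in the prime field,
  scaling \<open>A\<close> by \<open>z\<close> induces an endomorphism \<open>\<sigma> z\<close> of \<open>E(A)\<close>, and the functor on polar algebras is the
  eigenspace \<open>{f \<in> G(E(A)). \<sigma> z f = [z] f for all z}\<close>, where \<open>[z] = lim z ^ p ^ n\<close> is the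
  Teichmueller representative of \<open>z\<close> in the \<open>p\<close>-adic integers, which act on \<open>G\<close>. If \<open>A = pol R\<close>, then
  \<open>E(A)\<close> is \<open>K \<times> R ^ (p - 1)\<close>, the factors \<open>R\<close> being indexed by the units of the prime field and
  permuted simply transitively by the \<open>\<sigma> z\<close>. So an element of the eigenspace is determined by its
  component at \<open>1\<close>, which is arbitrary. The case \<open>z = 0\<close> of the condition makes the component in
  \<open>K\<close> trivial.
\<close>

text \<open>Two mechanisms drive the proof. Exponents: \<open>H\<close> is the union of the kernels
  \<open>H[p^n]\<close>, and on \<open>H[p^n]\<close> a convolution power depends only on its
  exponent modulo p^n. So a coherent sequence of residues acts on points, and each value of the
  limit is reached after finitely many steps: convergence is eventual equality. The residues z^(p^n)
  give the action of the Teichmueller representative, the residues p^n - 1 that of -1, hence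
  inverses. Splitting: in the envelope of \<open>pol p R\<close> let e be the image of 1. The tuple
  x, 1, ..., 1 has product x, so e^(p-1) fixes every generator and a word collapses to some x e^j
  with j taken modulo p - 1. Its component at z is z^(j+1) x. Since the units of the prime field are
  the roots of t^(p-1) - 1, finite Fourier inversion recovers the element from its components; the
  weights z^(-j) / (p - 1) explain the recurring factor p - 1, which is its own inverse modulo p. An
  obstacle of form: the envelope has coefficients in \<open>'k\<close>, but the prescribed type
  \<open>polar_point\<close> does not mention \<open>'k\<close>. The groups are therefore moved
  along an injection at the end.\<close>

definition lsum :: "('a, 'x) ring_scheme \<Rightarrow> 'a list \<Rightarrow> 'a" where
  "lsum R xs = foldr (\<oplus>\<^bsub>R\<^esub>) xs \<zero>\<^bsub>R\<^esub>"

lemma lsum_simps [simp]: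
  "lsum R [] = \<zero>\<^bsub>R\<^esub>"
  "lsum R (x # xs) = x \<oplus>\<^bsub>R\<^esub> lsum R xs"
  by (simp_all add: lsum_def)

lemma (in abelian_monoid) lsum_closed [simp]: "set xs \<subseteq> carrier G \<Longrightarrow> lsum G xs \<in> carrier G"
  by (induction xs) auto

lemma (in abelian_monoid) lsum_append [simp]:
  "\<lbrakk>set xs \<subseteq> carrier G; set ys \<subseteq> carrier G\<rbrakk> \<Longrightarrow> lsum G (xs @ ys) = lsum G xs \<oplus> lsum G ys"
  by (induction xs) (auto simp: a_assoc)

lemma (in abelian_monoid) lsum_add:
  "\<lbrakk>\<And>t. t \<in> set ts \<Longrightarrow> f t \<in> carrier G; \<And>t. t \<in> set ts \<Longrightarrow> g t \<in> carrier G\<rbrakk> \<Longrightarrow>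
   lsum G (map (\<lambda>t. f t \<oplus> g t) ts) = lsum G (map f ts) \<oplus> lsum G (map g ts)"
proof (induction ts)
  case (Cons t ts)
  then have "set (map f ts) \<subseteq> carrier G" "set (map g ts) \<subseteq> carrier G" by auto
  with Cons show ?case by (simp add: a_ac)
qed simp

lemma additive_lsum:
  assumes "abelian_group M" "abelian_group N"
    and f: "f \<in> carrier M \<rightarrow> carrier N"
      "\<And>x y. \<lbrakk>x \<in> carrier M; y \<in> carrier M\<rbrakk> \<Longrightarrow> f (x \<oplus>\<^bsub>M\<^esub> y) = f x \<oplus>\<^bsub>N\<^esub> f y"
    and xs: "set xs \<subseteq> carrier M"
  shows "f (lsum M xs) = lsum N (map f xs)" and "f \<zero>\<^bsub>M\<^esub> = \<zero>\<^bsub>N\<^esub>"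
proof -
  interpret M: abelian_group M by fact
  interpret N: abelian_group N by fact
  have "f \<zero>\<^bsub>M\<^esub> \<oplus>\<^bsub>N\<^esub> f \<zero>\<^bsub>M\<^esub> = f \<zero>\<^bsub>M\<^esub>" using f(2)[of "\<zero>\<^bsub>M\<^esub>" "\<zero>\<^bsub>M\<^esub>"] by simp
  then show 0: "f \<zero>\<^bsub>M\<^esub> = \<zero>\<^bsub>N\<^esub>"
    using f(1) by (metis M.zero_closed N.add.r_cancel_one' Pi_iff)
  show "f (lsum M xs) = lsum N (map f xs)"
    using xs by (induction xs) (auto simp: 0 f(2))
qed


section \<open>Linear and bilinear maps\<close>

lemma linear_mapD:
  assumes "f \<in> linear_map K M N"
  shows "x \<in> carrier M \<Longrightarrow> f x \<in> carrier N"
    and "\<lbrakk>x \<in> carrier M; y \<in> carrier M\<rbrakk> \<Longrightarrow> f (x \<oplus>\<^bsub>M\<^esub> y) = f x \<oplus>\<^bsub>N\<^esub> f y"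
    and "\<lbrakk>a \<in> carrier K; x \<in> carrier M\<rbrakk> \<Longrightarrow> f (a \<odot>\<^bsub>M\<^esub> x) = a \<odot>\<^bsub>N\<^esub> f x"
  using assms by (auto simp: linear_map_def)

lemma linear_map_lsum:
  assumes "Module.module K M" "Module.module K N" "f \<in> linear_map K M N"
  shows "set xs \<subseteq> carrier M \<Longrightarrow> f (lsum M xs) = lsum N (map f xs)" and "f \<zero>\<^bsub>M\<^esub> = \<zero>\<^bsub>N\<^esub>"
proof -
  have *: "abelian_group M" "abelian_group N" using assms(1,2) by (auto simp: Module.module_def)
  have f: "f \<in> carrier M \<rightarrow> carrier N"
      "\<And>x y. \<lbrakk>x \<in> carrier M; y \<in> carrier M\<rbrakk> \<Longrightarrow> f (x \<oplus>\<^bsub>M\<^esub> y) = f x \<oplus>\<^bsub>N\<^esub> f y"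
    using assms(3) by (auto simp: linear_map_def)
  show "set xs \<subseteq> carrier M \<Longrightarrow> f (lsum M xs) = lsum N (map f xs)"
    using additive_lsum(1)[OF * f] .
  show "f \<zero>\<^bsub>M\<^esub> = \<zero>\<^bsub>N\<^esub>" using additive_lsum(2)[OF * f, of "[]"] by simp
qed

definition bilinear ::
    "('k, 'r) ring_scheme \<Rightarrow> ('k, 'm, 'x) module_scheme \<Rightarrow> ('k, 'n, 'y) module_scheme
     \<Rightarrow> ('k, 'p, 'z) module_scheme \<Rightarrow> ('m \<Rightarrow> 'n \<Rightarrow> 'p) \<Rightarrow> bool" where
  "bilinear K M N P \<beta> \<longleftrightarrow>
     (\<forall>m\<in>carrier M. \<beta> m \<in> linear_map K N P) \<and> (\<forall>n\<in>carrier N. (\<lambda>m. \<beta> m n) \<in> linear_map K M P)"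

lemma bilinearD:
  assumes "bilinear K M N P \<beta>"
  shows "\<lbrakk>m \<in> carrier M; n \<in> carrier N\<rbrakk> \<Longrightarrow> \<beta> m n \<in> carrier P"
    and "\<lbrakk>m \<in> carrier M; m' \<in> carrier M; n \<in> carrier N\<rbrakk> \<Longrightarrow> \<beta> (m \<oplus>\<^bsub>M\<^esub> m') n = \<beta> m n \<oplus>\<^bsub>P\<^esub> \<beta> m' n"
    and "\<lbrakk>m \<in> carrier M; n \<in> carrier N; n' \<in> carrier N\<rbrakk> \<Longrightarrow> \<beta> m (n \<oplus>\<^bsub>N\<^esub> n') = \<beta> m n \<oplus>\<^bsub>P\<^esub> \<beta> m n'"
    and "\<lbrakk>a \<in> carrier K; m \<in> carrier M; n \<in> carrier N\<rbrakk> \<Longrightarrow> \<beta> (a \<odot>\<^bsub>M\<^esub> m) n = a \<odot>\<^bsub>P\<^esub> \<beta> m n"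
    and "\<lbrakk>a \<in> carrier K; m \<in> carrier M; n \<in> carrier N\<rbrakk> \<Longrightarrow> \<beta> m (a \<odot>\<^bsub>N\<^esub> n) = a \<odot>\<^bsub>P\<^esub> \<beta> m n"
  using assms by (auto simp: bilinear_def linear_map_def)

lemma bilinearI:
  assumes "\<And>m n. \<lbrakk>m \<in> carrier M; n \<in> carrier N\<rbrakk> \<Longrightarrow> \<beta> m n \<in> carrier P"
    and "\<And>m m' n. \<lbrakk>m \<in> carrier M; m' \<in> carrier M; n \<in> carrier N\<rbrakk> \<Longrightarrow> \<beta> (m \<oplus>\<^bsub>M\<^esub> m') n = \<beta> m n \<oplus>\<^bsub>P\<^esub> \<beta> m' n"
    and "\<And>m n n'. \<lbrakk>m \<in> carrier M; n \<in> carrier N; n' \<in> carrier N\<rbrakk> \<Longrightarrow> \<beta> m (n \<oplus>\<^bsub>N\<^esub> n') = \<beta> m n \<oplus>\<^bsub>P\<^esub> \<beta> m n'"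
    and "\<And>a m n. \<lbrakk>a \<in> carrier K; m \<in> carrier M; n \<in> carrier N\<rbrakk> \<Longrightarrow> \<beta> (a \<odot>\<^bsub>M\<^esub> m) n = a \<odot>\<^bsub>P\<^esub> \<beta> m n"
    and "\<And>a m n. \<lbrakk>a \<in> carrier K; m \<in> carrier M; n \<in> carrier N\<rbrakk> \<Longrightarrow> \<beta> m (a \<odot>\<^bsub>N\<^esub> n) = a \<odot>\<^bsub>P\<^esub> \<beta> m n"
  shows "bilinear K M N P \<beta>"
  using assms by (auto simp: bilinear_def linear_map_def)


section \<open>Tensor products\<close>

locale module_pair = M: Module.module K M + N: Module.module K N
  for K :: "('k, 'r) ring_scheme" and M :: "('k, 'm, 'x) module_scheme"
    and N :: "('k, 'n, 'y) module_scheme"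
begin

abbreviation cls where "cls \<equiv> tensor_class K M N"
abbreviation T where "T \<equiv> tensor K M N"

definition fsums :: "('m \<times> 'n) list set" where
  "fsums = {ts. set ts \<subseteq> carrier M \<times> carrier N}"

lemma fsums_simps [simp]:
  "[] \<in> fsums" "(m, n) # ts \<in> fsums \<longleftrightarrow> m \<in> carrier M \<and> n \<in> carrier N \<and> ts \<in> fsums"
  "ts @ us \<in> fsums \<longleftrightarrow> ts \<in> fsums \<and> us \<in> fsums"
  by (auto simp: fsums_def)

lemma fsumsD: "\<lbrakk>ts \<in> fsums; (m, n) \<in> set ts\<rbrakk> \<Longrightarrow> m \<in> carrier M \<and> n \<in> carrier N"
  by (auto simp: fsums_def)

lemma rel_fsums: "tensor_rel K M N ts us \<Longrightarrow> ts \<in> fsums \<and> us \<in> fsums"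
  by (induction rule: tensor_rel.induct) (auto simp: fsums_def)

lemma rel_refl: "ts \<in> fsums \<Longrightarrow> tensor_rel K M N ts ts"
  by (auto simp: fsums_def intro: tensor_rel.refl)

text \<open>A list outside \<open>fsums\<close> is related to nothing and has the empty class.
  Having one list in \<open>fsums\<close> excludes an accidental equality of empty classes.\<close>

lemma class_eq_iff:
  assumes "ts \<in> fsums"
  shows "cls ts = cls us \<longleftrightarrow> tensor_rel K M N ts us"
proof
  assume "cls ts = cls us"
  moreover have "ts \<in> cls ts" using rel_refl[OF assms] by (simp add: tensor_class_def)
  ultimately show "tensor_rel K M N ts us"
    by (auto simp: tensor_class_def intro: tensor_rel.sym)
qed (auto simp: tensor_class_def intro: tensor_rel.sym tensor_rel.trans)

lemma class_eqI: "tensor_rel K M N ts us \<Longrightarrow> cls ts = cls us"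
  using class_eq_iff rel_fsums by blast

lemma self_in_class: "ts \<in> fsums \<Longrightarrow> ts \<in> cls ts"
  using rel_refl by (simp add: tensor_class_def)

lemma in_classD: "ts' \<in> cls ts \<Longrightarrow> tensor_rel K M N ts ts'" "ts' \<in> cls ts \<Longrightarrow> cls ts' = cls ts"
  "ts' \<in> cls ts \<Longrightarrow> ts' \<in> fsums"
  using class_eqI rel_fsums by (force simp: tensor_class_def)+

lemma carrier_T: "carrier T = cls ` fsums"
  by (simp add: tensor_def fsums_def)

text \<open>Scalars act on the left factors. In the \<open>balanced\<close> case two scalars have to
  change places, by commutativity of \<open>K\<close>.\<close>

lemma rel_smult:
  "tensor_rel K M N ts us \<Longrightarrow> a \<in> carrier K \<Longrightarrow>
   tensor_rel K M N [(a \<odot>\<^bsub>M\<^esub> m, n). (m, n) \<leftarrow> ts] [(a \<odot>\<^bsub>M\<^esub> m, n). (m, n) \<leftarrow> us]"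
proof (induction rule: tensor_rel.induct)
  case (refl ts)
  then show ?case by (intro tensor_rel.refl) auto
next
  case (commute ts us)
  then show ?case unfolding map_append by (intro tensor_rel.commute) auto
next
  case (zero n)
  then show ?case by (auto intro!: tensor_rel.zero)
next
  case (add_left m m' n)
  then show ?case by (auto simp: M.smult_r_distr intro!: tensor_rel.add_left)
next
  case (add_right m n n')
  then show ?case by (auto intro!: tensor_rel.add_right)
next
  case (balanced b m n)
  then have "a \<odot>\<^bsub>M\<^esub> (b \<odot>\<^bsub>M\<^esub> m) = b \<odot>\<^bsub>M\<^esub> (a \<odot>\<^bsub>M\<^esub> m)"
    by (metis M.smult_assoc1 M.R.m_comm)
  with balanced show ?case by (auto intro!: tensor_rel.balanced)
qed (auto intro: tensor_rel.intros)

lemma T_zero: "\<zero>\<^bsub>T\<^esub> = cls []"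
  by (simp add: tensor_def)

text \<open>The operations of \<open>tensor\<close> are unions over all representatives; such a
  union collapses as soon as the result does not depend on them.\<close>

lemma UN_class:
  assumes "ts \<in> fsums" "us \<in> fsums"
    and "\<And>ts' us'. \<lbrakk>ts' \<in> cls ts; us' \<in> cls us\<rbrakk> \<Longrightarrow> F ts' us' = S"
  shows "(\<Union>ts\<in>cls ts. \<Union>us\<in>cls us. F ts us) = S"
  using assms self_in_class by force

lemma T_add:
  assumes "ts \<in> fsums" "us \<in> fsums"
  shows "cls ts \<oplus>\<^bsub>T\<^esub> cls us = cls (ts @ us)"
proof -
  have "cls ts \<oplus>\<^bsub>T\<^esub> cls us = (\<Union>ts\<in>cls ts. \<Union>us\<in>cls us. cls (ts @ us))"
    by (simp add: tensor_def)
  also have "\<dots> = cls (ts @ us)"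
    using assms
    by (rule UN_class) (rule class_eqI[OF tensor_rel.append, symmetric], simp_all add: in_classD(1))
  finally show ?thesis .
qed

lemma T_smult:
  assumes "ts \<in> fsums" "a \<in> carrier K"
  shows "a \<odot>\<^bsub>T\<^esub> cls ts = cls [(a \<odot>\<^bsub>M\<^esub> m, n). (m, n) \<leftarrow> ts]"
proof -
  have "a \<odot>\<^bsub>T\<^esub> cls ts = (\<Union>ts\<in>cls ts. cls [(a \<odot>\<^bsub>M\<^esub> m, n). (m, n) \<leftarrow> ts])"
    by (simp add: tensor_def)
  also have "\<dots> = cls [(a \<odot>\<^bsub>M\<^esub> m, n). (m, n) \<leftarrow> ts]"
  proof -
    have "cls [(a \<odot>\<^bsub>M\<^esub> m, n). (m, n) \<leftarrow> us] = cls [(a \<odot>\<^bsub>M\<^esub> m, n). (m, n) \<leftarrow> ts]" if "us \<in> cls ts" for us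
      using class_eqI[OF rel_smult[OF in_classD(1)[OF that] assms(2)]] by simp
    moreover have "cls ts \<noteq> {}" using self_in_class[OF assms(1)] by blast
    ultimately show ?thesis by (metis (no_types, lifting) SUP_eq_const)
  qed
  finally show ?thesis .
qed

lemma T_cases:
  assumes "X \<in> carrier T"
  obtains ts where "ts \<in> fsums" "X = cls ts"
  using assms by (auto simp: carrier_T)

lemma smult_fsums [simp]:
  "\<lbrakk>ts \<in> fsums; a \<in> carrier K\<rbrakk> \<Longrightarrow> [(a \<odot>\<^bsub>M\<^esub> m, n). (m, n) \<leftarrow> ts] \<in> fsums"
  by (auto simp: fsums_def)

lemma class_closed [simp]: "ts \<in> fsums \<Longrightarrow> cls ts \<in> carrier T"
  by (simp add: carrier_T)

text \<open>\<open>add_left\<close> splits every term, which leaves the terms with a and those with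
  b interleaved; \<open>commute\<close> sorts them. The case a = -1, b = 1 provides the additive
  inverses in \<open>module_T\<close>.\<close>

lemma class_smult_distr:
  assumes "a \<in> carrier K" "b \<in> carrier K" "ts \<in> fsums"
  shows "cls [((a \<oplus>\<^bsub>K\<^esub> b) \<odot>\<^bsub>M\<^esub> m, n). (m, n) \<leftarrow> ts] =
    cls ([(a \<odot>\<^bsub>M\<^esub> m, n). (m, n) \<leftarrow> ts] @ [(b \<odot>\<^bsub>M\<^esub> m, n). (m, n) \<leftarrow> ts])"
  using assms(3)
proof (induction ts)
  case (Cons t ts)
  obtain m n where t: "t = (m, n)" by (cases t)
  define A where "A = [(a \<odot>\<^bsub>M\<^esub> m, n). (m, n) \<leftarrow> ts]"
  define B where "B = [(b \<odot>\<^bsub>M\<^esub> m, n). (m, n) \<leftarrow> ts]"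
  have [simp]: "m \<in> carrier M" "n \<in> carrier N" "ts \<in> fsums" "A \<in> fsums" "B \<in> fsums"
    using Cons.prems assms by (simp_all add: t A_def B_def del: map_eq_conv)
  have [simp]: "a \<in> carrier K" "b \<in> carrier K" by fact+
  have "tensor_rel K M N ([((a \<oplus>\<^bsub>K\<^esub> b) \<odot>\<^bsub>M\<^esub> m, n)] @ [((a \<oplus>\<^bsub>K\<^esub> b) \<odot>\<^bsub>M\<^esub> m, n). (m, n) \<leftarrow> ts])
    ([(a \<odot>\<^bsub>M\<^esub> m, n), (b \<odot>\<^bsub>M\<^esub> m, n)] @ (A @ B))"
  proof (rule tensor_rel.append)
    show "tensor_rel K M N [((a \<oplus>\<^bsub>K\<^esub> b) \<odot>\<^bsub>M\<^esub> m, n). (m, n) \<leftarrow> ts] (A @ B)"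
      using Cons.IH[folded A_def B_def] assms(1,2)
        class_eq_iff[of "[((a \<oplus>\<^bsub>K\<^esub> b) \<odot>\<^bsub>M\<^esub> m, n). (m, n) \<leftarrow> ts]" "A @ B"] by simp
  qed (auto simp: M.smult_l_distr intro!: tensor_rel.add_left)
  moreover have "tensor_rel K M N ([(a \<odot>\<^bsub>M\<^esub> m, n)] @ (([(b \<odot>\<^bsub>M\<^esub> m, n)] @ A) @ B))
     ([(a \<odot>\<^bsub>M\<^esub> m, n)] @ ((A @ [(b \<odot>\<^bsub>M\<^esub> m, n)]) @ B))"
    by (intro tensor_rel.append tensor_rel.commute tensor_rel.refl)
      (use \<open>A \<in> fsums\<close> \<open>B \<in> fsums\<close> in \<open>auto simp: fsums_def\<close>)
  ultimately show ?case
    by (intro class_eqI) (simp add: t A_def B_def tensor_rel.trans)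
qed simp

lemma module_T: "Module.module K T"
proof (rule moduleI)
  show "abelian_group T"
  proof (rule abelian_groupI)
    fix X assume "X \<in> carrier T"
    then obtain ts where ts: "ts \<in> fsums" "X = cls ts" by (rule T_cases)
    \<comment> \<open>The inverse of a formal sum is its multiple by -1: together they give the
      multiple by 0, whose terms \<open>(\<zero>, n)\<close> vanish by the rule
      \<open>zero\<close>.\<close>
    have "cls ([(\<ominus>\<^bsub>K\<^esub> \<one>\<^bsub>K\<^esub> \<odot>\<^bsub>M\<^esub> m, n). (m, n) \<leftarrow> ts] @ [(\<one>\<^bsub>K\<^esub> \<odot>\<^bsub>M\<^esub> m, n). (m, n) \<leftarrow> ts]) =
      cls [((\<ominus>\<^bsub>K\<^esub> \<one>\<^bsub>K\<^esub> \<oplus>\<^bsub>K\<^esub> \<one>\<^bsub>K\<^esub>) \<odot>\<^bsub>M\<^esub> m, n). (m, n) \<leftarrow> ts]"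
      using ts by (subst class_smult_distr) auto
    also have "[(\<one>\<^bsub>K\<^esub> \<odot>\<^bsub>M\<^esub> m, n). (m, n) \<leftarrow> ts] = ts"
      using ts(1) by (induction ts) auto
    also have "[((\<ominus>\<^bsub>K\<^esub> \<one>\<^bsub>K\<^esub> \<oplus>\<^bsub>K\<^esub> \<one>\<^bsub>K\<^esub>) \<odot>\<^bsub>M\<^esub> m, n). (m, n) \<leftarrow> ts] = [(\<zero>\<^bsub>M\<^esub>, n). (m, n) \<leftarrow> ts]"
      using ts(1) by (induction ts) (auto simp: M.R.l_neg)
    also have "tensor_rel K M N [(\<zero>\<^bsub>M\<^esub>, n). (m, n) \<leftarrow> ts] []"
      using ts(1)
    proof (induction ts)
      case (Cons t ts)
      obtain m n where "t = (m, n)" by (cases t)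
      with Cons tensor_rel.append[OF tensor_rel.zero[of n N K M], of "[(\<zero>\<^bsub>M\<^esub>, n). (m, n) \<leftarrow> ts]" "[]"]
      show ?case by auto
    qed (auto intro: rel_refl)
    then have "cls [(\<zero>\<^bsub>M\<^esub>, n). (m, n) \<leftarrow> ts] = cls []" by (rule class_eqI)
    finally show "\<exists>Y\<in>carrier T. Y \<oplus>\<^bsub>T\<^esub> X = \<zero>\<^bsub>T\<^esub>"
      using ts by (intro bexI[of _ "cls [(\<ominus>\<^bsub>K\<^esub> \<one>\<^bsub>K\<^esub> \<odot>\<^bsub>M\<^esub> m, n). (m, n) \<leftarrow> ts]"]) (auto simp: T_add T_zero)
  next
    fix X Y assume "X \<in> carrier T" "Y \<in> carrier T"
    then obtain ts us where "ts \<in> fsums" "X = cls ts" "us \<in> fsums" "Y = cls us"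
      by (metis T_cases)
    then show "X \<oplus>\<^bsub>T\<^esub> Y = Y \<oplus>\<^bsub>T\<^esub> X"
      using class_eqI[OF tensor_rel.commute[of ts M N us K]]
      by (simp add: T_add) (simp add: fsums_def)
  qed (auto elim!: T_cases simp: T_zero T_add)
next
  fix a b X assume ab: "a \<in> carrier K" "b \<in> carrier K" and "X \<in> carrier T"
  then obtain ts where ts: "ts \<in> fsums" "X = cls ts" by (metis T_cases)
  show "(a \<oplus>\<^bsub>K\<^esub> b) \<odot>\<^bsub>T\<^esub> X = (a \<odot>\<^bsub>T\<^esub> X) \<oplus>\<^bsub>T\<^esub> (b \<odot>\<^bsub>T\<^esub> X)"
    using ts ab class_smult_distr[OF ab ts(1)] by (simp add: T_smult T_add)
  have "[((a \<otimes>\<^bsub>K\<^esub> b) \<odot>\<^bsub>M\<^esub> m, n). (m, n) \<leftarrow> ts] = [(a \<odot>\<^bsub>M\<^esub> m, n). (m, n) \<leftarrow> [(b \<odot>\<^bsub>M\<^esub> m, n). (m, n) \<leftarrow> ts]]"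
    using ts(1) ab by (induction ts) (auto simp: M.smult_assoc1)
  then show "(a \<otimes>\<^bsub>K\<^esub> b) \<odot>\<^bsub>T\<^esub> X = a \<odot>\<^bsub>T\<^esub> (b \<odot>\<^bsub>T\<^esub> X)"
    using ts ab smult_fsums[OF ts(1) ab(2)] by (simp add: T_smult del: map_map)
next
  fix X assume "X \<in> carrier T"
  then obtain ts where ts: "ts \<in> fsums" "X = cls ts" by (rule T_cases)
  moreover have "[(\<one>\<^bsub>K\<^esub> \<odot>\<^bsub>M\<^esub> m, n). (m, n) \<leftarrow> ts] = ts"
      using ts(1) by (induction ts) auto
  ultimately show "\<one>\<^bsub>K\<^esub> \<odot>\<^bsub>T\<^esub> X = X"
    by (simp add: T_smult)
qed (auto elim!: T_cases simp: T_smult T_add M.R.is_cring)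

section \<open>The universal property of the tensor product\<close>

definition bsum :: "('p, 'z) ring_scheme \<Rightarrow> ('m \<Rightarrow> 'n \<Rightarrow> 'p) \<Rightarrow> ('m \<times> 'n) list \<Rightarrow> 'p" where
  "bsum P \<beta> ts = lsum P [\<beta> m n. (m, n) \<leftarrow> ts]"

lemma bsum_simps [simp]:
  "bsum P \<beta> [] = \<zero>\<^bsub>P\<^esub>" "bsum P \<beta> ((m, n) # ts) = \<beta> m n \<oplus>\<^bsub>P\<^esub> bsum P \<beta> ts"
  by (simp_all add: bsum_def)

lemma bsum_closed [simp]:
  assumes "abelian_monoid P" "ts \<in> fsums" "\<And>m n. \<lbrakk>m \<in> carrier M; n \<in> carrier N\<rbrakk> \<Longrightarrow> \<beta> m n \<in> carrier P"
  shows "bsum P \<beta> ts \<in> carrier P"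
  unfolding bsum_def using assms by (intro abelian_monoid.lsum_closed) (auto dest: fsumsD)

lemma bsum_append:
  assumes "abelian_monoid P" "ts \<in> fsums" "us \<in> fsums"
    "\<And>m n. \<lbrakk>m \<in> carrier M; n \<in> carrier N\<rbrakk> \<Longrightarrow> \<beta> m n \<in> carrier P"
  shows "bsum P \<beta> (ts @ us) = bsum P \<beta> ts \<oplus>\<^bsub>P\<^esub> bsum P \<beta> us"
  unfolding bsum_def map_append using assms
  by (intro abelian_monoid.lsum_append) (auto dest: fsumsD)

lemma bsum_rel:
  assumes "Module.module K P" "bilinear K M N P \<beta>" "tensor_rel K M N ts us"
  shows "bsum P \<beta> ts = bsum P \<beta> us"
proof -
  interpret P: Module.module K P by fact
  note b = bilinearD[OF assms(2)]
  show ?thesis using assms(3)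
  proof (induction rule: tensor_rel.induct)
    case (append ts us ts' us')
    then show ?case by (auto dest!: rel_fsums simp: bsum_append b P.abelian_monoid_axioms)
  next
    case (commute ts us)
    then have "ts \<in> fsums" "us \<in> fsums" by (auto simp: fsums_def)
    then show ?case
      by (auto simp: bsum_append b P.abelian_monoid_axioms P.M.add.m_comm)
  next
    case (zero n)
    \<comment> \<open>Writing 0 as 0 times 0 lets linearity over \<open>K\<close> show that
      \<open>\<beta>\<close> vanishes at 0, as the rule \<open>zero\<close> demands.\<close>
    have "\<beta> (\<zero>\<^bsub>K\<^esub> \<odot>\<^bsub>M\<^esub> \<zero>\<^bsub>M\<^esub>) n = \<zero>\<^bsub>K\<^esub> \<odot>\<^bsub>P\<^esub> \<beta> \<zero>\<^bsub>M\<^esub> n"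
      using zero by (intro b) auto
    then show ?case using zero b(1) by simp
  qed (auto simp: b)
qed

text \<open>Applies to any nonempty set of formal sums, not only to a class.
  \<open>lift_mult\<close> needs this, because a product in \<open>tensor\<close> is given as a
  union of classes.\<close>

lemma lift_eqI:
  assumes "X \<noteq> {}" "\<And>ts. ts \<in> X \<Longrightarrow> bsum P \<beta> ts = v"
  shows "tensor_lift P \<beta> X = v"
proof -
  have "(\<lambda>ts. bsum P \<beta> ts) ` X = {v}" using assms by auto
  then show ?thesis
    by (simp add: tensor_lift_def bsum_def lsum_def)
qed

lemma lift_class:
  assumes "Module.module K P" "bilinear K M N P \<beta>" "ts \<in> fsums"
  shows "tensor_lift P \<beta> (cls ts) = bsum P \<beta> ts"
proof (rule lift_eqI)
  show "cls ts \<noteq> {}" using self_in_class[OF assms(3)] by blast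
  show "bsum P \<beta> us = bsum P \<beta> ts" if "us \<in> cls ts" for us
    using bsum_rel[OF assms(1,2) in_classD(1)[OF that]] by simp
qed

lemma bsum_smult:
  assumes "Module.module K P" "bilinear K M N P \<beta>" "ts \<in> fsums" "a \<in> carrier K"
  shows "bsum P \<beta> [(a \<odot>\<^bsub>M\<^esub> m, n). (m, n) \<leftarrow> ts] = a \<odot>\<^bsub>P\<^esub> bsum P \<beta> ts"
proof -
  interpret P: Module.module K P by fact
  show ?thesis using assms(3)
    by (induction ts) (auto simp: assms(4) bilinearD[OF assms(2)] P.smult_r_distr P.abelian_monoid_axioms)
qed

lemma lift_linear:
  assumes P: "Module.module K P" and b: "bilinear K M N P \<beta>"
  shows "tensor_lift P \<beta> \<in> linear_map K T P"
proof -
  interpret P: Module.module K P by fact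
  show ?thesis
    unfolding linear_map_def
    by (auto elim!: T_cases simp: T_add T_smult lift_class[OF assms] bilinearD[OF b]
        P.abelian_monoid_axioms bsum_append bsum_smult[OF assms])
qed

lemma lift_cong:
  assumes "Module.module K P" "bilinear K M N P \<beta>" "X \<in> carrier T"
    and "\<And>m n. \<lbrakk>m \<in> carrier M; n \<in> carrier N\<rbrakk> \<Longrightarrow> \<beta> m n = \<beta>' m n"
  shows "tensor_lift P \<beta> X = tensor_lift P \<beta>' X"
proof -
  obtain ts where ts: "ts \<in> fsums" "X = cls ts" using assms(3) by (rule T_cases)
  have eq: "bsum P \<beta> us = bsum P \<beta>' us" if "us \<in> fsums" for us
    using that by (induction us) (auto simp: assms(4))
  have "tensor_lift P \<beta>' X = bsum P \<beta> ts"
  proof (rule lift_eqI)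
    show "X \<noteq> {}" using self_in_class ts by blast
    show "bsum P \<beta>' us = bsum P \<beta> ts" if "us \<in> X" for us
      using bsum_rel[OF assms(1,2) in_classD(1)] in_classD(3) eq that ts by metis
  qed
  then show ?thesis using ts by (simp add: lift_class[OF assms(1,2)])
qed

lemma linear_bsum:
  assumes "Module.module K P" "Module.module K Q" "f \<in> linear_map K P Q" "ts \<in> fsums"
    "\<And>m n. \<lbrakk>m \<in> carrier M; n \<in> carrier N\<rbrakk> \<Longrightarrow> \<beta> m n \<in> carrier P"
  shows "f (bsum P \<beta> ts) = bsum Q (\<lambda>m n. f (\<beta> m n)) ts"
proof -
  have "f (bsum P \<beta> ts) = lsum Q (map f [\<beta> m n. (m, n) \<leftarrow> ts])"
    unfolding bsum_def using assms by (intro linear_map_lsum(1)[OF assms(1-3)]) (auto dest: fsumsD)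
  also have "map f [\<beta> m n. (m, n) \<leftarrow> ts] = [f (\<beta> m n). (m, n) \<leftarrow> ts]" by auto
  finally show ?thesis by (simp add: bsum_def)
qed

lemma linear_lift:
  assumes "Module.module K P" "Module.module K Q" "f \<in> linear_map K P Q" "bilinear K M N P \<beta>" "X \<in> carrier T"
  shows "f (tensor_lift P \<beta> X) = tensor_lift Q (\<lambda>m n. f (\<beta> m n)) X"
proof -
  obtain ts where ts: "ts \<in> fsums" "X = cls ts" using assms(5) by (rule T_cases)
  have "bilinear K M N Q (\<lambda>m n. f (\<beta> m n))"
    using assms(3,4) by (intro bilinearI) (simp_all add: bilinearD linear_mapD)
  then show ?thesis using ts assms
    by (simp add: lift_class linear_bsum bilinearD)
qed

lemma bilinear_class: "bilinear K M N T (\<lambda>m n. cls [(m, n)])"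
proof (rule bilinearI)
  fix a m n assume "a \<in> carrier K" "m \<in> carrier M" "n \<in> carrier N"
  then show "cls [(m, a \<odot>\<^bsub>N\<^esub> n)] = a \<odot>\<^bsub>T\<^esub> cls [(m, n)]"
    by (simp add: T_smult class_eqI tensor_rel.balanced tensor_rel.sym)
qed (simp_all add: T_add T_smult class_eqI tensor_rel.add_left tensor_rel.add_right)

end

lemma bilinear_tensor_map:
  assumes "Module.module K M'" "Module.module K N'" "Module.module K M" "Module.module K N"
    and "f \<in> linear_map K M' M" "g \<in> linear_map K N' N"
  shows "bilinear K M' N' (tensor K M N) (\<lambda>x y. tensor_class K M N [(f x, g y)])"
proof -
  interpret module_pair K M N using assms by (simp add: module_pair_def)
  show ?thesis
    using assms(5,6)
    by (intro bilinearI) (simp_all add: bilinearD[OF bilinear_class] linear_mapD)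
qed

text \<open>The means of evaluating conditions phrased with \<open>tensor_map\<close>:
  coassociativity, compatibility of Hopf morphisms with \<open>comult\<close>, and membership in
  \<open>hopf_kernel\<close>.\<close>

lemma lift_tensor_map:
  assumes "Module.module K M'" "Module.module K N'" "Module.module K M" "Module.module K N" "Module.module K P"
    and f: "f \<in> linear_map K M' M" and g: "g \<in> linear_map K N' N"
    and b: "bilinear K M N P \<beta>" and X: "X \<in> carrier (tensor K M' N')"
  shows "tensor_lift P \<beta> (tensor_map K M N f g X) = tensor_lift P (\<lambda>x y. \<beta> (f x) (g y)) X"
proof -
  interpret A: module_pair K M' N' using assms by (simp add: module_pair_def)
  interpret B: module_pair K M N using assms by (simp add: module_pair_def)
  have b': "bilinear K M' N' P (\<lambda>x y. \<beta> (f x) (g y))"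
    using b f g by (intro bilinearI) (simp_all add: bilinearD linear_mapD)
  have "tensor_lift P \<beta> (tensor_map K M N f g X) =
    tensor_lift P (\<lambda>x y. tensor_lift P \<beta> (B.cls [(f x, g y)])) X"
    unfolding tensor_map_def
    using assms by (intro A.linear_lift B.module_T B.lift_linear bilinear_tensor_map)
  also have "\<dots> = tensor_lift P (\<lambda>x y. \<beta> (f x) (g y)) X"
  proof (rule A.lift_cong[OF assms(5) b' X, symmetric])
    interpret P: Module.module K P by fact
    fix x y assume "x \<in> carrier M'" "y \<in> carrier N'"
    then show "\<beta> (f x) (g y) = tensor_lift P \<beta> (B.cls [(f x, g y)])"
      by (simp add: B.lift_class[OF assms(5) b] linear_mapD[OF f] linear_mapD[OF g] bilinearD(1)[OF b])
  qed
  finally show ?thesis .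
qed

section \<open>The group of points\<close>

lemma (in module_pair) bsum_add:
  assumes "abelian_monoid P" "ts \<in> fsums"
    "\<And>m n. \<lbrakk>m \<in> carrier M; n \<in> carrier N\<rbrakk> \<Longrightarrow> \<beta> m n \<in> carrier P"
    "\<And>m n. \<lbrakk>m \<in> carrier M; n \<in> carrier N\<rbrakk> \<Longrightarrow> \<gamma> m n \<in> carrier P"
  shows "bsum P (\<lambda>m n. \<beta> m n \<oplus>\<^bsub>P\<^esub> \<gamma> m n) ts = bsum P \<beta> ts \<oplus>\<^bsub>P\<^esub> bsum P \<gamma> ts"
proof -
  interpret P: abelian_monoid P by fact
  show ?thesis
    using assms(2) by (induction ts) (auto simp: assms(3,4) P.abelian_monoid_axioms P.a_ac)
qed

lemma (in module_pair) bsum_scale: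
  assumes "Module.module K P" "ts \<in> fsums" "a \<in> carrier K"
    "\<And>m n. \<lbrakk>m \<in> carrier M; n \<in> carrier N\<rbrakk> \<Longrightarrow> \<beta> m n \<in> carrier P"
  shows "bsum P (\<lambda>m n. a \<odot>\<^bsub>P\<^esub> \<beta> m n) ts = a \<odot>\<^bsub>P\<^esub> bsum P \<beta> ts"
proof -
  interpret P: Module.module K P by fact
  show ?thesis
    using assms(2) by (induction ts) (auto simp: assms(3,4) P.abelian_monoid_axioms P.smult_r_distr)
qed

lemma (in module_pair) bsum_cong:
  assumes "ts \<in> fsums" "\<And>m n. (m, n) \<in> set ts \<Longrightarrow> \<beta> m n = \<gamma> m n"
  shows "bsum P \<beta> ts = bsum P \<gamma> ts"
  using assms by (induction ts) auto

lemma alg_homD: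
  assumes "f \<in> alg_hom K R S"
  shows "f \<in> ring_hom R S" "f \<in> linear_map K R S" "f \<in> extensional (carrier R)"
    and "x \<in> carrier R \<Longrightarrow> f x \<in> carrier S"
    and "\<lbrakk>x \<in> carrier R; y \<in> carrier R\<rbrakk> \<Longrightarrow> f (x \<otimes>\<^bsub>R\<^esub> y) = f x \<otimes>\<^bsub>S\<^esub> f y"
    and "\<lbrakk>x \<in> carrier R; y \<in> carrier R\<rbrakk> \<Longrightarrow> f (x \<oplus>\<^bsub>R\<^esub> y) = f x \<oplus>\<^bsub>S\<^esub> f y"
    and "\<lbrakk>a \<in> carrier K; x \<in> carrier R\<rbrakk> \<Longrightarrow> f (a \<odot>\<^bsub>R\<^esub> x) = a \<odot>\<^bsub>S\<^esub> f x"
    and "f \<one>\<^bsub>R\<^esub> = \<one>\<^bsub>S\<^esub>"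
  using assms by (auto simp: alg_hom_def ring_hom_def linear_map_def)

lemma alg_homI:
  assumes "f \<in> extensional (carrier R)"
    and "\<And>x. x \<in> carrier R \<Longrightarrow> f x \<in> carrier S"
    and "\<And>x y. \<lbrakk>x \<in> carrier R; y \<in> carrier R\<rbrakk> \<Longrightarrow> f (x \<otimes>\<^bsub>R\<^esub> y) = f x \<otimes>\<^bsub>S\<^esub> f y"
    and "\<And>x y. \<lbrakk>x \<in> carrier R; y \<in> carrier R\<rbrakk> \<Longrightarrow> f (x \<oplus>\<^bsub>R\<^esub> y) = f x \<oplus>\<^bsub>S\<^esub> f y"
    and "\<And>a x. \<lbrakk>a \<in> carrier K; x \<in> carrier R\<rbrakk> \<Longrightarrow> f (a \<odot>\<^bsub>R\<^esub> x) = a \<odot>\<^bsub>S\<^esub> f x"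
    and "f \<one>\<^bsub>R\<^esub> = \<one>\<^bsub>S\<^esub>"
  shows "f \<in> alg_hom K R S"
  using assms by (auto simp: alg_hom_def ring_hom_def linear_map_def)

lemma alg_hom_compose:
  assumes "algebra K R" "f \<in> alg_hom K R S" "g \<in> alg_hom K S T"
  shows "compose (carrier R) g f \<in> alg_hom K R T"
proof -
  interpret R: algebra K R by fact
  show ?thesis
    by (rule alg_homI) (auto simp: compose_eq alg_homD[OF assms(2)] alg_homD[OF assms(3)])
qed

lemma alg_hom_id: "algebra K R \<Longrightarrow> (\<lambda>x\<in>carrier R. x) \<in> alg_hom K R R"
proof -
  assume "algebra K R"
  then interpret R: algebra K R .
  show ?thesis by (rule alg_homI) auto
qed

section \<open>Convolution on the maps from \<open>H\<close> to \<open>R\<close>\<close>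

locale hopf_points = H: bicommutative_hopf_algebra K H + R: algebra K R
  for K :: "('k, 'r) ring_scheme" and H :: "('k, 'h) hopf" and R :: "('k, 'a, 'x) module_scheme"
begin

sublocale HH: module_pair K H H
  by (simp add: module_pair_def H.module)

sublocale T: Module.module K HH.T
  by (rule HH.module_T)

sublocale HT: module_pair K H HH.T
  by (simp add: module_pair_def H.module HH.module_T)

sublocale TH: module_pair K HH.T H
  by (simp add: module_pair_def H.module HH.module_T)

abbreviation G where "G \<equiv> points K H R"

text \<open>Convolution is considered for all linear maps and without restriction to
  \<open>carrier H\<close>, so that associativity and commutativity are settled apart from
  multiplicativity.\<close>

definition conv :: "('h \<Rightarrow> 'a) \<Rightarrow> ('h \<Rightarrow> 'a) \<Rightarrow> 'h \<Rightarrow> 'a" where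
  "conv f g h = tensor_lift R (\<lambda>x y. f x \<otimes>\<^bsub>R\<^esub> g y) (comult H h)"

lemma comult_linear: "comult H \<in> linear_map K H HH.T"
  using H.comult_hom by simp

lemma comult_closed [simp]: "h \<in> carrier H \<Longrightarrow> comult H h \<in> carrier HH.T"
  by (rule linear_mapD(1)[OF comult_linear])

lemma bilinear_prod:
  assumes "f \<in> linear_map K M R" "g \<in> linear_map K N R"
  shows "bilinear K M N R (\<lambda>x y. f x \<otimes>\<^bsub>R\<^esub> g y)"
proof (rule bilinearI)
  fix a m n assume "a \<in> carrier K" "m \<in> carrier M" "n \<in> carrier N"
  then show "f m \<otimes>\<^bsub>R\<^esub> g (a \<odot>\<^bsub>N\<^esub> n) = a \<odot>\<^bsub>R\<^esub> (f m \<otimes>\<^bsub>R\<^esub> g n)"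
    using linear_mapD[OF assms(1)] linear_mapD[OF assms(2)]
    by (simp add: R.m_comm[of "f m"] R.smult_assoc2)
qed (use linear_mapD[OF assms(1)] linear_mapD[OF assms(2)] in
  \<open>simp_all add: R.smult_assoc2 R.l_distr R.r_distr\<close>)

text \<open>One formal sum representing \<open>comult H h\<close> serves all pairs f, g at once.
  This uniformity makes convolution continuous in \<open>tends_mult\<close>.\<close>

lemma conv_legs:
  assumes "h \<in> carrier H"
  obtains ts where "ts \<in> HH.fsums"
    "\<And>f g. \<lbrakk>f \<in> linear_map K H R; g \<in> linear_map K H R\<rbrakk> \<Longrightarrow>
      conv f g h = HH.bsum R (\<lambda>x y. f x \<otimes>\<^bsub>R\<^esub> g y) ts"
proof -
  obtain ts where "ts \<in> HH.fsums" "comult H h = HH.cls ts"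
    using comult_closed[OF assms] by (rule HH.T_cases)
  then show ?thesis
    by (intro that[of ts]) (simp_all add: conv_def HH.lift_class[OF R.module bilinear_prod])
qed

lemma conv_cong:
  assumes "f \<in> linear_map K H R" "g \<in> linear_map K H R" "h \<in> carrier H"
    and "\<And>x. x \<in> carrier H \<Longrightarrow> f x = f' x" "\<And>x. x \<in> carrier H \<Longrightarrow> g x = g' x"
  shows "conv f g h = conv f' g' h"
  unfolding conv_def using assms
  by (intro HH.lift_cong R.module bilinear_prod) simp_all

lemma conv_linear:
  assumes "f \<in> linear_map K H R" "g \<in> linear_map K H R"
  shows "conv f g \<in> linear_map K H R"
  using HH.lift_linear[OF R.module bilinear_prod[OF assms]] comult_linear
  by (auto simp: linear_map_def conv_def)

text \<open>The product of X and Y is a union over all pairs of representatives. Every member of it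
  evaluates to \<open>L X\<close> times \<open>L Y\<close>, because commutativity of
  \<open>R\<close> turns f(m m') g(n n') into f(m) g(n) f(m') g(n'); by \<open>lift_eqI\<close> this
  suffices.\<close>

lemma lift_mult:
  assumes f: "f \<in> alg_hom K H R" and g: "g \<in> alg_hom K H R"
    and X: "X \<in> carrier HH.T" and Y: "Y \<in> carrier HH.T"
  defines "L \<equiv> tensor_lift R (\<lambda>x y. f x \<otimes>\<^bsub>R\<^esub> g y)"
  shows "L (X \<otimes>\<^bsub>HH.T\<^esub> Y) = L X \<otimes>\<^bsub>R\<^esub> L Y"
proof -
  let ?\<beta> = "\<lambda>x y. f x \<otimes>\<^bsub>R\<^esub> g y"
  let ?pr = "\<lambda>ts us. [(m \<otimes>\<^bsub>H\<^esub> m', n \<otimes>\<^bsub>H\<^esub> n'). (m, n) \<leftarrow> ts, (m', n') \<leftarrow> us]"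
  note fD = alg_homD[OF f] and gD = alg_homD[OF g]
  have b: "bilinear K H H R ?\<beta>" by (rule bilinear_prod[OF fD(2) gD(2)])
  have inner: "HH.bsum R ?\<beta> [(m \<otimes>\<^bsub>H\<^esub> m', n \<otimes>\<^bsub>H\<^esub> n'). (m', n') \<leftarrow> us] = ?\<beta> m n \<otimes>\<^bsub>R\<^esub> HH.bsum R ?\<beta> us"
    if "m \<in> carrier H" "n \<in> carrier H" "us \<in> HH.fsums" for m n us
    using that(3)
  proof (induction us)
    case (Cons u us)
    obtain m' n' where u: "u = (m', n')" by (cases u)
    have "(f m \<otimes>\<^bsub>R\<^esub> f m') \<otimes>\<^bsub>R\<^esub> (g n \<otimes>\<^bsub>R\<^esub> g n') = (f m \<otimes>\<^bsub>R\<^esub> g n) \<otimes>\<^bsub>R\<^esub> (f m' \<otimes>\<^bsub>R\<^esub> g n')"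
      using that(1,2) Cons.prems by (simp add: u fD gD R.m_ac)
    with Cons that(1,2) show ?case
      by (simp add: u fD gD R.r_distr R.is_abelian_group R.abelian_monoid_axioms)
  qed (use that in \<open>simp add: fD gD\<close>)
  have prs_aux: "map (\<lambda>(m', n'). (m \<otimes>\<^bsub>H\<^esub> m', n \<otimes>\<^bsub>H\<^esub> n')) us \<in> HH.fsums"
    if "m \<in> carrier H" "n \<in> carrier H" "us \<in> HH.fsums" for m n us
    using that(3) by (induction us) (auto simp: that)
  have prs: "?pr ts us \<in> HH.fsums" if "ts \<in> HH.fsums" "us \<in> HH.fsums" for ts us
    using that(1) by (induction ts) (auto simp: that(2) prs_aux)
  have sum_pr: "HH.bsum R ?\<beta> (?pr ts us) = HH.bsum R ?\<beta> ts \<otimes>\<^bsub>R\<^esub> HH.bsum R ?\<beta> us"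
    if "ts \<in> HH.fsums" "us \<in> HH.fsums" for ts us
    using that(1)
  proof (induction ts)
    case (Cons t ts)
    obtain m n where t: "t = (m, n)" by (cases t)
    have c: "m \<in> carrier H" "n \<in> carrier H" "ts \<in> HH.fsums" using Cons.prems by (auto simp: t)
    have "HH.bsum R ?\<beta> (?pr (t # ts) us) =
      HH.bsum R ?\<beta> [(m \<otimes>\<^bsub>H\<^esub> m', n \<otimes>\<^bsub>H\<^esub> n'). (m', n') \<leftarrow> us] \<oplus>\<^bsub>R\<^esub> HH.bsum R ?\<beta> (?pr ts us)"
      using c that(2) prs prs_aux
      by (simp add: t) (subst HH.bsum_append, auto simp: R.abelian_monoid_axioms fD gD)
    also have "\<dots> = (?\<beta> m n \<oplus>\<^bsub>R\<^esub> HH.bsum R ?\<beta> ts) \<otimes>\<^bsub>R\<^esub> HH.bsum R ?\<beta> us"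
      using c that(2) Cons.IH
      by (simp add: inner R.l_distr fD gD R.abelian_monoid_axioms)
    finally show ?case by (simp add: t)
  qed (use that in \<open>simp add: fD gD R.abelian_monoid_axioms\<close>)
  obtain ts us where ts: "ts \<in> HH.fsums" "X = HH.cls ts" and us: "us \<in> HH.fsums" "Y = HH.cls us"
    using X Y by (metis HH.T_cases)
  have L: "L (HH.cls ts') = HH.bsum R ?\<beta> ts'" if "ts' \<in> HH.fsums" for ts'
    unfolding L_def by (rule HH.lift_class[OF R.module b that])
  have XY: "X \<otimes>\<^bsub>HH.T\<^esub> Y = (\<Union>ts\<in>X. \<Union>us\<in>Y. HH.cls (?pr ts us))"
    by (simp add: tensor_def)
  show ?thesis
    unfolding L_def
  proof (rule HH.lift_eqI, unfold L_def[symmetric])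
    have "?pr ts us \<in> HH.cls (?pr ts us)" "ts \<in> X" "us \<in> Y"
      using ts us prs HH.self_in_class by auto
    then show "X \<otimes>\<^bsub>HH.T\<^esub> Y \<noteq> {}" unfolding XY by blast
  next
    fix zs assume "zs \<in> X \<otimes>\<^bsub>HH.T\<^esub> Y"
    then obtain ts' us' where *: "ts' \<in> X" "us' \<in> Y" "zs \<in> HH.cls (?pr ts' us')"
      unfolding XY by blast
    have s: "ts' \<in> HH.fsums" "us' \<in> HH.fsums" "HH.cls ts' = X" "HH.cls us' = Y"
      using HH.in_classD(2,3) *(1,2) ts us by blast+
    have "HH.bsum R ?\<beta> zs = HH.bsum R ?\<beta> (?pr ts' us')"
      using HH.bsum_rel[OF R.module b HH.in_classD(1)[OF *(3)]] by simp
    also have "\<dots> = L X \<otimes>\<^bsub>R\<^esub> L Y"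
      using sum_pr[OF s(1,2)] L[OF s(1)] L[OF s(2)] s(3,4) by simp
    finally show "HH.bsum R ?\<beta> zs = L X \<otimes>\<^bsub>R\<^esub> L Y" .
  qed
qed

lemma conv_alg_hom:
  assumes f: "f \<in> alg_hom K H R" and g: "g \<in> alg_hom K H R"
  shows "(\<lambda>h\<in>carrier H. conv f g h) \<in> alg_hom K H R"
proof (rule alg_homI)
  note lin = conv_linear[OF alg_homD(2)[OF f] alg_homD(2)[OF g]]
  fix x y assume [simp]: "x \<in> carrier H" "y \<in> carrier H"
  have "comult H (x \<otimes>\<^bsub>H\<^esub> y) = comult H x \<otimes>\<^bsub>HH.T\<^esub> comult H y"
    using H.comult_hom by (simp add: ring_hom_def)
  then show "(\<lambda>h\<in>carrier H. conv f g h) (x \<otimes>\<^bsub>H\<^esub> y)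
    = (\<lambda>h\<in>carrier H. conv f g h) x \<otimes>\<^bsub>R\<^esub> (\<lambda>h\<in>carrier H. conv f g h) y"
    using lift_mult[OF f g] by (simp add: conv_def)
next
  have "comult H \<one>\<^bsub>H\<^esub> = HH.cls [(\<one>\<^bsub>H\<^esub>, \<one>\<^bsub>H\<^esub>)]"
    using H.comult_hom by (simp add: ring_hom_def tensor_def)
  then show "(\<lambda>h\<in>carrier H. conv f g h) \<one>\<^bsub>H\<^esub> = \<one>\<^bsub>R\<^esub>"
    using f g by (simp add: conv_def HH.lift_class[OF R.module bilinear_prod] alg_homD)
qed (auto simp: linear_mapD[OF conv_linear[OF alg_homD(2)[OF f] alg_homD(2)[OF g]]])

text \<open>Cocommutativity exchanges the tensor factors, and commutativity of \<open>R\<close>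
  exchanges the values back.\<close>

lemma conv_comm:
  assumes "f \<in> linear_map K H R" "g \<in> linear_map K H R" "h \<in> carrier H"
  shows "conv f g h = conv g f h"
proof -
  have b: "bilinear K H H HH.T (\<lambda>m n. HH.cls [(n, m)])"
    using HH.bilinear_class by (simp add: bilinear_def)
  have "conv f g h = tensor_lift R (\<lambda>x y. f x \<otimes>\<^bsub>R\<^esub> g y) (tensor_swap K H H (comult H h))"
    by (simp add: conv_def H.cocomm assms)
  also have "\<dots> = tensor_lift R (\<lambda>x y. tensor_lift R (\<lambda>x y. f x \<otimes>\<^bsub>R\<^esub> g y) (HH.cls [(y, x)])) (comult H h)"
    unfolding tensor_swap_def using assms b
    by (intro HH.linear_lift HH.module_T R.module HH.lift_linear bilinear_prod) simp_all
  also have "\<dots> = conv g f h"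
    unfolding conv_def using assms
    by (intro HH.lift_cong[symmetric] R.module bilinear_prod)
      (simp_all add: HH.lift_class[OF R.module bilinear_prod] linear_mapD R.m_comm)
  finally show ?thesis .
qed

text \<open>Both sides arise by applying the linear map L, which sends x \<otimes> (y \<otimes> z)
  to f(x) g(y) k(z), to the two sides of \<open>coassoc\<close>.\<close>

lemma conv_assoc:
  assumes f: "f \<in> linear_map K H R" and g: "g \<in> linear_map K H R" and k: "k \<in> linear_map K H R"
    and h: "h \<in> carrier H"
  shows "conv (conv f g) k h = conv f (conv g k) h"
proof -
  let ?T' = "HT.T"
  define \<gamma> where "\<gamma> = (\<lambda>z m n. HT.cls [(m, HH.cls [(n, z)])])"
  \<comment> \<open>\<open>tensor_assoc\<close> is by definition the lift of this B; for a sum X of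
    terms m \<otimes> n, the value B X z is the sum of the terms m \<otimes> (n \<otimes>
    z).\<close>
  define B where "B = (\<lambda>X z. tensor_lift ?T' (\<gamma> z) X)"
  define L where "L = tensor_lift R (\<lambda>x Z. f x \<otimes>\<^bsub>R\<^esub> tensor_lift R (\<lambda>y z. g y \<otimes>\<^bsub>R\<^esub> k z) Z)"
  note c = bilinearD[OF HH.bilinear_class] and c' = bilinearD[OF HT.bilinear_class]
  have \<gamma>: "bilinear K H H ?T' (\<gamma> z)" if "z \<in> carrier H" for z
    unfolding \<gamma>_def using that by (intro bilinearI) (simp_all add: c c')
  interpret T': Module.module K ?T' by (rule HT.module_T)
  have B: "bilinear K HH.T H ?T' B"
    unfolding bilinear_def
  proof (intro conjI ballI)
    show "(\<lambda>X. B X z) \<in> linear_map K HH.T ?T'" if "z \<in> carrier H" for z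
      unfolding B_def by (rule HH.lift_linear[OF HT.module_T \<gamma>[OF that]])
    \<comment> \<open>For linearity in z a representative of X is fixed once; then B X z is a finite
      sum of terms that are linear in z.\<close>
    fix X assume "X \<in> carrier HH.T"
    then obtain ts where ts: "ts \<in> HH.fsums" "X = HH.cls ts" by (rule HH.T_cases)
    have BX: "B X z = HH.bsum ?T' (\<gamma> z) ts" if "z \<in> carrier H" for z
      by (simp add: B_def ts HH.lift_class[OF HT.module_T \<gamma>[OF that]])
    have \<gamma>_closed: "\<gamma> z m n \<in> carrier ?T'" if "z \<in> carrier H" "m \<in> carrier H" "n \<in> carrier H" for z m n
      using bilinearD(1)[OF \<gamma>[OF that(1)]] that by simp
    show "B X \<in> linear_map K H ?T'"
      unfolding linear_map_def
    proof (intro CollectI conjI ballI Pi_I)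
      fix z w assume z: "z \<in> carrier H" "w \<in> carrier H"
      have "HH.bsum ?T' (\<gamma> (z \<oplus>\<^bsub>H\<^esub> w)) ts = HH.bsum ?T' (\<lambda>m n. \<gamma> z m n \<oplus>\<^bsub>?T'\<^esub> \<gamma> w m n) ts"
        using z ts by (intro HH.bsum_cong) (auto simp: \<gamma>_def c c' dest!: HH.fsumsD)
      also have "\<dots> = HH.bsum ?T' (\<gamma> z) ts \<oplus>\<^bsub>?T'\<^esub> HH.bsum ?T' (\<gamma> w) ts"
        using z ts by (intro HH.bsum_add) (auto simp: \<gamma>_closed T'.abelian_monoid_axioms)
      finally show "B X (z \<oplus>\<^bsub>H\<^esub> w) = B X z \<oplus>\<^bsub>?T'\<^esub> B X w"
        using z by (simp add: BX)
    next
      fix a z assume z: "a \<in> carrier K" "z \<in> carrier H"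
      have "HH.bsum ?T' (\<gamma> (a \<odot>\<^bsub>H\<^esub> z)) ts = HH.bsum ?T' (\<lambda>m n. a \<odot>\<^bsub>?T'\<^esub> \<gamma> z m n) ts"
        using z ts by (intro HH.bsum_cong) (auto simp: \<gamma>_def c c' dest!: HH.fsumsD)
      also have "\<dots> = a \<odot>\<^bsub>?T'\<^esub> HH.bsum ?T' (\<gamma> z) ts"
        using z ts by (intro HH.bsum_scale) (auto simp: \<gamma>_closed HT.module_T)
      finally show "B X (a \<odot>\<^bsub>H\<^esub> z) = a \<odot>\<^bsub>?T'\<^esub> B X z"
        using z by (simp add: BX)
    next
      fix z assume z: "z \<in> carrier H"
      show "B X z \<in> carrier ?T'"
        unfolding BX[OF z] using z ts by (intro HH.bsum_closed \<gamma>_closed T'.abelian_monoid_axioms)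
    qed
  qed
  note gk = HH.lift_linear[OF R.module bilinear_prod[OF g k]]
  have bL: "bilinear K H HH.T R (\<lambda>x Z. f x \<otimes>\<^bsub>R\<^esub> tensor_lift R (\<lambda>y z. g y \<otimes>\<^bsub>R\<^esub> k z) Z)"
    by (rule bilinear_prod[OF f gk])
  have L: "L \<in> linear_map K ?T' R"
    unfolding L_def by (rule HT.lift_linear[OF R.module bL])
  have bLB: "bilinear K HH.T H R (\<lambda>X z. L (B X z))"
    by (intro bilinearI) (simp_all add: bilinearD[OF B] linear_mapD[OF L])
  have id: "(\<lambda>x. x) \<in> linear_map K H H" by (auto simp: linear_map_def)
  have "conv f (conv g k) h = L (tensor_map K H HH.T (\<lambda>x. x) (comult H) (comult H h))"
    unfolding L_def using h
    by (subst lift_tensor_map[OF H.module H.module H.module HH.module_T R.module id comult_linear bL])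
      (simp_all add: conv_def[abs_def])
  also have "\<dots> = L (tensor_lift ?T' B (tensor_map K HH.T H (comult H) (\<lambda>x. x) (comult H h)))"
    using H.coassoc[OF h] by (simp add: tensor_assoc_def B_def \<gamma>_def Let_def)
  also have "\<dots> = tensor_lift R (\<lambda>X z. L (B X z)) (tensor_map K HH.T H (comult H) (\<lambda>x. x) (comult H h))"
  proof (rule TH.linear_lift[OF HT.module_T R.module L B])
    show "tensor_map K HH.T H (comult H) (\<lambda>x. x) (comult H h) \<in> carrier TH.T"
      unfolding tensor_map_def
      by (rule linear_mapD(1)[OF HH.lift_linear[OF TH.module_T bilinear_tensor_map]])
        (simp_all add: h H.module HH.module_T id comult_linear)
  qed
  also have "\<dots> = tensor_lift R (\<lambda>x z. L (B (comult H x) z)) (comult H h)"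
    using h
    by (intro lift_tensor_map[OF H.module H.module HH.module_T H.module R.module comult_linear id bLB]) simp
  also have "\<dots> = conv (conv f g) k h"
    unfolding conv_def[of "conv f g"]
  proof (rule HH.lift_cong[OF R.module bilinear_prod[OF conv_linear[OF f g] k], symmetric])
    fix x z assume [simp]: "x \<in> carrier H" "z \<in> carrier H"
    have lk: "(\<lambda>r. r \<otimes>\<^bsub>R\<^esub> k z) \<in> linear_map K R R"
      using linear_mapD(1)[OF k] by (auto simp: linear_map_def R.l_distr R.smult_assoc2)
    have "conv f g x \<otimes>\<^bsub>R\<^esub> k z = tensor_lift R (\<lambda>m n. (f m \<otimes>\<^bsub>R\<^esub> g n) \<otimes>\<^bsub>R\<^esub> k z) (comult H x)"
      unfolding conv_def
      by (rule HH.linear_lift[OF R.module R.module lk bilinear_prod[OF f g]]) simp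
    also have "\<dots> = tensor_lift R (\<lambda>m n. L (\<gamma> z m n)) (comult H x)"
    proof (rule HH.lift_cong[OF R.module])
      show "bilinear K H H R (\<lambda>m n. (f m \<otimes>\<^bsub>R\<^esub> g n) \<otimes>\<^bsub>R\<^esub> k z)"
        using bilinearD[OF bilinear_prod[OF f g]] linear_mapD[OF lk] by (intro bilinearI) simp_all
      fix m n assume "m \<in> carrier H" "n \<in> carrier H"
      then show "(f m \<otimes>\<^bsub>R\<^esub> g n) \<otimes>\<^bsub>R\<^esub> k z = L (\<gamma> z m n)"
        by (simp add: L_def \<gamma>_def HT.lift_class[OF R.module bL] HH.lift_class[OF R.module bilinear_prod[OF g k]]
            linear_mapD(1)[OF f] linear_mapD(1)[OF g] linear_mapD(1)[OF k] R.m_assoc)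
    qed simp
    also have "\<dots> = L (B (comult H x) z)"
      unfolding B_def by (rule HH.linear_lift[OF HT.module_T R.module L \<gamma>, symmetric]) simp_all
    finally show "conv f g x \<otimes>\<^bsub>R\<^esub> k z = L (B (comult H x) z)" .
  qed (simp add: h)
  finally show ?thesis ..
qed

lemma one_alg_hom: "(\<lambda>h\<in>carrier H. counit H h \<odot>\<^bsub>R\<^esub> \<one>\<^bsub>R\<^esub>) \<in> alg_hom K H R"
proof (rule alg_homI)
  note c = ring_hom_closed[OF H.counit_hom] ring_hom_mult[OF H.counit_hom]
    ring_hom_add[OF H.counit_hom] ring_hom_one[OF H.counit_hom]
  show "(\<lambda>h\<in>carrier H. counit H h \<odot>\<^bsub>R\<^esub> \<one>\<^bsub>R\<^esub>) \<one>\<^bsub>H\<^esub> = \<one>\<^bsub>R\<^esub>"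
    by (simp add: c)
  fix x y assume "x \<in> carrier H" "y \<in> carrier H"
  then show "(\<lambda>h\<in>carrier H. counit H h \<odot>\<^bsub>R\<^esub> \<one>\<^bsub>R\<^esub>) (x \<otimes>\<^bsub>H\<^esub> y) =
    (\<lambda>h\<in>carrier H. counit H h \<odot>\<^bsub>R\<^esub> \<one>\<^bsub>R\<^esub>) x \<otimes>\<^bsub>R\<^esub> (\<lambda>h\<in>carrier H. counit H h \<odot>\<^bsub>R\<^esub> \<one>\<^bsub>R\<^esub>) y"
    "(\<lambda>h\<in>carrier H. counit H h \<odot>\<^bsub>R\<^esub> \<one>\<^bsub>R\<^esub>) (x \<oplus>\<^bsub>H\<^esub> y) =
    (\<lambda>h\<in>carrier H. counit H h \<odot>\<^bsub>R\<^esub> \<one>\<^bsub>R\<^esub>) x \<oplus>\<^bsub>R\<^esub> (\<lambda>h\<in>carrier H. counit H h \<odot>\<^bsub>R\<^esub> \<one>\<^bsub>R\<^esub>) y"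
    by (simp_all add: c R.smult_l_distr R.smult_assoc1 R.smult_assoc2)
qed (auto simp: ring_hom_closed[OF H.counit_hom] H.counit_linear R.smult_assoc1)

text \<open>The identity is f applied to \<open>counit_right\<close>, with the scalar
  \<open>counit H y\<close> pulled out of f.\<close>

lemma conv_one:
  assumes f: "f \<in> alg_hom K H R" and h: "h \<in> carrier H"
  shows "conv f (\<lambda>h\<in>carrier H. counit H h \<odot>\<^bsub>R\<^esub> \<one>\<^bsub>R\<^esub>) h = f h"
proof -
  note fD = alg_homD[OF f]
  have b: "bilinear K H H H (\<lambda>x y. counit H y \<odot>\<^bsub>H\<^esub> x)"
  proof (rule bilinearI)
    note c = ring_hom_closed[OF H.counit_hom] ring_hom_add[OF H.counit_hom]
    fix a m n assume *: "a \<in> carrier K" "m \<in> carrier H" "n \<in> carrier H"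
    have "counit H n \<odot>\<^bsub>H\<^esub> (a \<odot>\<^bsub>H\<^esub> m) = (counit H n \<otimes>\<^bsub>K\<^esub> a) \<odot>\<^bsub>H\<^esub> m"
      using * c by (simp add: H.smult_assoc1)
    also have "\<dots> = (a \<otimes>\<^bsub>K\<^esub> counit H n) \<odot>\<^bsub>H\<^esub> m" using * c by (simp add: H.R.m_comm)
    also have "\<dots> = a \<odot>\<^bsub>H\<^esub> (counit H n \<odot>\<^bsub>H\<^esub> m)" using * c by (simp add: H.smult_assoc1)
    finally show "counit H n \<odot>\<^bsub>H\<^esub> (a \<odot>\<^bsub>H\<^esub> m) = a \<odot>\<^bsub>H\<^esub> (counit H n \<odot>\<^bsub>H\<^esub> m)" .
  qed (use ring_hom_closed[OF H.counit_hom] ring_hom_add[OF H.counit_hom] in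
      \<open>simp_all add: H.smult_r_distr H.smult_l_distr H.counit_linear H.smult_assoc1\<close>)
  have "f h = f (tensor_lift H (\<lambda>x y. counit H y \<odot>\<^bsub>H\<^esub> x) (comult H h))"
    by (simp add: H.counit_right h)
  also have "\<dots> = tensor_lift R (\<lambda>x y. f (counit H y \<odot>\<^bsub>H\<^esub> x)) (comult H h)"
    by (rule HH.linear_lift[OF H.module R.module fD(2) b]) (simp add: h)
  also have "\<dots> = conv f (\<lambda>h\<in>carrier H. counit H h \<odot>\<^bsub>R\<^esub> \<one>\<^bsub>R\<^esub>) h"
    unfolding conv_def
  proof (rule HH.lift_cong[OF R.module])
    show "bilinear K H H R (\<lambda>x y. f (counit H y \<odot>\<^bsub>H\<^esub> x))"
      using bilinearD[OF b] fD by (intro bilinearI) simp_all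
    fix m n assume m: "m \<in> carrier H" "n \<in> carrier H"
    have c: "counit H n \<in> carrier K" using ring_hom_closed[OF H.counit_hom] m by simp
    have "f m \<otimes>\<^bsub>R\<^esub> (counit H n \<odot>\<^bsub>R\<^esub> \<one>\<^bsub>R\<^esub>) = counit H n \<odot>\<^bsub>R\<^esub> f m"
      using m c fD by (simp add: R.m_comm[of "f m"] R.smult_assoc2)
    then show "f (counit H n \<odot>\<^bsub>H\<^esub> m) = f m \<otimes>\<^bsub>R\<^esub> (\<lambda>h\<in>carrier H. counit H h \<odot>\<^bsub>R\<^esub> \<one>\<^bsub>R\<^esub>) n"
      using m fD c by simp
  qed (simp add: h)
  finally show ?thesis by simp
qed

lemma G_simps [simp]:
  "carrier G = alg_hom K H R"
  "f \<otimes>\<^bsub>G\<^esub> g = (\<lambda>h\<in>carrier H. conv f g h)"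
  by (auto simp: points_def conv_def)

lemma G_one: "\<one>\<^bsub>G\<^esub> = (\<lambda>h\<in>carrier H. counit H h \<odot>\<^bsub>R\<^esub> \<one>\<^bsub>R\<^esub>)"
  by (simp add: points_def)

lemma conv_restrict:
  assumes "f \<in> linear_map K H R" "g \<in> linear_map K H R" "h \<in> carrier H"
  shows "conv (\<lambda>h\<in>carrier H. f h) g h = conv f g h" "conv f (\<lambda>h\<in>carrier H. g h) h = conv f g h"
  using assms by (auto intro!: conv_cong[symmetric])

lemma comm_monoid_G: "comm_monoid G"
proof (rule comm_monoidI; unfold G_simps)
  fix f g assume f: "f \<in> alg_hom K H R" and g: "g \<in> alg_hom K H R"
  show "(\<lambda>h\<in>carrier H. conv f g h) \<in> alg_hom K H R" using conv_alg_hom[OF f g] .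
  note lf = alg_homD(2)[OF f] and lg = alg_homD(2)[OF g]
  show "(\<lambda>h\<in>carrier H. conv f g h) = (\<lambda>h\<in>carrier H. conv g f h)"
    by (rule restrict_ext) (rule conv_comm[OF lf lg])
  fix k assume k: "k \<in> alg_hom K H R"
  note lk = alg_homD(2)[OF k]
  show "(\<lambda>h\<in>carrier H. conv (\<lambda>h\<in>carrier H. conv f g h) k h) =
        (\<lambda>h\<in>carrier H. conv f (\<lambda>h\<in>carrier H. conv g k h) h)"
    by (rule restrict_ext) (simp add: conv_restrict lf lg lk conv_linear conv_assoc)
next
  show "\<one>\<^bsub>G\<^esub> \<in> alg_hom K H R" using one_alg_hom by (simp add: G_one)
  fix f assume f: "f \<in> alg_hom K H R"
  have "conv (\<lambda>h\<in>carrier H. counit H h \<odot>\<^bsub>R\<^esub> \<one>\<^bsub>R\<^esub>) f h = f h" if "h \<in> carrier H" for h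
    using conv_one[OF f that] conv_comm[OF alg_homD(2)[OF f] alg_homD(2)[OF one_alg_hom] that] by simp
  then show "(\<lambda>h\<in>carrier H. conv \<one>\<^bsub>G\<^esub> f h) = f"
    unfolding G_one using alg_homD(3)[OF f] by (auto simp: extensional_def)
qed

sublocale G: comm_monoid G
  by (rule comm_monoid_G)

end

section \<open>Teichmueller sequences\<close>

text \<open>In a^p - b^p = (a - b) S the first factor is divisible by p^k, while S is congruent to p
  b^(p-1) and so contributes one more p. The condition on k guarantees that a and b agree modulo
  p.\<close>

lemma cong_pow_prime_lift:
  fixes a b :: int
  assumes "[a = b] (mod int p ^ k)" "k \<ge> 1"
  shows "[a ^ p = b ^ p] (mod int p ^ Suc k)"
proof -
  have 1: "int p ^ k dvd a - b" using assms by (simp add: cong_iff_dvd_diff)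
  then have "[a = b] (mod int p)"
    using assms(2) dvd_trans[OF dvd_power[of k "int p"]] by (simp add: cong_iff_dvd_diff)
  then have "[(\<Sum>i<p. b ^ (p - Suc i) * a ^ i) = (\<Sum>i<p. b ^ (p - Suc i) * b ^ i)] (mod int p)"
    by (intro cong_sum cong_mult cong_pow) auto
  also have "(\<Sum>i<p. b ^ (p - Suc i) * b ^ i) = (\<Sum>i<p. b ^ (p - 1))"
    by (intro sum.cong) (auto simp flip: power_add)
  also have "[\<dots> = 0] (mod int p)" by (simp add: cong_0_iff)
  finally have "int p dvd (\<Sum>i<p. b ^ (p - Suc i) * a ^ i)" by (simp add: cong_0_iff)
  then have "int p ^ Suc k dvd (a - b) * (\<Sum>i<p. b ^ (p - Suc i) * a ^ i)"
    using 1 by (metis mult_dvd_mono power_Suc2)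
  then show ?thesis by (simp add: cong_iff_dvd_diff power_diff_sumr2)
qed

text \<open>Each p-th power gains a factor p, so the induction even reaches the modulus p^(n+1). The
  modulus p^n is kept to match the kernels \<open>H[p^n]\<close>.\<close>

lemma cong_pow_prime_power:
  fixes a b :: nat
  assumes "[a = b] (mod p)"
  shows "[a ^ p ^ n = b ^ p ^ n] (mod p ^ n)"
proof -
  have "[int a ^ p ^ n = int b ^ p ^ n] (mod int p ^ Suc n)"
  proof (induction n)
    case (Suc n)
    then show ?case
      using cong_pow_prime_lift[of "int a ^ p ^ n" "int b ^ p ^ n" p "Suc n"]
      by (simp add: power_mult[symmetric] mult.commute)
  qed (use assms in \<open>simp add: cong_int_iff\<close>)
  then have "[a ^ p ^ n = b ^ p ^ n] (mod p ^ Suc n)"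
    by (metis cong_int_iff of_nat_power)
  then show ?thesis by (rule cong_dvd_modulus_nat) simp
qed

lemma fermat_cong:
  fixes z :: nat
  assumes "prime p"
  shows "[z ^ p = z] (mod p)"
proof (cases "p dvd z")
  case True
  then show ?thesis
    using dvd_trans[OF True dvd_power[of p z]] prime_gt_0_nat[OF assms] by (simp add: cong_def mod_eq_0_iff_dvd)
next
  case False
  then have "[z * z ^ (p - 1) = z * 1] (mod p)"
    using fermat_theorem[OF assms False] by (intro cong_mult) auto
  then show ?thesis using assms by (simp add: power_eq_if[of z p] prime_gt_0_nat)
qed

text \<open>Fermat's congruence of z^p and z, raised to the power p^(n+d), compares consecutive
  terms. The sequence z^(p^n) is thus p-adically coherent, as \<open>ex_pow_limit\<close>
  requires.\<close>

lemma teichmueller_cong: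
  fixes z :: nat
  assumes "prime p" "n \<le> m"
  shows "[z ^ p ^ m = z ^ p ^ n] (mod p ^ n)"
proof -
  have "[z ^ p ^ (n + d) = z ^ p ^ n] (mod p ^ n)" for d
  proof (induction d)
    case (Suc d)
    have "[(z ^ p) ^ p ^ (n + d) = z ^ p ^ (n + d)] (mod p ^ (n + d))"
      by (intro cong_pow_prime_power fermat_cong assms)
    then have "[z ^ p ^ (n + Suc d) = z ^ p ^ (n + d)] (mod p ^ (n + d))"
      by (simp add: power_mult[symmetric] mult.commute)
    then have "[z ^ p ^ (n + Suc d) = z ^ p ^ (n + d)] (mod p ^ n)"
      by (rule cong_dvd_modulus_nat) (simp add: le_imp_power_dvd)
    then show ?case using Suc cong_trans by blast
  qed simp
  then show ?thesis using assms(2) by (metis le_add_diff_inverse)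
qed


section \<open>Functoriality of the points\<close>

text \<open>Between monoids \<open>hom\<close> does not include preservation of the unit, hence the
  separate assumption.\<close>

lemma hom_nat_pow:
  assumes "monoid G" "monoid G'" "F \<in> hom G G'" "F \<one>\<^bsub>G\<^esub> = \<one>\<^bsub>G'\<^esub>" "x \<in> carrier G"
  shows "F (x [^]\<^bsub>G\<^esub> (n::nat)) = F x [^]\<^bsub>G'\<^esub> n"
proof -
  interpret G: monoid G by fact
  interpret G': monoid G' by fact
  show ?thesis
    by (induction n) (use assms(3-5) in \<open>auto simp: hom_def Pi_iff\<close>)
qed

lemma points_map_apply [simp]: "h \<in> carrier H \<Longrightarrow> points_map H u f h = u (f h)"
  by (simp add: points_map_def compose_eq)

context
  fixes K :: "('k, 'r) ring_scheme" and H :: "('k, 'h) hopf"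
    and R :: "('k, 'a, 'x) module_scheme" and S :: "('k, 'b, 'y) module_scheme" and u
  assumes H: "bicommutative_hopf_algebra K H" and R: "algebra K R" and S: "algebra K S"
    and u: "u \<in> alg_hom K R S"
begin

interpretation PR: hopf_points K H R by (simp add: hopf_points_def H R)
interpretation PS: hopf_points K H S by (simp add: hopf_points_def H S)

lemma points_map_hom: "points_map H u \<in> hom (points K H R) (points K H S)"
proof (rule homI; unfold PR.G_simps PS.G_simps)
  show c: "points_map H u f \<in> alg_hom K H S" if "f \<in> alg_hom K H R" for f
    unfolding points_map_def using that u by (intro alg_hom_compose PR.H.algebra_axioms)
  fix f g assume f: "f \<in> alg_hom K H R" and g: "g \<in> alg_hom K H R"
  note l = alg_homD(2)[OF f] alg_homD(2)[OF g]
  note uD = alg_homD[OF u] and fD = alg_homD[OF f] and gD = alg_homD[OF g]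
  show "points_map H u (\<lambda>h\<in>carrier H. PR.conv f g h) =
       (\<lambda>h\<in>carrier H. PS.conv (points_map H u f) (points_map H u g) h)"
  proof (rule extensionalityI[of _ "carrier H"])
    fix h assume h: "h \<in> carrier H"
    have "u (PR.conv f g h) = tensor_lift S (\<lambda>x y. u (f x \<otimes>\<^bsub>R\<^esub> g y)) (comult H h)"
      unfolding PR.conv_def
      by (rule PR.HH.linear_lift[OF PR.R.module PS.R.module uD(2) PR.bilinear_prod[OF l]]) (simp add: h)
    also have "\<dots> = PS.conv (points_map H u f) (points_map H u g) h"
      unfolding PS.conv_def
      using PS.bilinear_prod[OF c[OF f, THEN alg_homD(2)] c[OF g, THEN alg_homD(2)]]
      by (intro PR.HH.lift_cong[symmetric] PS.R.module) (simp_all add: h uD fD gD)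
    finally show "points_map H u (\<lambda>h\<in>carrier H. PR.conv f g h) h =
       (\<lambda>h\<in>carrier H. PS.conv (points_map H u f) (points_map H u g) h) h" using h by simp
  qed (simp_all add: points_map_def)
qed

lemma points_map_one: "points_map H u \<one>\<^bsub>points K H R\<^esub> = \<one>\<^bsub>points K H S\<^esub>"
  unfolding PR.G_one PS.G_one
  by (rule extensionalityI[of _ "carrier H"])
    (simp_all add: points_map_def compose_eq alg_homD[OF u] ring_hom_closed[OF PR.H.counit_hom])

lemma points_map_pow:
  "f \<in> alg_hom K H R \<Longrightarrow> points_map H u (f [^]\<^bsub>points K H R\<^esub> (n::nat)) = points_map H u f [^]\<^bsub>points K H S\<^esub> n"
  by (rule hom_nat_pow[of _ _ "points_map H u"]) (simp_all add: PR.G.monoid_axioms PS.G.monoid_axioms points_map_hom points_map_one)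

end

context
  fixes K :: "('k, 'r) ring_scheme" and H :: "('k, 'h) hopf" and H' :: "('k, 'g) hopf"
    and R :: "('k, 'a, 'x) module_scheme" and \<phi>
  assumes H: "bicommutative_hopf_algebra K H" and H': "bicommutative_hopf_algebra K H'"
    and R: "algebra K R" and \<phi>: "\<phi> \<in> hopf_hom K H' H"
begin

interpretation P: hopf_points K H R by (simp add: hopf_points_def H R)
interpretation P': hopf_points K H' R by (simp add: hopf_points_def H' R)

lemma pullback_hom: "(\<lambda>f. compose (carrier H') f \<phi>) \<in> hom (points K H R) (points K H' R)"
proof (rule homI; unfold P.G_simps P'.G_simps)
  have \<phi>1: "\<phi> \<in> alg_hom K H' H" using \<phi> by (simp add: hopf_hom_def)
  note \<phi>D = alg_homD[OF \<phi>1]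
  show c: "compose (carrier H') f \<phi> \<in> alg_hom K H' R" if "f \<in> alg_hom K H R" for f
    using that \<phi>1 by (intro alg_hom_compose P'.H.algebra_axioms)
  fix f g assume f: "f \<in> alg_hom K H R" and g: "g \<in> alg_hom K H R"
  note fD = alg_homD[OF f] and gD = alg_homD[OF g]
  show "compose (carrier H') (\<lambda>h\<in>carrier H. P.conv f g h) \<phi> =
       (\<lambda>h\<in>carrier H'. P'.conv (compose (carrier H') f \<phi>) (compose (carrier H') g \<phi>) h)"
  proof (rule extensionalityI[of _ "carrier H'"])
    fix h assume h: "h \<in> carrier H'"
    have "P.conv f g (\<phi> h) = tensor_lift R (\<lambda>x y. f x \<otimes>\<^bsub>R\<^esub> g y) (tensor_map K H H \<phi> \<phi> (comult H' h))"
      using \<phi> h by (simp add: P.conv_def hopf_hom_def)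
    also have "\<dots> = tensor_lift R (\<lambda>x y. f (\<phi> x) \<otimes>\<^bsub>R\<^esub> g (\<phi> y)) (comult H' h)"
      by (rule lift_tensor_map[OF P'.H.module P'.H.module P.H.module P.H.module P.R.module \<phi>D(2) \<phi>D(2)
          P.bilinear_prod[OF fD(2) gD(2)]]) (simp add: h)
    also have "\<dots> = P'.conv (compose (carrier H') f \<phi>) (compose (carrier H') g \<phi>) h"
      unfolding P'.conv_def
      using P'.bilinear_prod[OF c[OF f, THEN alg_homD(2)] c[OF g, THEN alg_homD(2)]]
      by (intro P'.HH.lift_cong[symmetric] P.R.module) (simp_all add: h compose_eq)
    finally show "compose (carrier H') (\<lambda>h\<in>carrier H. P.conv f g h) \<phi> h =
       (\<lambda>h\<in>carrier H'. P'.conv (compose (carrier H') f \<phi>) (compose (carrier H') g \<phi>) h) h"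
      using h by (simp add: compose_eq \<phi>D)
  qed simp_all
qed

lemma pullback_one: "compose (carrier H') \<one>\<^bsub>points K H R\<^esub> \<phi> = \<one>\<^bsub>points K H' R\<^esub>"
  unfolding P.G_one P'.G_one
  by (rule extensionalityI[of _ "carrier H'"])
    (use \<phi> in \<open>auto simp: hopf_hom_def compose_eq alg_homD\<close>)

lemma pullback_pow:
  "f \<in> alg_hom K H R \<Longrightarrow>
   compose (carrier H') (f [^]\<^bsub>points K H R\<^esub> (n::nat)) \<phi> = compose (carrier H') f \<phi> [^]\<^bsub>points K H' R\<^esub> n"
  by (rule hom_nat_pow[of _ _ "\<lambda>f. compose (carrier H') f \<phi>"])
    (simp_all add: P.G.monoid_axioms P'.G.monoid_axioms pullback_hom pullback_one)

end


section \<open>p-adic groups\<close>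

context hopf_points
begin

lemma id_point: "(\<lambda>h\<in>carrier H. h) \<in> alg_hom K H H"
  by (rule alg_hom_id[OF H.algebra_axioms])

lemma mult_by_hom: "hopf_mult_by K H n \<in> alg_hom K H H"
proof -
  interpret P: hopf_points K H H
    by (simp add: hopf_points_def H.bicommutative_hopf_algebra_axioms H.algebra_axioms)
  show ?thesis
    unfolding hopf_mult_by_def
    using P.G.nat_pow_closed[of "\<lambda>h\<in>carrier H. h" n] id_point by (simp del: P.G.nat_pow_closed)
qed

text \<open>Yoneda: f is the image of the identity point of \<open>H\<close> under the homomorphism
  from G(H) to G(R) induced by f, and homomorphisms preserve powers.\<close>

lemma pow_eq_mult_by:
  assumes f: "f \<in> alg_hom K H R" and h: "h \<in> carrier H"
  shows "(f [^]\<^bsub>G\<^esub> n) h = f (hopf_mult_by K H n h)"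
proof -
  have "points_map H f (\<lambda>h\<in>carrier H. h) = f"
    using f by (auto simp: points_map_def compose_def alg_hom_def extensional_def)
  then have "f [^]\<^bsub>G\<^esub> n = points_map H f (hopf_mult_by K H n)"
    unfolding hopf_mult_by_def
    by (subst points_map_pow[OF _ _ _ f id_point])
      (simp_all add: H.bicommutative_hopf_algebra_axioms H.algebra_axioms R.algebra_axioms)
  then show ?thesis using h by simp
qed

text \<open>The left side is f \<otimes> g evaluated on (id \<otimes> [n])(comult h), and on the
  kernel this element is h \<otimes> 1. All statements about p-adic exponents rest on this.\<close>

lemma kernel_mult_pow:
  assumes f: "f \<in> alg_hom K H R" and g: "g \<in> alg_hom K H R"
    and h: "h \<in> hopf_kernel K H H (hopf_mult_by K H n)"
  shows "(f \<otimes>\<^bsub>G\<^esub> g [^]\<^bsub>G\<^esub> n) h = f h"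
proof -
  let ?\<phi> = "hopf_mult_by K H n"
  have h': "h \<in> carrier H" "tensor_map K H H (\<lambda>x. x) ?\<phi> (comult H h) = HH.cls [(h, \<one>\<^bsub>H\<^esub>)]"
    using h by (auto simp: hopf_kernel_def)
  note fD = alg_homD[OF f] and gD = alg_homD[OF g] and \<phi>D = alg_homD[OF mult_by_hom]
  have id: "(\<lambda>x. x) \<in> linear_map K H H" by (auto simp: linear_map_def)
  note b = bilinear_prod[OF fD(2) gD(2)]
  have gn: "g [^]\<^bsub>G\<^esub> n \<in> alg_hom K H R" using G.nat_pow_closed[of g n] g by simp
  have "(f \<otimes>\<^bsub>G\<^esub> g [^]\<^bsub>G\<^esub> n) h = conv f (g [^]\<^bsub>G\<^esub> n) h" using h' by simp
  also have "\<dots> = conv f (\<lambda>h. g (?\<phi> h)) h"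
    using h'(1) by (intro conv_cong fD(2) alg_homD(2)[OF gn]) (simp_all add: pow_eq_mult_by[OF g])
  also have "\<dots> = tensor_lift R (\<lambda>x y. f x \<otimes>\<^bsub>R\<^esub> g y) (tensor_map K H H (\<lambda>x. x) ?\<phi> (comult H h))"
    unfolding conv_def
    by (rule lift_tensor_map[OF H.module H.module H.module H.module R.module id \<phi>D(2) b, symmetric])
      (simp add: h')
  also have "\<dots> = f h"
    unfolding h'(2) using h'(1) by (simp add: HH.lift_class[OF R.module b] fD gD)
  finally show ?thesis .
qed

text \<open>Pointwise convergence on \<open>carrier H\<close>, with \<open>R\<close>
  discrete.\<close>

definition tends :: "(nat \<Rightarrow> 'h \<Rightarrow> 'a) \<Rightarrow> ('h \<Rightarrow> 'a) \<Rightarrow> bool" where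
  "tends F f \<longleftrightarrow> (\<forall>h\<in>carrier H. \<forall>\<^sub>F n in sequentially. F n h = f h)"

lemma tends_const: "tends (\<lambda>n. f) f"
  by (simp add: tends_def)

lemma tends_unique:
  assumes "tends F f" "tends F g" "f \<in> extensional (carrier H)" "g \<in> extensional (carrier H)"
  shows "f = g"
proof (rule extensionalityI[OF assms(3,4)])
  fix h assume "h \<in> carrier H"
  then have "\<forall>\<^sub>F n in sequentially. F n h = f h \<and> F n h = g h"
    using assms(1,2) by (auto simp: tends_def intro: eventually_conj)
  then show "f h = g h" by (auto dest: eventually_happens)
qed

text \<open>Each axiom of an algebra homomorphism involves finitely many elements of
  \<open>H\<close>, and some F n agrees with f on all of them.\<close>

lemma tends_alg_hom:
  assumes F: "\<And>n. F n \<in> alg_hom K H R" and f: "f \<in> extensional (carrier H)" and tends: "tends F f"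
  shows "f \<in> alg_hom K H R"
proof (rule alg_homI[OF f])
  have ev: "\<forall>\<^sub>F n in sequentially. F n h = f h" if "h \<in> carrier H" for h
    using tends that by (simp add: tends_def)
  have ex: "\<exists>n. \<forall>h\<in>A. F n h = f h" if "finite A" "A \<subseteq> carrier H" for A
  proof -
    have "\<forall>\<^sub>F n in sequentially. \<forall>h\<in>A. F n h = f h"
      using that ev by (intro eventually_ball_finite) auto
    then show ?thesis by (auto dest: eventually_happens)
  qed
  show "f x \<in> carrier R" if "x \<in> carrier H" for x
    using ex[of "{x}"] alg_homD(4)[OF F that] that by (metis empty_subsetI finite.emptyI finite.insertI insertI1 insert_subset)
  show "f (x \<otimes>\<^bsub>H\<^esub> y) = f x \<otimes>\<^bsub>R\<^esub> f y" if "x \<in> carrier H" "y \<in> carrier H" for x y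
    using ex[of "{x, y, x \<otimes>\<^bsub>H\<^esub> y}"] alg_homD(5)[OF F that] that by auto
  show "f (x \<oplus>\<^bsub>H\<^esub> y) = f x \<oplus>\<^bsub>R\<^esub> f y" if "x \<in> carrier H" "y \<in> carrier H" for x y
    using ex[of "{x, y, x \<oplus>\<^bsub>H\<^esub> y}"] alg_homD(6)[OF F that] that by auto
  show "f (a \<odot>\<^bsub>H\<^esub> x) = a \<odot>\<^bsub>R\<^esub> f x" if "a \<in> carrier K" "x \<in> carrier H" for a x
    using ex[of "{x, a \<odot>\<^bsub>H\<^esub> x}"] alg_homD(7)[OF F that] that by auto
  show "f \<one>\<^bsub>H\<^esub> = \<one>\<^bsub>R\<^esub>"
    using ex[of "{\<one>\<^bsub>H\<^esub>}"] alg_homD(8)[OF F] by auto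
qed

text \<open>Only finitely many elements of \<open>H\<close> occur in a representative of \<open>comult H h\<close>.\<close>

lemma tends_mult:
  assumes F: "\<And>n. F n \<in> alg_hom K H R" "f \<in> alg_hom K H R" "tends F f"
    and F': "\<And>n. F' n \<in> alg_hom K H R" "g \<in> alg_hom K H R" "tends F' g"
  shows "tends (\<lambda>n. F n \<otimes>\<^bsub>G\<^esub> F' n) (f \<otimes>\<^bsub>G\<^esub> g)"
  unfolding tends_def
proof
  fix h assume h: "h \<in> carrier H"
  obtain ts where ts: "ts \<in> HH.fsums" and eq: "\<And>f g. \<lbrakk>f \<in> linear_map K H R; g \<in> linear_map K H R\<rbrakk> \<Longrightarrow>
      conv f g h = HH.bsum R (\<lambda>x y. f x \<otimes>\<^bsub>R\<^esub> g y) ts"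
    using conv_legs[OF h] by blast
  have "\<forall>\<^sub>F n in sequentially. \<forall>t\<in>set ts. F n (fst t) = f (fst t) \<and> F' n (snd t) = g (snd t)"
    using F(3) F'(3) ts
    by (intro eventually_ball_finite) (auto simp: tends_def dest!: HH.fsumsD intro!: eventually_conj)
  then show "\<forall>\<^sub>F n in sequentially. (F n \<otimes>\<^bsub>G\<^esub> F' n) h = (f \<otimes>\<^bsub>G\<^esub> g) h"
  proof eventually_elim
    case (elim n)
    then have "HH.bsum R (\<lambda>x y. F n x \<otimes>\<^bsub>R\<^esub> F' n y) ts = HH.bsum R (\<lambda>x y. f x \<otimes>\<^bsub>R\<^esub> g y) ts"
      by (intro HH.bsum_cong[OF ts]) force
    then show ?case
      using F(1,2) F'(1,2) by (simp add: h eq alg_homD)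
  qed
qed

end

section \<open>The action of p-adic integers on points by limits of powers\<close>

locale padic_points = hopf_points K H R
  for K :: "('k, 'r) ring_scheme" and H :: "('k, 'h) hopf" and R :: "('k, 'a, 'x) module_scheme" +
  fixes p :: nat
  assumes prime: "prime p" and padic: "H \<in> AbSch_padic K p"
begin

definition level :: "nat \<Rightarrow> 'h set" where
  "level n = hopf_kernel K H H (hopf_mult_by K H (p ^ n))"

lemma level: "h \<in> level n \<Longrightarrow> h \<in> carrier H" "h \<in> carrier H \<Longrightarrow> \<exists>n. h \<in> level n"
proof -
  have "(\<Union>n. level n) = carrier H" using padic by (simp add: level_def AbSch_padic_def)
  then show "h \<in> level n \<Longrightarrow> h \<in> carrier H" "h \<in> carrier H \<Longrightarrow> \<exists>n. h \<in> level n" by blast+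
qed

lemma pow_closed [simp]: "f \<in> alg_hom K H R \<Longrightarrow> f [^]\<^bsub>G\<^esub> (n::nat) \<in> alg_hom K H R"
  using G.nat_pow_closed[of f n] by simp

lemma level_mult:
  assumes "f \<in> alg_hom K H R" "g \<in> alg_hom K H R" "h \<in> level n"
  shows "(f \<otimes>\<^bsub>G\<^esub> g [^]\<^bsub>G\<^esub> (p ^ n)) h = f h"
  using kernel_mult_pow[OF assms(1,2)] assms(3) by (simp add: level_def)

text \<open>The power with exponent c p^n is the p^n-th power of another point, and multiplying by
  it changes nothing on \<open>level n\<close>.\<close>

lemma level_pow_cong:
  assumes f: "f \<in> alg_hom K H R" and h: "h \<in> level n" and "[a = b] (mod p ^ n)"
  shows "(f [^]\<^bsub>G\<^esub> a) h = (f [^]\<^bsub>G\<^esub> b) h"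
proof -
  have *: "(f [^]\<^bsub>G\<^esub> (a + c * p ^ n)) h = (f [^]\<^bsub>G\<^esub> a) h" for a c
  proof -
    have "f [^]\<^bsub>G\<^esub> (a + c * p ^ n) = f [^]\<^bsub>G\<^esub> a \<otimes>\<^bsub>G\<^esub> (f [^]\<^bsub>G\<^esub> c) [^]\<^bsub>G\<^esub> (p ^ n)"
      using f by (subst G.nat_pow_mult[symmetric]) (simp_all only: G_simps(1) G.nat_pow_pow)
    then show ?thesis by (simp only: level_mult[OF pow_closed[OF f] pow_closed[OF f] h])
  qed
  obtain c d where "a + c * p ^ n = b + d * p ^ n"
    using assms(3) unfolding cong_iff_lin_nat by metis
  then show ?thesis using *[of a c] *[of b d] by simp
qed

text \<open>The coherent residues e n describe a p-adic integer, and g is the result of letting it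
  act on f. On \<open>level n\<close> the limit is already attained at index n, which gives exact
  formulas instead of eventual ones.\<close>

lemma ex_pow_limit:
  assumes f: "f \<in> alg_hom K H R" and e: "\<And>m n. n \<le> m \<Longrightarrow> [e m = e n] (mod p ^ n)"
  obtains g where "g \<in> alg_hom K H R" "\<And>h n. h \<in> level n \<Longrightarrow> g h = (f [^]\<^bsub>G\<^esub> e n) h"
    "tends (\<lambda>n. f [^]\<^bsub>G\<^esub> e n) g"
proof -
  define l where "l h = (SOME n. h \<in> level n)" for h
  have l: "h \<in> level (l h)" if "h \<in> carrier H" for h
    unfolding l_def using level(2)[OF that] by (rule someI_ex)
  define g where "g = (\<lambda>h\<in>carrier H. (f [^]\<^bsub>G\<^esub> e (l h)) h)"
  have eq: "(f [^]\<^bsub>G\<^esub> e m) h = (f [^]\<^bsub>G\<^esub> e n) h" if "h \<in> level n" "n \<le> m" for h m n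
    using level_pow_cong[OF f that(1) e[OF that(2)]] .
  have g: "g h = (f [^]\<^bsub>G\<^esub> e n) h" if "h \<in> level n" for h n
  proof -
    have h: "h \<in> carrier H" by (rule level(1)[OF that])
    then show ?thesis
      using eq[OF that, of "l h"] eq[OF l[OF h], of n] by (cases "n \<le> l h") (simp_all add: g_def)
  qed
  have t: "tends (\<lambda>n. f [^]\<^bsub>G\<^esub> e n) g"
    unfolding tends_def
  proof
    fix h assume "h \<in> carrier H"
    then obtain n where n: "h \<in> level n" using level(2) by blast
    show "\<forall>\<^sub>F m in sequentially. (f [^]\<^bsub>G\<^esub> e m) h = g h"
      unfolding g[OF n] eventually_sequentially using eq[OF n] by blast
  qed
  have "g \<in> alg_hom K H R"
    by (rule tends_alg_hom[OF _ _ t]) (use f in \<open>simp_all add: g_def\<close>)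
  then show thesis using g t by (rule that)
qed

text \<open>The inverse of \<open>f\<close> is the limit of \<open>f ^ (p ^ n - 1)\<close>. This makes it unnecessary to know that the
  antipode is multiplicative.\<close>

lemma comm_group_G: "comm_group G"
proof -
  \<comment> \<open>The residues p^n - 1 are coherent and represent the p-adic integer -1.\<close>
  have pow: "[p ^ m - 1 = p ^ n - 1] (mod p ^ n)" if "n \<le> m" for m n
  proof -
    have "p ^ n \<noteq> 0" "p ^ (m - n) \<noteq> 0" using prime_gt_0_nat[OF prime] by simp_all
    then obtain x y where xy: "p ^ n = Suc x" "p ^ (m - n) = Suc y" by (metis not0_implies_Suc)
    have "p ^ m = p ^ n * p ^ (m - n)" using that by (simp add: power_add[symmetric])
    with xy have "p ^ m - 1 = (p ^ n - 1) + p ^ n * (p ^ (m - n) - 1)" by simp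
    then show ?thesis by (simp add: cong_def)
  qed
  have "\<exists>g\<in>carrier G. g \<otimes>\<^bsub>G\<^esub> f = \<one>\<^bsub>G\<^esub>" if "f \<in> carrier G" for f
  proof -
    have f: "f \<in> alg_hom K H R" using that by simp
    obtain g where g: "g \<in> alg_hom K H R" "tends (\<lambda>n. f [^]\<^bsub>G\<^esub> (p ^ n - 1)) g"
      using ex_pow_limit[OF f pow] by blast
    have t: "tends (\<lambda>n. f [^]\<^bsub>G\<^esub> (p ^ n - 1) \<otimes>\<^bsub>G\<^esub> f) (g \<otimes>\<^bsub>G\<^esub> f)"
      using f g by (intro tends_mult tends_const) simp_all
    have "f [^]\<^bsub>G\<^esub> (p ^ n - 1) \<otimes>\<^bsub>G\<^esub> f = f [^]\<^bsub>G\<^esub> (p ^ n)" for n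
    proof -
      have "p ^ n \<noteq> 0" using prime_gt_0_nat[OF prime] by simp
      then obtain x where "p ^ n = Suc x" by (metis not0_implies_Suc)
      then show ?thesis by simp
    qed
    moreover have "tends (\<lambda>n. f [^]\<^bsub>G\<^esub> (p ^ n)) \<one>\<^bsub>G\<^esub>"
      unfolding tends_def
    proof
      fix h assume "h \<in> carrier H"
      then obtain n where n: "h \<in> level n" using level(2) by blast
      have "(f [^]\<^bsub>G\<^esub> (p ^ m)) h = \<one>\<^bsub>G\<^esub> h" if "n \<le> m" for m
          using level_pow_cong[OF f n, of "p ^ m" 0] le_imp_power_dvd[OF that, of p]
        by (simp add: cong_0_iff del: G_simps)
      then show "\<forall>\<^sub>F m in sequentially. (f [^]\<^bsub>G\<^esub> (p ^ m)) h = \<one>\<^bsub>G\<^esub> h"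
        unfolding eventually_sequentially by blast
    qed
    ultimately have "g \<otimes>\<^bsub>G\<^esub> f = \<one>\<^bsub>G\<^esub>"
      using t f g G.one_closed
      by (intro tends_unique[of "\<lambda>n. f [^]\<^bsub>G\<^esub> (p ^ n)"]) (simp_all add: alg_homD(3))
    then show ?thesis using g by auto
  qed
  then have "group G" by (rule G.group_l_invI)
  then show ?thesis by (simp add: comm_group_def comm_monoid_G)
qed

sublocale G: comm_group G
  by (rule comm_group_G)

text \<open>Modulo p^n the exponent -a equals a (p^n - 1). This replaces powers of the inverse by
  natural powers of f itself, at the price that the exponent depends on the level.\<close>

lemma level_inv_pow:
  assumes f: "f \<in> alg_hom K H R" and h: "h \<in> level n"
  shows "((inv\<^bsub>G\<^esub> f) [^]\<^bsub>G\<^esub> a) h = (f [^]\<^bsub>G\<^esub> (a * (p ^ n - 1))) h"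
proof -
  have c: "f \<in> carrier G" "inv\<^bsub>G\<^esub> f \<in> carrier G" using f G.inv_closed[of f] by auto
  have "p ^ n \<noteq> 0" using prime_gt_0_nat[OF prime] by simp
  then obtain x where "p ^ n = Suc x" by (metis not0_implies_Suc)
  then have split: "a * p ^ n = a * (p ^ n - 1) + a" by simp
  have "f [^]\<^bsub>G\<^esub> (a * (p ^ n - 1)) \<otimes>\<^bsub>G\<^esub> ((inv\<^bsub>G\<^esub> f) [^]\<^bsub>G\<^esub> a) [^]\<^bsub>G\<^esub> (p ^ n)
    = f [^]\<^bsub>G\<^esub> (a * (p ^ n - 1)) \<otimes>\<^bsub>G\<^esub> ((inv\<^bsub>G\<^esub> f) [^]\<^bsub>G\<^esub> (a * (p ^ n - 1)) \<otimes>\<^bsub>G\<^esub> (inv\<^bsub>G\<^esub> f) [^]\<^bsub>G\<^esub> a)"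
    unfolding G.nat_pow_pow[OF c(2)] split G.nat_pow_mult[OF c(2)] ..
  also have "\<dots> = (f [^]\<^bsub>G\<^esub> (a * (p ^ n - 1)) \<otimes>\<^bsub>G\<^esub> (inv\<^bsub>G\<^esub> f) [^]\<^bsub>G\<^esub> (a * (p ^ n - 1))) \<otimes>\<^bsub>G\<^esub> (inv\<^bsub>G\<^esub> f) [^]\<^bsub>G\<^esub> a"
    by (rule G.m_assoc[symmetric]) (intro G.nat_pow_closed c)+
  also have "f [^]\<^bsub>G\<^esub> (a * (p ^ n - 1)) \<otimes>\<^bsub>G\<^esub> (inv\<^bsub>G\<^esub> f) [^]\<^bsub>G\<^esub> (a * (p ^ n - 1)) = \<one>\<^bsub>G\<^esub>"
    unfolding G.nat_pow_inv[OF c(1)] by (rule G.r_inv[OF G.nat_pow_closed[OF c(1)]])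
  also have "\<one>\<^bsub>G\<^esub> \<otimes>\<^bsub>G\<^esub> (inv\<^bsub>G\<^esub> f) [^]\<^bsub>G\<^esub> a = (inv\<^bsub>G\<^esub> f) [^]\<^bsub>G\<^esub> a"
    by (rule G.l_one) (intro G.nat_pow_closed c)
  finally show ?thesis
    using level_mult[of "f [^]\<^bsub>G\<^esub> (a * (p ^ n - 1))" "(inv\<^bsub>G\<^esub> f) [^]\<^bsub>G\<^esub> a" h n] c h
    by (simp only: G_simps(1) pow_closed)
qed

end

section \<open>The enveloping algebra of a polar algebra\<close>

definition lprod :: "('a, 'x) monoid_scheme \<Rightarrow> 'a list \<Rightarrow> 'a" where
  "lprod R xs = foldr (\<otimes>\<^bsub>R\<^esub>) xs \<one>\<^bsub>R\<^esub>"

lemma lprod_simps [simp]: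
  "lprod R [] = \<one>\<^bsub>R\<^esub>" "lprod R (x # xs) = x \<otimes>\<^bsub>R\<^esub> lprod R xs"
  by (simp_all add: lprod_def)

lemma (in monoid) lprod_closed [simp]: "set xs \<subseteq> carrier G \<Longrightarrow> lprod G xs \<in> carrier G"
  by (induction xs) auto

lemma (in monoid) lprod_append [simp]:
  "\<lbrakk>set xs \<subseteq> carrier G; set ys \<subseteq> carrier G\<rbrakk> \<Longrightarrow> lprod G (xs @ ys) = lprod G xs \<otimes> lprod G ys"
  by (induction xs) (auto simp: m_assoc)

lemma alg_hom_lprod:
  assumes "algebra K R" "f \<in> alg_hom K R S" "set xs \<subseteq> carrier R"
  shows "f (lprod R xs) = lprod S (map f xs)"
proof -
  interpret R: algebra K R by fact
  show ?thesis using assms(3) by (induction xs) (auto simp: alg_homD[OF assms(2)])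
qed

datatype ('k, 'a) pexpr =
  PCon 'k | PGen 'a | PAdd "('k, 'a) pexpr" "('k, 'a) pexpr" | PMul "('k, 'a) pexpr" "('k, 'a) pexpr"

primrec pexpr_over :: "('k, 'r) ring_scheme \<Rightarrow> ('a, 'x) partial_object_scheme \<Rightarrow> ('k, 'a) pexpr \<Rightarrow> bool" where
  "pexpr_over K A (PCon a) \<longleftrightarrow> a \<in> carrier K"
| "pexpr_over K A (PGen x) \<longleftrightarrow> x \<in> carrier A"
| "pexpr_over K A (PAdd d e) \<longleftrightarrow> pexpr_over K A d \<and> pexpr_over K A e"
| "pexpr_over K A (PMul d e) \<longleftrightarrow> pexpr_over K A d \<and> pexpr_over K A e"

text \<open>Congruence of polynomial expressions generated by the laws of commutative algebras,
  linearity of \<open>PGen\<close> and, in \<open>gen_mu\<close>, the polar product. Negation is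
  multiplication by the constant -1; as cancellation is not among the rules, \<open>mul_zero\<close>
  is imposed to make it an inverse.\<close>

inductive env_rel ::
    "('k, 'r) ring_scheme \<Rightarrow> nat \<Rightarrow> ('k, 'a) polar \<Rightarrow> ('k, 'a) pexpr \<Rightarrow> ('k, 'a) pexpr \<Rightarrow> bool"
  for K p A where
    refl: "pexpr_over K A d \<Longrightarrow> env_rel K p A d d"
  | sym: "env_rel K p A d e \<Longrightarrow> env_rel K p A e d"
  | trans: "\<lbrakk>env_rel K p A d e; env_rel K p A e f\<rbrakk> \<Longrightarrow> env_rel K p A d f"
  | add: "\<lbrakk>env_rel K p A d e; env_rel K p A d' e'\<rbrakk> \<Longrightarrow> env_rel K p A (PAdd d d') (PAdd e e')"
  | mul: "\<lbrakk>env_rel K p A d e; env_rel K p A d' e'\<rbrakk> \<Longrightarrow> env_rel K p A (PMul d d') (PMul e e')"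
  | add_assoc: "\<lbrakk>pexpr_over K A d; pexpr_over K A e; pexpr_over K A f\<rbrakk> \<Longrightarrow>
      env_rel K p A (PAdd (PAdd d e) f) (PAdd d (PAdd e f))"
  | add_comm: "\<lbrakk>pexpr_over K A d; pexpr_over K A e\<rbrakk> \<Longrightarrow> env_rel K p A (PAdd d e) (PAdd e d)"
  | add_zero: "pexpr_over K A d \<Longrightarrow> env_rel K p A (PAdd (PCon \<zero>\<^bsub>K\<^esub>) d) d"
  | mul_assoc: "\<lbrakk>pexpr_over K A d; pexpr_over K A e; pexpr_over K A f\<rbrakk> \<Longrightarrow>
      env_rel K p A (PMul (PMul d e) f) (PMul d (PMul e f))"
  | mul_comm: "\<lbrakk>pexpr_over K A d; pexpr_over K A e\<rbrakk> \<Longrightarrow> env_rel K p A (PMul d e) (PMul e d)"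
  | mul_one: "pexpr_over K A d \<Longrightarrow> env_rel K p A (PMul (PCon \<one>\<^bsub>K\<^esub>) d) d"
  | mul_zero: "pexpr_over K A d \<Longrightarrow> env_rel K p A (PMul (PCon \<zero>\<^bsub>K\<^esub>) d) (PCon \<zero>\<^bsub>K\<^esub>)"
  | distr: "\<lbrakk>pexpr_over K A d; pexpr_over K A e; pexpr_over K A f\<rbrakk> \<Longrightarrow>
      env_rel K p A (PMul (PAdd d e) f) (PAdd (PMul d f) (PMul e f))"
  | con_add: "\<lbrakk>a \<in> carrier K; b \<in> carrier K\<rbrakk> \<Longrightarrow>
      env_rel K p A (PCon (a \<oplus>\<^bsub>K\<^esub> b)) (PAdd (PCon a) (PCon b))"
  | con_mul: "\<lbrakk>a \<in> carrier K; b \<in> carrier K\<rbrakk> \<Longrightarrow>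
      env_rel K p A (PCon (a \<otimes>\<^bsub>K\<^esub> b)) (PMul (PCon a) (PCon b))"
  | gen_add: "\<lbrakk>x \<in> carrier A; y \<in> carrier A\<rbrakk> \<Longrightarrow>
      env_rel K p A (PGen (x \<oplus>\<^bsub>A\<^esub> y)) (PAdd (PGen x) (PGen y))"
  | gen_smult: "\<lbrakk>a \<in> carrier K; x \<in> carrier A\<rbrakk> \<Longrightarrow>
      env_rel K p A (PGen (a \<odot>\<^bsub>A\<^esub> x)) (PMul (PCon a) (PGen x))"
  | gen_mu: "xs \<in> tuples p A \<Longrightarrow>
      env_rel K p A (PGen (mu A xs)) (foldr PMul (map PGen xs) (PCon \<one>\<^bsub>K\<^esub>))"

definition env_class ::
    "('k, 'r) ring_scheme \<Rightarrow> nat \<Rightarrow> ('k, 'a) polar \<Rightarrow> ('k, 'a) pexpr \<Rightarrow> ('k, 'a) pexpr set" where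
  "env_class K p A d = {e. env_rel K p A d e}"

definition rep :: "'e set \<Rightarrow> 'e" where
  "rep X = (SOME e. e \<in> X)"

definition envelope ::
    "('k, 'r) ring_scheme \<Rightarrow> nat \<Rightarrow> ('k, 'a) polar \<Rightarrow> ('k, ('k, 'a) pexpr set) module" where
  "envelope K p A =
     \<lparr>carrier = env_class K p A ` {d. pexpr_over K A d},
      mult = (\<lambda>X Y. env_class K p A (PMul (rep X) (rep Y))),
      one = env_class K p A (PCon \<one>\<^bsub>K\<^esub>),
      zero = env_class K p A (PCon \<zero>\<^bsub>K\<^esub>),
      add = (\<lambda>X Y. env_class K p A (PAdd (rep X) (rep Y))),
      smult = (\<lambda>a X. env_class K p A (PMul (PCon a) (rep X)))\<rparr>"

primrec pexpr_eval :: "('k, 's, 'x) module_scheme \<Rightarrow> ('a \<Rightarrow> 's) \<Rightarrow> ('k, 'a) pexpr \<Rightarrow> 's" where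
  "pexpr_eval S \<beta> (PCon a) = a \<odot>\<^bsub>S\<^esub> \<one>\<^bsub>S\<^esub>"
| "pexpr_eval S \<beta> (PGen x) = \<beta> x"
| "pexpr_eval S \<beta> (PAdd d e) = pexpr_eval S \<beta> d \<oplus>\<^bsub>S\<^esub> pexpr_eval S \<beta> e"
| "pexpr_eval S \<beta> (PMul d e) = pexpr_eval S \<beta> d \<otimes>\<^bsub>S\<^esub> pexpr_eval S \<beta> e"

definition env_lift ::
    "('k, 'r) ring_scheme \<Rightarrow> nat \<Rightarrow> ('k, 'a) polar \<Rightarrow> ('k, 's, 'x) module_scheme \<Rightarrow> ('a \<Rightarrow> 's)
     \<Rightarrow> ('k, 'a) pexpr set \<Rightarrow> 's" where
  "env_lift K p A S \<beta> = (\<lambda>X\<in>carrier (envelope K p A). pexpr_eval S \<beta> (rep X))"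

definition env_gen ::
    "('k, 'r) ring_scheme \<Rightarrow> nat \<Rightarrow> ('k, 'a) polar \<Rightarrow> 'a \<Rightarrow> ('k, 'a) pexpr set" where
  "env_gen K p A x = env_class K p A (PGen x)"

text \<open>For an algebra \<open>S\<close> these are the polar morphisms from \<open>A\<close> to
  the polarization of \<open>S\<close>, without the extensionality required in
  \<open>polar_hom\<close>.\<close>

definition polar_map ::
    "('k, 'r) ring_scheme \<Rightarrow> nat \<Rightarrow> ('k, 'a) polar \<Rightarrow> ('k, 's, 'x) module_scheme \<Rightarrow> ('a \<Rightarrow> 's) set" where
  "polar_map K p A S =
     {\<beta> \<in> linear_map K A S. \<forall>xs\<in>tuples p A. \<beta> (mu A xs) = lprod S (map \<beta> xs)}"

context polar_algebra
begin

abbreviation E where "E \<equiv> envelope K p A"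
abbreviation cl where "cl \<equiv> env_class K p A"
abbreviation gen where "gen \<equiv> env_gen K p A"

lemma rel_over: "env_rel K p A d e \<Longrightarrow> pexpr_over K A d \<and> pexpr_over K A e"
proof (induction rule: env_rel.induct)
  case (gen_mu xs)
  then have "set xs \<subseteq> carrier A" by (simp add: tuples_def)
  then have "pexpr_over K A (foldr PMul (map PGen xs) (PCon \<one>\<^bsub>K\<^esub>))" by (induction xs) auto
  with mu_closed[OF gen_mu] show ?case by simp
qed auto

lemma cl_eqI: "env_rel K p A d e \<Longrightarrow> cl d = cl e"
  by (auto simp: env_class_def intro: env_rel.sym env_rel.trans)

lemma rep_cl: "pexpr_over K A d \<Longrightarrow> env_rel K p A d (rep (cl d))"
  unfolding rep_def env_class_def by (simp, rule someI, rule env_rel.refl)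

lemma E_cases:
  assumes "X \<in> carrier E"
  obtains d where "pexpr_over K A d" "X = cl d"
  using assms by (auto simp: envelope_def)

lemma cl_closed [simp]: "pexpr_over K A d \<Longrightarrow> cl d \<in> carrier E"
  by (auto simp: envelope_def)

lemma cl_add: "\<lbrakk>pexpr_over K A d; pexpr_over K A e\<rbrakk> \<Longrightarrow> cl d \<oplus>\<^bsub>E\<^esub> cl e = cl (PAdd d e)"
  by (simp add: envelope_def) (intro cl_eqI env_rel.sym[OF env_rel.add] rep_cl)

lemma cl_mul: "\<lbrakk>pexpr_over K A d; pexpr_over K A e\<rbrakk> \<Longrightarrow> cl d \<otimes>\<^bsub>E\<^esub> cl e = cl (PMul d e)"
  by (simp add: envelope_def) (intro cl_eqI env_rel.sym[OF env_rel.mul] rep_cl)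

lemma cl_smult: "\<lbrakk>pexpr_over K A d; a \<in> carrier K\<rbrakk> \<Longrightarrow> a \<odot>\<^bsub>E\<^esub> cl d = cl (PMul (PCon a) d)"
  by (simp add: envelope_def) (intro cl_eqI env_rel.sym[OF env_rel.mul] rep_cl env_rel.refl; simp)

lemma E_one: "\<one>\<^bsub>E\<^esub> = cl (PCon \<one>\<^bsub>K\<^esub>)" and E_zero: "\<zero>\<^bsub>E\<^esub> = cl (PCon \<zero>\<^bsub>K\<^esub>)"
  by (simp_all add: envelope_def)

lemma cring_E: "cring E"
proof (rule cringI)
  show "abelian_group E"
  proof (rule abelian_groupI)
    fix X assume "X \<in> carrier E"
    then obtain d where d: "pexpr_over K A d" "X = cl d" by (rule E_cases)
    let ?m = "PMul (PCon (\<ominus>\<^bsub>K\<^esub> \<one>\<^bsub>K\<^esub>)) d"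
    have "env_rel K p A (PAdd ?m d) (PAdd ?m (PMul (PCon \<one>\<^bsub>K\<^esub>) d))"
      using d by (intro env_rel.add env_rel.refl env_rel.sym[OF env_rel.mul_one]) simp_all
    moreover have "env_rel K p A (PAdd ?m (PMul (PCon \<one>\<^bsub>K\<^esub>) d)) (PMul (PAdd (PCon (\<ominus>\<^bsub>K\<^esub> \<one>\<^bsub>K\<^esub>)) (PCon \<one>\<^bsub>K\<^esub>)) d)"
      using d by (intro env_rel.sym[OF env_rel.distr]) simp_all
    moreover have "env_rel K p A (PMul (PAdd (PCon (\<ominus>\<^bsub>K\<^esub> \<one>\<^bsub>K\<^esub>)) (PCon \<one>\<^bsub>K\<^esub>)) d) (PMul (PCon (\<ominus>\<^bsub>K\<^esub> \<one>\<^bsub>K\<^esub> \<oplus>\<^bsub>K\<^esub> \<one>\<^bsub>K\<^esub>)) d)"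
      using d by (intro env_rel.mul env_rel.refl env_rel.sym[OF env_rel.con_add]) simp_all
    ultimately have m: "env_rel K p A (PAdd ?m d) (PMul (PCon \<zero>\<^bsub>K\<^esub>) d)"
      by (metis env_rel.trans R.l_neg R.one_closed)
    have z: "env_rel K p A (PMul (PCon \<zero>\<^bsub>K\<^esub>) d) (PCon \<zero>\<^bsub>K\<^esub>)"
      using d by (intro env_rel.mul_zero)
    show "\<exists>Y\<in>carrier E. Y \<oplus>\<^bsub>E\<^esub> X = \<zero>\<^bsub>E\<^esub>"
      using d cl_eqI[OF env_rel.trans[OF m z]]
      by (intro bexI[of _ "cl ?m"]) (simp_all add: cl_add E_zero)
  next
    fix X Y Z assume XYZ: "X \<in> carrier E" "Y \<in> carrier E" "Z \<in> carrier E"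
    then show "X \<oplus>\<^bsub>E\<^esub> Y \<oplus>\<^bsub>E\<^esub> Z = X \<oplus>\<^bsub>E\<^esub> (Y \<oplus>\<^bsub>E\<^esub> Z)"
      by (elim E_cases) (simp add: cl_add cl_eqI[OF env_rel.add_assoc])
  next
    fix X Y assume XYZ: "X \<in> carrier E" "Y \<in> carrier E"
    then show "X \<oplus>\<^bsub>E\<^esub> Y = Y \<oplus>\<^bsub>E\<^esub> X"
      by (elim E_cases) (simp add: cl_add cl_eqI[OF env_rel.add_comm])
  next
    fix X assume "X \<in> carrier E"
    then show "\<zero>\<^bsub>E\<^esub> \<oplus>\<^bsub>E\<^esub> X = X"
      by (elim E_cases) (simp add: E_zero cl_add cl_eqI[OF env_rel.add_zero])
  qed (auto elim!: E_cases simp: E_zero cl_add)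
  show "comm_monoid E"
  proof (rule comm_monoidI)
    fix X Y Z assume "X \<in> carrier E" "Y \<in> carrier E" "Z \<in> carrier E"
    then show "X \<otimes>\<^bsub>E\<^esub> Y \<otimes>\<^bsub>E\<^esub> Z = X \<otimes>\<^bsub>E\<^esub> (Y \<otimes>\<^bsub>E\<^esub> Z)"
      by (elim E_cases) (simp add: cl_mul cl_eqI[OF env_rel.mul_assoc])
  next
    fix X Y assume "X \<in> carrier E" "Y \<in> carrier E"
    then show "X \<otimes>\<^bsub>E\<^esub> Y = Y \<otimes>\<^bsub>E\<^esub> X"
      by (elim E_cases) (simp add: cl_mul cl_eqI[OF env_rel.mul_comm])
  next
    fix X assume "X \<in> carrier E"
    then show "\<one>\<^bsub>E\<^esub> \<otimes>\<^bsub>E\<^esub> X = X"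
      by (elim E_cases) (simp add: E_one cl_mul cl_eqI[OF env_rel.mul_one])
  qed (auto elim!: E_cases simp: E_one cl_mul)
next
  fix X Y Z assume "X \<in> carrier E" "Y \<in> carrier E" "Z \<in> carrier E"
  then show "(X \<oplus>\<^bsub>E\<^esub> Y) \<otimes>\<^bsub>E\<^esub> Z = X \<otimes>\<^bsub>E\<^esub> Z \<oplus>\<^bsub>E\<^esub> Y \<otimes>\<^bsub>E\<^esub> Z"
    by (elim E_cases) (simp add: cl_mul cl_add cl_eqI[OF env_rel.distr])
qed

lemma mul_con_assoc:
  assumes "a \<in> carrier K" "b \<in> carrier K" "pexpr_over K A d"
  shows "cl (PMul (PCon (a \<otimes>\<^bsub>K\<^esub> b)) d) = cl (PMul (PCon a) (PMul (PCon b) d))"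
proof (rule cl_eqI, rule env_rel.trans)
  show "env_rel K p A (PMul (PCon (a \<otimes>\<^bsub>K\<^esub> b)) d) (PMul (PMul (PCon a) (PCon b)) d)"
    using assms by (intro env_rel.mul env_rel.con_mul env_rel.refl)
  show "env_rel K p A (PMul (PMul (PCon a) (PCon b)) d) (PMul (PCon a) (PMul (PCon b) d))"
    using assms by (intro env_rel.mul_assoc) simp_all
qed

lemma mul_con_distr:
  assumes "a \<in> carrier K" "b \<in> carrier K" "pexpr_over K A d"
  shows "cl (PMul (PCon (a \<oplus>\<^bsub>K\<^esub> b)) d) = cl (PAdd (PMul (PCon a) d) (PMul (PCon b) d))"
proof (rule cl_eqI, rule env_rel.trans)
  show "env_rel K p A (PMul (PCon (a \<oplus>\<^bsub>K\<^esub> b)) d) (PMul (PAdd (PCon a) (PCon b)) d)"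
    using assms by (intro env_rel.mul env_rel.con_add env_rel.refl)
  show "env_rel K p A (PMul (PAdd (PCon a) (PCon b)) d) (PAdd (PMul (PCon a) d) (PMul (PCon b) d))"
    using assms by (intro env_rel.distr) simp_all
qed

lemma algebra_E: "algebra K E"
proof (rule algebraI)
  interpret E: cring E by (rule cring_E)
  have con: "a \<odot>\<^bsub>E\<^esub> X = cl (PCon a) \<otimes>\<^bsub>E\<^esub> X" if "a \<in> carrier K" "X \<in> carrier E" for a X
    using that by (auto elim!: E_cases simp: cl_smult cl_mul)
  have c: "cl (PCon a) \<in> carrier E" if "a \<in> carrier K" for a using that by simp
  fix a X Y assume a: "a \<in> carrier K" "X \<in> carrier E" "Y \<in> carrier E"
  show "a \<odot>\<^bsub>E\<^esub> X \<in> carrier E" using a c by (simp add: con del: cl_closed)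
  then show "(a \<odot>\<^bsub>E\<^esub> X) \<otimes>\<^bsub>E\<^esub> Y = a \<odot>\<^bsub>E\<^esub> (X \<otimes>\<^bsub>E\<^esub> Y)"
    using a c by (simp add: con E.m_assoc del: cl_closed)
  show "a \<odot>\<^bsub>E\<^esub> (X \<oplus>\<^bsub>E\<^esub> Y) = (a \<odot>\<^bsub>E\<^esub> X) \<oplus>\<^bsub>E\<^esub> (a \<odot>\<^bsub>E\<^esub> Y)"
    using a c by (simp add: con E.r_distr del: cl_closed)
  fix b assume b: "b \<in> carrier K"
  show "(a \<oplus>\<^bsub>K\<^esub> b) \<odot>\<^bsub>E\<^esub> X = (a \<odot>\<^bsub>E\<^esub> X) \<oplus>\<^bsub>E\<^esub> (b \<odot>\<^bsub>E\<^esub> X)"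
    "(a \<otimes>\<^bsub>K\<^esub> b) \<odot>\<^bsub>E\<^esub> X = a \<odot>\<^bsub>E\<^esub> (b \<odot>\<^bsub>E\<^esub> X)"
    using a b by (auto elim!: E_cases simp: cl_smult cl_add mul_con_distr mul_con_assoc)
qed (auto elim!: E_cases simp: cl_smult cring_E R.is_cring cl_eqI[OF env_rel.mul_one])

sublocale E: algebra K E
  by (rule algebra_E)

lemma cl_con: "a \<in> carrier K \<Longrightarrow> cl (PCon a) = a \<odot>\<^bsub>E\<^esub> \<one>\<^bsub>E\<^esub>"
proof -
  assume a: "a \<in> carrier K"
  then have "a \<odot>\<^bsub>E\<^esub> \<one>\<^bsub>E\<^esub> = cl (PMul (PCon a) (PCon \<one>\<^bsub>K\<^esub>))" by (simp add: E_one cl_smult)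
  also have "\<dots> = cl (PMul (PCon \<one>\<^bsub>K\<^esub>) (PCon a))" using a by (intro cl_eqI env_rel.mul_comm) simp_all
  also have "\<dots> = cl (PCon a)" using a by (intro cl_eqI env_rel.mul_one) simp_all
  finally show ?thesis ..
qed

lemma cl_lprod: "set xs \<subseteq> carrier A \<Longrightarrow> cl (foldr PMul (map PGen xs) (PCon \<one>\<^bsub>K\<^esub>)) = lprod E (map gen xs)"
proof (induction xs)
  case (Cons x xs)
  have "pexpr_over K A (foldr PMul (map PGen xs) (PCon \<one>\<^bsub>K\<^esub>))"
    using Cons.prems by (induction xs) auto
  with Cons show ?case by (simp add: env_gen_def cl_mul[symmetric])
qed (simp add: E_one)

lemma gen_polar: "gen \<in> polar_map K p A E"
  unfolding polar_map_def linear_map_def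
proof (intro CollectI IntI conjI ballI Pi_I)
  fix xs assume xs: "xs \<in> tuples p A"
  then show "gen (mu A xs) = lprod E (map gen xs)"
    using cl_eqI[OF env_rel.gen_mu[OF xs, of K]] by (simp add: cl_lprod[symmetric] tuples_def env_gen_def)
qed (simp_all add: env_gen_def cl_add cl_smult cl_eqI[OF env_rel.gen_add] cl_eqI[OF env_rel.gen_smult])

lemma gen_closed [simp]: "x \<in> carrier A \<Longrightarrow> gen x \<in> carrier E"
  by (simp add: env_gen_def)

lemma E_induct [consumes 1, case_names con gen add mul]:
  assumes "X \<in> carrier E"
    and "\<And>a. a \<in> carrier K \<Longrightarrow> P (a \<odot>\<^bsub>E\<^esub> \<one>\<^bsub>E\<^esub>)"
    and "\<And>x. x \<in> carrier A \<Longrightarrow> P (gen x)"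
    and "\<And>X Y. \<lbrakk>X \<in> carrier E; Y \<in> carrier E; P X; P Y\<rbrakk> \<Longrightarrow> P (X \<oplus>\<^bsub>E\<^esub> Y)"
    and "\<And>X Y. \<lbrakk>X \<in> carrier E; Y \<in> carrier E; P X; P Y\<rbrakk> \<Longrightarrow> P (X \<otimes>\<^bsub>E\<^esub> Y)"
  shows "P X"
proof -
  have "P (cl d)" if "pexpr_over K A d" for d
    using that
  proof (induction d)
    case (PCon a)
    then show ?case using assms(2) by (simp add: cl_con)
  next
    case (PGen x)
    then show ?case using assms(3) by (simp add: env_gen_def)
  next
    case (PAdd d e)
    then show ?case using assms(4)[of "cl d" "cl e"] by (simp add: cl_add)
  next
    case (PMul d e)
    then show ?case using assms(5)[of "cl d" "cl e"] by (simp add: cl_mul)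
  qed
  then show ?thesis using assms(1) by (metis E_cases)
qed

text \<open>Uniqueness half of the universal property, by which identities between maps out of the
  envelope are checked on generators.\<close>

lemma alg_hom_E_eqI:
  assumes f: "f \<in> alg_hom K E S" and g: "g \<in> alg_hom K E S" and eq: "\<And>x. x \<in> carrier A \<Longrightarrow> f (gen x) = g (gen x)"
  shows "f = g"
proof (rule extensionalityI[OF alg_homD(3)[OF f] alg_homD(3)[OF g]])
  show "f X = g X" if "X \<in> carrier E" for X
    using that by (induction rule: E_induct) (simp_all add: alg_homD[OF f] alg_homD[OF g] eq)
qed

section \<open>Existence half of the universal property of the envelope\<close>

context
  fixes S :: "('k, 's, 'x) module_scheme" and \<beta>
  assumes S: "algebra K S" and \<beta>: "\<beta> \<in> polar_map K p A S"
begin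

interpretation S: algebra K S by (rule S)

lemma polar_linear: "\<beta> \<in> linear_map K A S"
  using \<beta> by (simp add: polar_map_def)

lemma eval_closed: "pexpr_over K A d \<Longrightarrow> pexpr_eval S \<beta> d \<in> carrier S"
  by (induction d) (auto simp: linear_mapD[OF polar_linear])

lemma eval_rel: "env_rel K p A d e \<Longrightarrow> pexpr_eval S \<beta> d = pexpr_eval S \<beta> e"
proof (induction rule: env_rel.induct)
  case (gen_mu xs)
  have "pexpr_eval S \<beta> (foldr PMul (map PGen xs) (PCon \<one>\<^bsub>K\<^esub>)) = lprod S (map \<beta> xs)"
    by (induction xs) auto
  with gen_mu \<beta> show ?case by (simp add: polar_map_def)
next
  case (add_comm d e)
  then show ?case by (simp add: eval_closed S.a_comm)
next
  case (mul_comm d e)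
  then show ?case by (simp add: eval_closed S.m_comm)
qed (use linear_mapD[OF polar_linear] in
    \<open>simp_all add: eval_closed S.a_assoc S.m_assoc S.l_distr S.smult_l_distr
      S.smult_assoc1 S.smult_assoc2\<close>)

lemma env_lift_cl: "pexpr_over K A d \<Longrightarrow> env_lift K p A S \<beta> (cl d) = pexpr_eval S \<beta> d"
  using eval_rel[OF rep_cl] by (simp add: env_lift_def)

lemma env_lift_hom: "env_lift K p A S \<beta> \<in> alg_hom K E S"
proof (rule alg_homI)
  show "env_lift K p A S \<beta> \<one>\<^bsub>E\<^esub> = \<one>\<^bsub>S\<^esub>" by (simp add: E_one env_lift_cl)
  show "env_lift K p A S \<beta> \<in> extensional (carrier E)" by (simp add: env_lift_def)
qed (auto elim!: E_cases simp: env_lift_cl eval_closed cl_add cl_mul cl_smult S.smult_assoc2)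

lemma env_lift_gen: "x \<in> carrier A \<Longrightarrow> env_lift K p A S \<beta> (gen x) = \<beta> x"
  by (simp add: env_gen_def env_lift_cl)

end

section \<open>Normal form: a constant plus a sum of words of positive length\<close>

definition mon :: "'a list \<Rightarrow> ('k, 'a) pexpr set" where
  "mon xs = lprod E (map gen xs)"

text \<open>Empty words are excluded for two reasons: a nonempty word has a first letter that can
  absorb a scalar, and it is annihilated by scaling with 0.\<close>

definition mon_lists :: "'a list list set" where
  "mon_lists = {tss. \<forall>ts\<in>set tss. ts \<noteq> [] \<and> set ts \<subseteq> carrier A}"

lemma mon_closed [simp]: "set xs \<subseteq> carrier A \<Longrightarrow> mon xs \<in> carrier E"
  unfolding mon_def by (intro E.lprod_closed) auto

lemma mon_append: "\<lbrakk>set xs \<subseteq> carrier A; set ys \<subseteq> carrier A\<rbrakk> \<Longrightarrow> mon (xs @ ys) = mon xs \<otimes>\<^bsub>E\<^esub> mon ys"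
  unfolding mon_def map_append by (intro E.lprod_append) auto

lemma mon_lists_simps [simp]: "[] \<in> mon_lists"
  "ts # tss \<in> mon_lists \<longleftrightarrow> ts \<noteq> [] \<and> set ts \<subseteq> carrier A \<and> tss \<in> mon_lists"
  "tss @ uss \<in> mon_lists \<longleftrightarrow> tss \<in> mon_lists \<and> uss \<in> mon_lists"
  by (auto simp: mon_lists_def)

definition mon_sum :: "'a list list \<Rightarrow> ('k, 'a) pexpr set" where
  "mon_sum tss = lsum E (map mon tss)"

lemma mon_sum_simps [simp]: "mon_sum [] = \<zero>\<^bsub>E\<^esub>" "mon_sum (ts # tss) = mon ts \<oplus>\<^bsub>E\<^esub> mon_sum tss"
  by (simp_all add: mon_sum_def)

lemma mon_sum_closed [simp]: "tss \<in> mon_lists \<Longrightarrow> mon_sum tss \<in> carrier E"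
  by (induction tss) auto

lemma mon_sum_append: "\<lbrakk>tss \<in> mon_lists; uss \<in> mon_lists\<rbrakk> \<Longrightarrow> mon_sum (tss @ uss) = mon_sum tss \<oplus>\<^bsub>E\<^esub> mon_sum uss"
  by (induction tss) (auto simp: E.a_assoc)

text \<open>The scalar is absorbed into the first letter of each word, so sums of words carry no
  coefficients.\<close>

lemma mon_sum_smult:
  assumes "tss \<in> mon_lists" "a \<in> carrier K"
  shows "\<exists>uss\<in>mon_lists. mon_sum uss = a \<odot>\<^bsub>E\<^esub> mon_sum tss"
  using assms(1)
proof (induction tss)
  case (Cons ts tss)
  then obtain uss where uss: "uss \<in> mon_lists" "mon_sum uss = a \<odot>\<^bsub>E\<^esub> mon_sum tss" by auto
  obtain t ts' where t: "ts = t # ts'" using Cons.prems by (cases ts) auto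
  have c: "t \<in> carrier A" "set ts' \<subseteq> carrier A" using Cons.prems by (auto simp: t)
  have "mon ((a \<odot>\<^bsub>A\<^esub> t) # ts') = a \<odot>\<^bsub>E\<^esub> mon ts"
    using c assms(2) linear_mapD(3)[OF polar_linear[OF algebra_E gen_polar]]
      mon_closed[OF c(2)] by (simp add: mon_def t E.smult_assoc2)
  then show ?case
    using uss c Cons.prems assms(2)
    by (intro bexI[of _ "((a \<odot>\<^bsub>A\<^esub> t) # ts') # uss"]) (simp_all add: E.smult_r_distr)
qed (auto intro!: bexI[of _ "[]"] simp: assms)

lemma mon_sum_mono:
  assumes "tss \<in> mon_lists" "set us \<subseteq> carrier A" "us \<noteq> []"
  shows "\<exists>uss\<in>mon_lists. mon_sum uss = mon us \<otimes>\<^bsub>E\<^esub> mon_sum tss"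
  using assms(1)
proof (induction tss)
  case (Cons ts tss)
  then obtain uss where "uss \<in> mon_lists" "mon_sum uss = mon us \<otimes>\<^bsub>E\<^esub> mon_sum tss" by auto
  then show ?case
    using Cons.prems assms(2,3)
    by (intro bexI[of _ "(us @ ts) # uss"]) (simp_all add: mon_append E.r_distr)
qed (use assms in \<open>auto intro!: bexI[of _ "[]"]\<close>)

lemma mon_sum_mult:
  assumes "tss \<in> mon_lists" "uss \<in> mon_lists"
  shows "\<exists>vss\<in>mon_lists. mon_sum vss = mon_sum tss \<otimes>\<^bsub>E\<^esub> mon_sum uss"
  using assms(1)
proof (induction tss)
  case (Cons ts tss)
  then obtain vss where v: "vss \<in> mon_lists" "mon_sum vss = mon_sum tss \<otimes>\<^bsub>E\<^esub> mon_sum uss" by auto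
  obtain wss where "wss \<in> mon_lists" "mon_sum wss = mon ts \<otimes>\<^bsub>E\<^esub> mon_sum uss"
    using mon_sum_mono[OF assms(2), of ts] Cons.prems by auto
  with v show ?case
    using Cons.prems assms(2)
    by (intro bexI[of _ "wss @ vss"]) (simp_all add: mon_sum_append E.l_distr)
qed (use assms in \<open>auto intro!: bexI[of _ "[]"]\<close>)

text \<open>The elements of this form contain the constants and generators and are closed under sums
  and products; in a product the two mixed terms are scaled sums of words. The words are not unique,
  but \<open>\<sigma>_0\<close> will recover the constant part.\<close>

lemma normal_form:
  assumes "X \<in> carrier E"
  obtains a tss where "a \<in> carrier K" "tss \<in> mon_lists" "X = a \<odot>\<^bsub>E\<^esub> \<one>\<^bsub>E\<^esub> \<oplus>\<^bsub>E\<^esub> mon_sum tss"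
proof -
  have "\<exists>a\<in>carrier K. \<exists>tss\<in>mon_lists. X = a \<odot>\<^bsub>E\<^esub> \<one>\<^bsub>E\<^esub> \<oplus>\<^bsub>E\<^esub> mon_sum tss"
    using assms
  proof (induction rule: E_induct)
    case (con a)
    then show ?case by (intro bexI[of _ a] bexI[of _ "[]"]) simp_all
  next
    case (gen x)
    then show ?case by (intro bexI[of _ "\<zero>\<^bsub>K\<^esub>"] bexI[of _ "[[x]]"]) (simp_all add: mon_def)
  next
    case (add X Y)
    then obtain a tss b uss where *: "a \<in> carrier K" "tss \<in> mon_lists" "X = a \<odot>\<^bsub>E\<^esub> \<one>\<^bsub>E\<^esub> \<oplus>\<^bsub>E\<^esub> mon_sum tss"
      "b \<in> carrier K" "uss \<in> mon_lists" "Y = b \<odot>\<^bsub>E\<^esub> \<one>\<^bsub>E\<^esub> \<oplus>\<^bsub>E\<^esub> mon_sum uss" by blast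
    then show ?case
      by (intro bexI[of _ "a \<oplus>\<^bsub>K\<^esub> b"] bexI[of _ "tss @ uss"])
        (simp_all add: mon_sum_append E.smult_l_distr E.a_ac)
  next
    case (mul X Y)
    then obtain a tss b uss where *: "a \<in> carrier K" "tss \<in> mon_lists" "X = a \<odot>\<^bsub>E\<^esub> \<one>\<^bsub>E\<^esub> \<oplus>\<^bsub>E\<^esub> mon_sum tss"
      "b \<in> carrier K" "uss \<in> mon_lists" "Y = b \<odot>\<^bsub>E\<^esub> \<one>\<^bsub>E\<^esub> \<oplus>\<^bsub>E\<^esub> mon_sum uss" by blast
    obtain u v w where uvw: "u \<in> mon_lists" "mon_sum u = a \<odot>\<^bsub>E\<^esub> mon_sum uss"
      "v \<in> mon_lists" "mon_sum v = b \<odot>\<^bsub>E\<^esub> mon_sum tss"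
      "w \<in> mon_lists" "mon_sum w = mon_sum tss \<otimes>\<^bsub>E\<^esub> mon_sum uss"
      using mon_sum_smult[OF *(5,1)] mon_sum_smult[OF *(2,4)] mon_sum_mult[OF *(2,5)] by auto
    have sw: "mon_sum tss \<otimes>\<^bsub>E\<^esub> (b \<odot>\<^bsub>E\<^esub> \<one>\<^bsub>E\<^esub>) = b \<odot>\<^bsub>E\<^esub> mon_sum tss"
      using * by (simp add: E.m_comm[of "mon_sum tss"] E.smult_assoc2)
    show ?case
      using * uvw sw
      by (intro bexI[of _ "a \<otimes>\<^bsub>K\<^esub> b"] bexI[of _ "u @ v @ w"])
        (simp_all add: mon_sum_append E.l_distr E.r_distr E.smult_assoc1 E.smult_assoc2 E.smult_r_distr E.a_ac)
  qed
  then show thesis using that by blast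
qed

end

section \<open>Orthogonality relations modulo p\<close>

text \<open>Telescoping (x+1)^(k+1) - x^(k+1) expresses p^(k+1) through the power sums with
  exponents up to k. By induction only (k+1) S k is left modulo p, and k + 1 < p is invertible. The
  term x = 0 counts as 1 for k = 0.\<close>

lemma power_sum_cong_0:
  assumes "prime p" "k < p - 1"
  shows "[(\<Sum>x<p. int x ^ k) = 0] (mod int p)"
  using assms(2)
proof (induction k rule: less_induct)
  case (less k)
  define S where "S i = (\<Sum>x<p. int x ^ i)" for i
  have "int p ^ Suc k = (\<Sum>x<p. int (Suc x) ^ Suc k - int x ^ Suc k)"
    using sum_lessThan_telescope[of "\<lambda>x. int x ^ Suc k" p] by simp
  also have "\<dots> = (\<Sum>x<p. \<Sum>i\<le>k. int (Suc k choose i) * int x ^ i)"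
  proof (rule sum.cong[OF HOL.refl])
    fix x
    have "int (Suc x) ^ Suc k = (int x + 1) ^ Suc k" by (simp add: add.commute)
    also have "\<dots> = (\<Sum>i\<le>Suc k. int (Suc k choose i) * int x ^ i)"
      by (subst binomial_ring) simp
    finally show "int (Suc x) ^ Suc k - int x ^ Suc k = (\<Sum>i\<le>k. int (Suc k choose i) * int x ^ i)"
      by simp
  qed
  also have "\<dots> = (\<Sum>i\<le>k. int (Suc k choose i) * S i)"
    by (subst sum.swap) (simp add: S_def sum_distrib_left)
  also have "\<dots> = (\<Sum>i<k. int (Suc k choose i) * S i) + int (Suc k) * S k"
  proof -
    have "{..k} = insert k {..<k}" by auto
    then show ?thesis by simp
  qed
  finally have eq: "int (Suc k) * S k = int p ^ Suc k - (\<Sum>i<k. int (Suc k choose i) * S i)" by simp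
  have "int p dvd (\<Sum>i<k. int (Suc k choose i) * S i)"
    using less by (intro dvd_sum dvd_mult) (auto simp: S_def cong_0_iff)
  then have "int p dvd int (Suc k) * S k" unfolding eq by (intro dvd_diff) simp_all
  moreover have "\<not> int p dvd int (Suc k)"
  proof -
    have "\<not> p dvd Suc k" using less.prems dvd_imp_le[of p "Suc k"] by auto
    then show ?thesis by (metis int_dvd_int_iff)
  qed
  ultimately have "int p dvd S k"
    using assms(1) by (simp add: prime_dvd_mult_iff)
  then show ?case by (simp add: S_def cong_0_iff)
qed

lemma cong_minus_one_square:
  fixes p :: nat
  assumes "prime p"
  shows "[(p - 1) * (p - 1) = 1] (mod p)"
proof -
  obtain q where "p = Suc (Suc q)" using prime_ge_2_nat[OF assms] by (metis add_2_eq_Suc le_Suc_ex)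
  then have "(p - 1) * (p - 1) = 1 + p * q" by (simp add: algebra_simps)
  then show ?thesis unfolding cong_def by (simp only: mod_mult_self2)
qed

text \<open>Orthogonality by summing over the units of the prime field. The factor p - 1 normalizes:
  it is the inverse modulo p of the number p - 1 of units. Fermat reduces the exponent modulo p - 1,
  after which a nonzero exponent is small enough for \<open>power_sum_cong_0\<close>.\<close>

lemma power_sum_cong:
  assumes p: "prime p"
  shows "[(\<Sum>x\<in>{1..<p}. (p - 1) * x ^ m) = (if (p - 1) dvd m then 1 else 0)] (mod p)"
proof -
  define r where "r = m mod (p - 1)"
  have "[x ^ m = x ^ r] (mod p)" if "x \<in> {1..<p}" for x
  proof -
    have "\<not> p dvd x" using that by (auto dest: dvd_imp_le)
    then have "[(x ^ (p - 1)) ^ (m div (p - 1)) * x ^ r = 1 ^ (m div (p - 1)) * x ^ r] (mod p)"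
      by (intro cong_mult cong_pow fermat_theorem p) auto
    then show ?thesis by (simp add: r_def power_mult[symmetric] power_add[symmetric])
  qed
  then have *: "[(\<Sum>x\<in>{1..<p}. (p - 1) * x ^ m) = (\<Sum>x\<in>{1..<p}. (p - 1) * x ^ r)] (mod p)"
    by (intro cong_sum cong_mult) auto
  show ?thesis
  proof (cases "r = 0")
    case True
    then have "(p - 1) dvd m" by (auto simp: r_def)
    with True * cong_minus_one_square[OF p] show ?thesis by (auto intro: cong_trans)
  next
    case False
    then have "\<not> (p - 1) dvd m" by (auto simp: r_def dvd_eq_mod_eq_0)
    have p1: "p - 1 > 0" using prime_ge_2_nat[OF p] by simp
    have "[(\<Sum>x<p. int x ^ r) = 0] (mod int p)"
      using p1 by (intro power_sum_cong_0 p) (simp add: r_def)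
    moreover have "(\<Sum>x<p. int x ^ r) = int (\<Sum>x\<in>{1..<p}. x ^ r)"
    proof -
      have "{..<p} = insert 0 {1..<p}" using p1 by auto
      then show ?thesis using False by simp
    qed
    ultimately have "p dvd (\<Sum>x\<in>{1..<p}. x ^ r)" by (simp only: cong_0_iff int_dvd_int_iff)
    then have "[(\<Sum>x\<in>{1..<p}. (p - 1) * x ^ r) = 0] (mod p)"
      by (simp add: cong_0_iff sum_distrib_left[symmetric])
    with * \<open>\<not> (p - 1) dvd m\<close> show ?thesis by (auto intro: cong_trans)
  qed
qed

lemma cong_nat_imp_dvd: "[a = b] (mod m) \<Longrightarrow> int m dvd int a - int b"
  by (simp only: cong_iff_dvd_diff[symmetric] cong_int_iff)

text \<open>The dual orthogonality, summing over exponents; z^(p-1-j) stands for z^(-j). For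
  distinct x and z, divide x^p - z^p by x - z: Fermat makes the quotient z^(p-1) + S congruent to 1,
  and z^(p-1) is congruent to 1 as well.\<close>

lemma geometric_cong:
  assumes p: "prime p" and xz: "x \<in> {1..<p}" "z \<in> {1..<p}"
  shows "[(\<Sum>j\<in>{1..<p}. (p - 1) * z ^ (p - 1 - j) * x ^ j) = (if x = z then 1 else 0)] (mod p)"
proof -
  have z: "[z ^ (p - 1) = 1] (mod p)"
    using xz by (intro fermat_theorem p) (auto dest: dvd_imp_le)
  show ?thesis
  proof (cases "x = z")
    case True
    have "(\<Sum>j\<in>{1..<p}. (p - 1) * z ^ (p - 1 - j) * x ^ j) = (\<Sum>j\<in>{1..<p}. (p - 1) * z ^ (p - 1))"
      by (intro sum.cong) (auto simp: True mult.assoc simp flip: power_add)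
    also have "\<dots> = (p - 1) * (p - 1) * z ^ (p - 1)" by simp
    also have "[\<dots> = 1 * 1] (mod p)"
      by (intro cong_mult cong_minus_one_square p z)
    finally show ?thesis using True by simp
  next
    case False
    define S where "S = (\<Sum>j\<in>{1..<p}. z ^ (p - 1 - j) * x ^ j)"
    have p0: "p > 0" using prime_gt_0_nat[OF p] .
    have "int p dvd (int x ^ p - int x) - (int z ^ p - int z)"
      using dvd_diff[OF cong_nat_imp_dvd[OF fermat_cong[OF p, of x]] cong_nat_imp_dvd[OF fermat_cong[OF p, of z]]]
      by simp
    also have "(int x ^ p - int x) - (int z ^ p - int z) = (int x ^ p - int z ^ p) - (int x - int z)" by simp
    also have "int x ^ p - int z ^ p = (int x - int z) * (\<Sum>j<p. int z ^ (p - Suc j) * int x ^ j)"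
      by (rule power_diff_sumr2)
    also have "(\<Sum>j<p. int z ^ (p - Suc j) * int x ^ j) = int (z ^ (p - 1)) + int S"
    proof -
      have "{..<p} = insert 0 {1..<p}" using p0 by auto
      then show ?thesis by (simp add: S_def)
    qed
    finally have "int p dvd (int x - int z) * (int (z ^ (p - 1)) + int S - 1)"
      by (simp add: algebra_simps)
    moreover have "\<not> int p dvd int x - int z"
      using xz False by (auto simp flip: cong_iff_dvd_diff simp: cong_int_iff cong_def)
    ultimately have "int p dvd int (z ^ (p - 1)) + int S - 1"
      using p by (simp add: prime_dvd_mult_iff)
    moreover have "int p dvd int (z ^ (p - 1)) - 1"
      using cong_nat_imp_dvd[OF z] by simp
    ultimately have "int p dvd int (z ^ (p - 1)) + int S - 1 - (int (z ^ (p - 1)) - 1)" by (rule dvd_diff)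
    then have "p dvd S" by (simp add: int_dvd_int_iff)
    then show ?thesis
      using False by (simp add: cong_0_iff S_def sum_distrib_left[symmetric] mult.assoc)
  qed
qed


section \<open>Points on which scaling acts by Teichmueller multiplication\<close>

text \<open>The multiplicative lift of \<open>z\<close> to the \<open>p\<close>-adic integers is the limit of \<open>z ^ p ^ n\<close>; the
  condition says that \<open>\<sigma> z\<close> acts on \<open>f\<close> as multiplication by this limit.\<close>

definition teich_points ::
    "('k, 'r) ring_scheme \<Rightarrow> nat \<Rightarrow> ('k, 'h) hopf \<Rightarrow> ('k, 'a, 'x) module_scheme \<Rightarrow> (nat \<Rightarrow> 'a \<Rightarrow> 'a)
     \<Rightarrow> ('h \<Rightarrow> 'a) monoid" where
  "teich_points K p H R \<sigma> = (points K H R)\<lparr>carrier :=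
     {f \<in> alg_hom K H R. \<forall>z. \<forall>h\<in>carrier H.
        \<forall>\<^sub>F n in sequentially. \<sigma> z (f h) = (f [^]\<^bsub>points K H R\<^esub> (z ^ p ^ n)) h}\<rparr>"

lemma teich_points_simps [simp]:
  "f \<in> carrier (teich_points K p H R \<sigma>) \<longleftrightarrow> f \<in> alg_hom K H R \<and> (\<forall>z. \<forall>h\<in>carrier H.
        \<forall>\<^sub>F n in sequentially. \<sigma> z (f h) = (f [^]\<^bsub>points K H R\<^esub> (z ^ p ^ n)) h)"
  "mult (teich_points K p H R \<sigma>) = mult (points K H R)"
  "one (teich_points K p H R \<sigma>) = one (points K H R)"
  by (simp_all add: teich_points_def)

text \<open>Membership says that the powers of f with exponents z^(p^n) converge to the composite of
  \<open>\<sigma> z\<close> with f, and such limits respect products. Inverses are treated at one h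
  at a time, where they agree with a natural power of f.\<close>

lemma (in padic_points) teich_subgroup:
  assumes \<sigma>: "\<And>z. \<sigma> z \<in> alg_hom K R R"
  shows "subgroup (carrier (teich_points K p H R \<sigma>)) G"
proof -
  let ?C = "carrier (teich_points K p H R \<sigma>)"
  note hom = points_map_hom[OF H.bicommutative_hopf_algebra_axioms R.algebra_axioms R.algebra_axioms \<sigma>]
  have iff: "f \<in> ?C \<longleftrightarrow> f \<in> carrier G \<and> (\<forall>z. tends (\<lambda>n. f [^]\<^bsub>G\<^esub> (z ^ p ^ n)) (points_map H (\<sigma> z) f))" for f
    by (auto simp: tends_def eq_commute)
  have mult: "f \<otimes>\<^bsub>G\<^esub> g \<in> ?C" if f: "f \<in> ?C" and g: "g \<in> ?C" for f g
    unfolding iff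
  proof (intro conjI allI)
    have c: "f \<in> carrier G" "g \<in> carrier G" using f g by (simp_all only: iff)
    show "f \<otimes>\<^bsub>G\<^esub> g \<in> carrier G" using c by (rule G.m_closed)
    fix z
    have "points_map H (\<sigma> z) (f \<otimes>\<^bsub>G\<^esub> g) = points_map H (\<sigma> z) f \<otimes>\<^bsub>G\<^esub> points_map H (\<sigma> z) g"
      by (rule hom_mult[OF hom c])
    moreover have "(f \<otimes>\<^bsub>G\<^esub> g) [^]\<^bsub>G\<^esub> n = f [^]\<^bsub>G\<^esub> n \<otimes>\<^bsub>G\<^esub> g [^]\<^bsub>G\<^esub> n" for n :: nat
      by (rule G.nat_pow_distrib[OF c])
    moreover have "tends (\<lambda>n. f [^]\<^bsub>G\<^esub> (z ^ p ^ n) \<otimes>\<^bsub>G\<^esub> g [^]\<^bsub>G\<^esub> (z ^ p ^ n))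
      (points_map H (\<sigma> z) f \<otimes>\<^bsub>G\<^esub> points_map H (\<sigma> z) g)"
      using f g c hom_in_carrier[OF hom c(1)] hom_in_carrier[OF hom c(2)] unfolding iff
      by (intro tends_mult pow_closed) (simp_all only: G_simps(1))
    ultimately show "tends (\<lambda>n. (f \<otimes>\<^bsub>G\<^esub> g) [^]\<^bsub>G\<^esub> (z ^ p ^ n)) (points_map H (\<sigma> z) (f \<otimes>\<^bsub>G\<^esub> g))"
      by (simp only:)
  qed
  have one: "\<one>\<^bsub>G\<^esub> \<in> ?C"
    unfolding iff
    using points_map_one[OF H.bicommutative_hopf_algebra_axioms R.algebra_axioms R.algebra_axioms \<sigma>]
    by (simp add: tends_const G.one_closed del: G_simps)
  have pow: "f [^]\<^bsub>G\<^esub> n \<in> ?C" if "f \<in> ?C" for f and n :: nat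
  proof (induction n)
    case 0
    then show ?case using one by (simp only: nat_pow_0)
  next
    case (Suc n)
    then show ?case using mult[OF Suc that] by (simp only: nat_pow_Suc)
  qed
  show ?thesis
  proof (rule G.subgroupI)
    show "?C \<subseteq> carrier G" by auto
    show "?C \<noteq> {}" using one by blast
    fix f assume f: "f \<in> ?C"
    then have fc: "f \<in> alg_hom K H R" by simp
    have ic: "inv\<^bsub>G\<^esub> f \<in> alg_hom K H R" using G.inv_closed[of f] fc by simp
    show "inv\<^bsub>G\<^esub> f \<in> ?C"
      unfolding teich_points_simps
    proof (intro conjI allI ballI ic)
      fix z h assume "h \<in> carrier H"
      then obtain n where n: "h \<in> level n" using level(2) by blast
      \<comment> \<open>A member of the set by closure under products. It depends on h through the
        level n and has the same powers at h as the inverse of f.\<close>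
      let ?g = "f [^]\<^bsub>G\<^esub> (p ^ n - 1)"
      have "(inv\<^bsub>G\<^esub> f) h = ?g h"
        using level_inv_pow[OF fc n, of 1] ic by (simp del: G_simps(2))
      moreover have "\<forall>\<^sub>F m in sequentially. \<sigma> z (?g h) = (?g [^]\<^bsub>G\<^esub> (z ^ p ^ m)) h"
        using pow[OF f, of "p ^ n - 1"] \<open>h \<in> carrier H\<close> unfolding teich_points_simps by blast
      moreover have "(?g [^]\<^bsub>G\<^esub> a) h = ((inv\<^bsub>G\<^esub> f) [^]\<^bsub>G\<^esub> a) h" for a :: nat
        using fc level_inv_pow[OF fc n, of a] G.nat_pow_pow[of f "p ^ n - 1" a]
        by (simp add: mult.commute del: G_simps(2))
      ultimately show "\<forall>\<^sub>F m in sequentially. \<sigma> z ((inv\<^bsub>G\<^esub> f) h) = ((inv\<^bsub>G\<^esub> f) [^]\<^bsub>G\<^esub> (z ^ p ^ m)) h"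
        by simp
    qed
  qed (rule mult)
qed

lemma (in padic_points) teich_comm_group:
  assumes "\<And>z. \<sigma> z \<in> alg_hom K R R"
  shows "comm_group (teich_points K p H R \<sigma>)"
proof -
  have "teich_points K p H R \<sigma> = G\<lparr>carrier := carrier (teich_points K p H R \<sigma>)\<rparr>"
    by (simp add: teich_points_def)
  then have grp: "group (teich_points K p H R \<sigma>)"
    using G.subgroup_imp_group[OF teich_subgroup[of \<sigma>, OF assms]] by metis
  show ?thesis
    by (rule group.group_comm_groupI[OF grp]) (use G.m_comm in \<open>simp del: G_simps(2)\<close>)
qed

lemma teich_points_map_hom:
  assumes H: "bicommutative_hopf_algebra K H" and R: "algebra K R" and S: "algebra K S"
    and u: "u \<in> alg_hom K R S"
    and \<sigma>: "\<And>z r. r \<in> carrier R \<Longrightarrow> u (\<sigma> z r) = \<tau> z (u r)"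
  shows "points_map H u \<in> hom (teich_points K p H R \<sigma>) (teich_points K p H S \<tau>)"
proof (rule homI)
  note hom = points_map_hom[OF H R S u]
  have C: "carrier (points K H R) = alg_hom K H R" "carrier (points K H S) = alg_hom K H S"
    by (simp_all add: points_def)
  show "points_map H u f \<in> carrier (teich_points K p H S \<tau>)" if f: "f \<in> carrier (teich_points K p H R \<sigma>)" for f
    unfolding teich_points_simps
  proof (intro conjI allI ballI)
    have fc: "f \<in> alg_hom K H R" using f by simp
    show "points_map H u f \<in> alg_hom K H S"
      using hom_in_carrier[OF hom] fc by (simp add: C)
    fix z h assume h: "h \<in> carrier H"
    have "\<forall>\<^sub>F n in sequentially. \<sigma> z (f h) = (f [^]\<^bsub>points K H R\<^esub> (z ^ p ^ n)) h"
      using f h by simp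
    then show "\<forall>\<^sub>F n in sequentially. \<tau> z (points_map H u f h) = (points_map H u f [^]\<^bsub>points K H S\<^esub> (z ^ p ^ n)) h"
    proof eventually_elim
      case (elim n)
      have "\<tau> z (u (f h)) = u (\<sigma> z (f h))" using \<sigma> alg_homD(4)[OF fc h] by simp
      also have "\<dots> = points_map H u (f [^]\<^bsub>points K H R\<^esub> (z ^ p ^ n)) h" using elim h by simp
      finally show ?case using h by (simp add: points_map_pow[OF H R S u fc])
    qed
  qed
  show "points_map H u (f \<otimes>\<^bsub>teich_points K p H R \<sigma>\<^esub> g) = points_map H u f \<otimes>\<^bsub>teich_points K p H S \<tau>\<^esub> points_map H u g"
    if "f \<in> carrier (teich_points K p H R \<sigma>)" "g \<in> carrier (teich_points K p H R \<sigma>)" for f g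
    using that hom_mult[OF hom, of f g] by (simp add: C)
qed

lemma teich_pullback_hom:
  assumes H: "bicommutative_hopf_algebra K H" and H': "bicommutative_hopf_algebra K H'"
    and R: "algebra K R" and \<phi>: "\<phi> \<in> hopf_hom K H' H"
  shows "(\<lambda>f. compose (carrier H') f \<phi>) \<in> hom (teich_points K p H R \<sigma>) (teich_points K p H' R \<sigma>)"
proof (rule homI)
  note hom = pullback_hom[OF H H' R \<phi>]
  have C: "carrier (points K H R) = alg_hom K H R" "carrier (points K H' R) = alg_hom K H' R"
    by (simp_all add: points_def)
  have \<phi>1: "\<phi> \<in> alg_hom K H' H" using \<phi> by (simp add: hopf_hom_def)
  show "compose (carrier H') f \<phi> \<in> carrier (teich_points K p H' R \<sigma>)" if f: "f \<in> carrier (teich_points K p H R \<sigma>)" for f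
    unfolding teich_points_simps
  proof (intro conjI allI ballI)
    have fc: "f \<in> alg_hom K H R" using f by simp
    show "compose (carrier H') f \<phi> \<in> alg_hom K H' R"
      using hom_in_carrier[OF hom] fc by (simp add: C)
    fix z h assume h: "h \<in> carrier H'"
    have "\<forall>\<^sub>F n in sequentially. \<sigma> z (f (\<phi> h)) = (f [^]\<^bsub>points K H R\<^esub> (z ^ p ^ n)) (\<phi> h)"
      using f alg_homD(4)[OF \<phi>1 h] by simp
    then show "\<forall>\<^sub>F n in sequentially. \<sigma> z (compose (carrier H') f \<phi> h) = (compose (carrier H') f \<phi> [^]\<^bsub>points K H' R\<^esub> (z ^ p ^ n)) h"
    proof eventually_elim
      case (elim n)
      then have "\<sigma> z (f (\<phi> h)) = compose (carrier H') (f [^]\<^bsub>points K H R\<^esub> (z ^ p ^ n)) \<phi> h"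
        using h by (simp add: compose_eq)
      then show ?case using h by (simp add: pullback_pow[OF H H' R \<phi> fc] compose_eq)
    qed
  qed
  show "compose (carrier H') (f \<otimes>\<^bsub>teich_points K p H R \<sigma>\<^esub> g) \<phi> =
      compose (carrier H') f \<phi> \<otimes>\<^bsub>teich_points K p H' R \<sigma>\<^esub> compose (carrier H') g \<phi>"
    if "f \<in> carrier (teich_points K p H R \<sigma>)" "g \<in> carrier (teich_points K p H R \<sigma>)" for f g
    using that hom_mult[OF hom, of f g] by (simp add: C)
qed

section \<open>Scaling by natural numbers in characteristic p\<close>

lemma (in abelian_monoid) lsum_swap:
  assumes "\<And>i j. \<lbrakk>i \<in> set is; j \<in> set js\<rbrakk> \<Longrightarrow> f i j \<in> carrier G"
  shows "lsum G (map (\<lambda>i. lsum G (map (\<lambda>j. f i j) js)) is) = lsum G (map (\<lambda>j. lsum G (map (\<lambda>i. f i j) is)) js)"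
  using assms
proof (induction "is")
  case Nil
  have "lsum G (map (\<lambda>j. \<zero>) js) = \<zero>" by (induction js) auto
  then show ?case by simp
next
  case (Cons i "is")
  have "lsum G (map (\<lambda>j. f i j \<oplus> lsum G (map (\<lambda>i. f i j) is)) js) =
    lsum G (map (\<lambda>j. f i j) js) \<oplus> lsum G (map (\<lambda>j. lsum G (map (\<lambda>i. f i j) is)) js)"
    using Cons.prems by (intro lsum_add lsum_closed) auto
  with Cons show ?case by simp
qed

lemma (in abelian_monoid) lsum_single:
  assumes "distinct js" "j0 \<in> set js" "\<And>j. \<lbrakk>j \<in> set js; j \<noteq> j0\<rbrakk> \<Longrightarrow> f j = \<zero>" "f j0 \<in> carrier G"
  shows "lsum G (map f js) = f j0"
proof -
  have 0: "lsum G (map f js) = \<zero>" if "\<And>j. j \<in> set js \<Longrightarrow> f j = \<zero>" for js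
    using that by (induction js) auto
  show ?thesis
    using assms(1-3)
  proof (induction js)
    case (Cons j js)
    show ?case
    proof (cases "j = j0")
      case True
      then have "lsum G (map f js) = \<zero>" using Cons.prems by (intro 0) auto
      then show ?thesis using True assms(4) by simp
    next
      case False
      then show ?thesis using Cons assms(4) by auto
    qed
  qed simp
qed

definition nat_in :: "('k, 'r) ring_scheme \<Rightarrow> nat \<Rightarrow> 'k" where
  "nat_in K n = [n] \<cdot>\<^bsub>K\<^esub> \<one>\<^bsub>K\<^esub>"

locale char_p = K: cring K for K :: "('k, 'r) ring_scheme" and p :: nat +
  assumes prime: "prime p" and char: "nat_in K p = \<zero>\<^bsub>K\<^esub>"
begin

abbreviation nk where "nk \<equiv> nat_in K"

lemma nk_simps [simp]: "nk n \<in> carrier K" "nk 0 = \<zero>\<^bsub>K\<^esub>" "nk (Suc 0) = \<one>\<^bsub>K\<^esub>"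
  by (simp_all add: nat_in_def)

lemma nk_add: "nk (m + n) = nk m \<oplus>\<^bsub>K\<^esub> nk n"
  by (simp add: nat_in_def K.add.nat_pow_mult)

lemma nk_mult: "nk (m * n) = nk m \<otimes>\<^bsub>K\<^esub> nk n"
  by (simp add: nat_in_def K.add_pow_ldistr K.add.nat_pow_pow mult.commute)

lemma nk_pow: "nk (m ^ n) = nk m [^]\<^bsub>K\<^esub> n"
  using nk_simps(3) by (induction n) (simp_all add: nk_mult K.m_comm)

lemma nk_cong:
  assumes "[m = n] (mod p)"
  shows "nk m = nk n"
proof -
  have mult: "nk (c * p) = \<zero>\<^bsub>K\<^esub>" for c by (simp add: nk_mult char)
  obtain c d where "m + c * p = n + d * p"
    using assms unfolding cong_iff_lin_nat by metis
  then have "nk (m + c * p) = nk (n + d * p)" by simp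
  then show ?thesis by (simp add: nk_add mult)
qed

lemma nk_pow_p: "nk z [^]\<^bsub>K\<^esub> p = nk z"
  by (simp add: nk_pow[symmetric] nk_cong[OF fermat_cong[OF prime]])

lemma lsum_nk:
  assumes "Module.module K M" "x \<in> carrier M"
  shows "lsum M (map (\<lambda>i. nk (c i) \<odot>\<^bsub>M\<^esub> x) is) = nk (sum_list (map c is)) \<odot>\<^bsub>M\<^esub> x"
proof -
  interpret M: Module.module K M by fact
  show ?thesis
    using assms(2) by (induction "is") (simp_all add: nk_add M.smult_l_distr)
qed

end

lemma (in algebra) smult_assoc2_right:
  "\<lbrakk>a \<in> carrier R; x \<in> carrier M; y \<in> carrier M\<rbrakk> \<Longrightarrow> x \<otimes>\<^bsub>M\<^esub> (a \<odot>\<^bsub>M\<^esub> y) = a \<odot>\<^bsub>M\<^esub> (x \<otimes>\<^bsub>M\<^esub> y)"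
  using cring.cring_simprules(14)[OF M_cring, of x] by (metis smult_assoc2 smult_closed)

lemma lprod_smult:
  assumes "algebra K S" "c \<in> carrier K" "set xs \<subseteq> carrier S"
  shows "lprod S (map (\<lambda>x. c \<odot>\<^bsub>S\<^esub> x) xs) = (c [^]\<^bsub>K\<^esub> length xs) \<odot>\<^bsub>S\<^esub> lprod S xs"
proof -
  interpret S: algebra K S by fact
  show ?thesis
    using assms(3)
  proof (induction xs)
    case (Cons x xs)
    then have c: "x \<in> carrier S" "lprod S xs \<in> carrier S" by auto
    have "(c \<odot>\<^bsub>S\<^esub> x) \<otimes>\<^bsub>S\<^esub> ((c [^]\<^bsub>K\<^esub> length xs) \<odot>\<^bsub>S\<^esub> lprod S xs) =
      (c [^]\<^bsub>K\<^esub> length xs \<otimes>\<^bsub>K\<^esub> c) \<odot>\<^bsub>S\<^esub> (x \<otimes>\<^bsub>S\<^esub> lprod S xs)"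
      using c assms(2) by (simp add: S.smult_assoc2 S.smult_assoc2_right S.smult_assoc1)
    then show ?case using Cons by simp
  qed simp
qed

section \<open>Scaling endomorphisms and functoriality of the envelope\<close>

definition env_scale ::
    "('k, 'r) ring_scheme \<Rightarrow> nat \<Rightarrow> ('k, 'a) polar \<Rightarrow> nat \<Rightarrow> ('k, 'a) pexpr set \<Rightarrow> ('k, 'a) pexpr set" where
  "env_scale K p A z =
     env_lift K p A (envelope K p A) (\<lambda>x. nat_in K z \<odot>\<^bsub>envelope K p A\<^esub> env_gen K p A x)"

definition env_map ::
    "('k, 'r) ring_scheme \<Rightarrow> nat \<Rightarrow> ('k, 'a) polar \<Rightarrow> ('k, 'b) polar \<Rightarrow> ('a \<Rightarrow> 'b)
     \<Rightarrow> ('k, 'a) pexpr set \<Rightarrow> ('k, 'b) pexpr set" where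
  "env_map K p A B \<alpha> = env_lift K p A (envelope K p B) (\<lambda>x. env_gen K p B (\<alpha> x))"

lemma polar_homD:
  assumes "\<alpha> \<in> polar_hom K p A B"
  shows "\<alpha> \<in> linear_map K A B" "\<alpha> \<in> extensional (carrier A)"
    "xs \<in> tuples p A \<Longrightarrow> \<alpha> (mu A xs) = mu B (map \<alpha> xs)" "xs \<in> tuples p A \<Longrightarrow> map \<alpha> xs \<in> tuples p B"
  using assms by (auto simp: polar_hom_def tuples_def linear_map_def Pi_iff)

lemma polar_mapD:
  assumes "\<beta> \<in> polar_map K p A S"
  shows "\<beta> \<in> linear_map K A S" "xs \<in> tuples p A \<Longrightarrow> \<beta> (mu A xs) = lprod S (map \<beta> xs)"
  using assms by (auto simp: polar_map_def)

locale polar_char_p = polar_algebra K p A + char_p K p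
  for K :: "('k, 'r) ring_scheme" and p :: nat and A :: "('k, 'a) polar"
begin

lemma scale_polar_map:
  assumes S: "algebra K S" and \<beta>: "\<beta> \<in> polar_map K p A S"
  shows "(\<lambda>x. nk z \<odot>\<^bsub>S\<^esub> \<beta> x) \<in> polar_map K p A S"
  unfolding polar_map_def
proof (intro CollectI conjI ballI)
  interpret S: algebra K S by fact
  note l = linear_mapD[OF polar_mapD(1)[OF \<beta>]]
  show "(\<lambda>x. nk z \<odot>\<^bsub>S\<^esub> \<beta> x) \<in> linear_map K A S"
    by (auto simp: linear_map_def l S.smult_r_distr S.smult_assoc1[symmetric] R.m_comm)
  fix xs assume xs: "xs \<in> tuples p A"
  then have "set (map \<beta> xs) \<subseteq> carrier S" using l(1) by (auto simp: tuples_def)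
  then have "lprod S (map (\<lambda>x. nk z \<odot>\<^bsub>S\<^esub> x) (map \<beta> xs)) = nk z \<odot>\<^bsub>S\<^esub> lprod S (map \<beta> xs)"
    using xs by (subst lprod_smult[OF S]) (simp_all add: tuples_def nk_pow_p)
  then show "nk z \<odot>\<^bsub>S\<^esub> \<beta> (mu A xs) = lprod S (map (\<lambda>x. nk z \<odot>\<^bsub>S\<^esub> \<beta> x) xs)"
    by (simp add: polar_mapD(2)[OF \<beta> xs] comp_def)
qed

abbreviation \<sigma> where "\<sigma> \<equiv> env_scale K p A"

lemma \<sigma>_hom: "\<sigma> z \<in> alg_hom K E E"
  unfolding env_scale_def by (intro env_lift_hom algebra_E scale_polar_map gen_polar)

lemma \<sigma>_gen: "x \<in> carrier A \<Longrightarrow> \<sigma> z (gen x) = nk z \<odot>\<^bsub>E\<^esub> gen x"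
  unfolding env_scale_def by (intro env_lift_gen algebra_E scale_polar_map gen_polar)

lemma \<sigma>_comp:
  assumes "X \<in> carrier E"
  shows "\<sigma> y (\<sigma> z X) = \<sigma> (y * z) X"
proof -
  have "compose (carrier E) (\<sigma> y) (\<sigma> z) = \<sigma> (y * z)"
    by (rule alg_hom_E_eqI[OF alg_hom_compose[OF algebra_E \<sigma>_hom \<sigma>_hom] \<sigma>_hom])
      (simp add: compose_eq \<sigma>_gen alg_homD[OF \<sigma>_hom] nk_mult E.smult_assoc1[symmetric] R.m_comm)
  from fun_cong[OF this, of X] show ?thesis using assms by (simp add: compose_eq)
qed

text \<open>\<open>\<sigma> 0\<close> kills the generators and hence every nonempty word, so it is
  the projection onto the constants.\<close>

lemma \<sigma>_0:
  assumes "a \<in> carrier K" "tss \<in> mon_lists"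
  shows "\<sigma> 0 (a \<odot>\<^bsub>E\<^esub> \<one>\<^bsub>E\<^esub> \<oplus>\<^bsub>E\<^esub> mon_sum tss) = a \<odot>\<^bsub>E\<^esub> \<one>\<^bsub>E\<^esub>"
proof -
  have "\<sigma> 0 (mon_sum tss) = \<zero>\<^bsub>E\<^esub>"
    using assms(2)
  proof (induction tss)
    case Nil
    then show ?case
      using linear_map_lsum(2)[OF E.module E.module alg_homD(2)[OF \<sigma>_hom]] by simp
  next
    case (Cons ts tss)
    then obtain t us where ts: "ts = t # us" by (cases ts) auto
    then have c: "t \<in> carrier A" "mon us \<in> carrier E" using Cons.prems by auto
    have "mon ts = gen t \<otimes>\<^bsub>E\<^esub> mon us" by (simp add: mon_def ts)
    then have "\<sigma> 0 (mon ts) = \<zero>\<^bsub>E\<^esub>"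
      using c by (simp add: alg_homD[OF \<sigma>_hom] \<sigma>_gen)
    with Cons show ?case by (simp add: alg_homD[OF \<sigma>_hom])
  qed
  then show ?thesis using assms by (simp add: alg_homD[OF \<sigma>_hom])
qed

end

context
  fixes K :: "('k, 'r) ring_scheme" and p :: nat and A :: "('k, 'a) polar" and B :: "('k, 'b) polar" and \<alpha>
  assumes A: "polar_char_p K p A" and B: "polar_char_p K p B" and \<alpha>: "\<alpha> \<in> polar_hom K p A B"
begin

interpretation A: polar_char_p K p A by (rule A)
interpretation B: polar_char_p K p B by (rule B)

lemma gen_comp_polar: "(\<lambda>x. B.gen (\<alpha> x)) \<in> polar_map K p A B.E"
  unfolding polar_map_def
proof (intro CollectI conjI ballI)
  note g = linear_mapD[OF polar_mapD(1)[OF B.gen_polar]] and a = linear_mapD[OF polar_homD(1)[OF \<alpha>]]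
  show "(\<lambda>x. B.gen (\<alpha> x)) \<in> linear_map K A B.E"
    by (auto simp: linear_map_def a g)
  fix xs assume "xs \<in> tuples p A"
  then show "B.gen (\<alpha> (mu A xs)) = lprod B.E (map (\<lambda>x. B.gen (\<alpha> x)) xs)"
    using polar_mapD(2)[OF B.gen_polar polar_homD(4)[OF \<alpha>]] by (simp add: polar_homD(3)[OF \<alpha>] comp_def)
qed

lemma env_map_hom: "env_map K p A B \<alpha> \<in> alg_hom K A.E B.E"
  unfolding env_map_def by (intro A.env_lift_hom B.algebra_E gen_comp_polar)

lemma env_map_gen: "x \<in> carrier A \<Longrightarrow> env_map K p A B \<alpha> (A.gen x) = B.gen (\<alpha> x)"
  unfolding env_map_def by (intro A.env_lift_gen B.algebra_E gen_comp_polar)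

lemma env_map_scale:
  assumes "X \<in> carrier A.E"
  shows "env_map K p A B \<alpha> (A.\<sigma> z X) = B.\<sigma> z (env_map K p A B \<alpha> X)"
proof -
  have "compose (carrier A.E) (env_map K p A B \<alpha>) (A.\<sigma> z) = compose (carrier A.E) (B.\<sigma> z) (env_map K p A B \<alpha>)"
    by (rule A.alg_hom_E_eqI[OF alg_hom_compose[OF A.algebra_E A.\<sigma>_hom env_map_hom]
          alg_hom_compose[OF A.algebra_E env_map_hom B.\<sigma>_hom]])
      (simp add: compose_eq A.\<sigma>_gen B.\<sigma>_gen env_map_gen alg_homD[OF env_map_hom] linear_mapD(1)[OF polar_homD(1)[OF \<alpha>]])
  from fun_cong[OF this, of X] show ?thesis using assms by (simp add: compose_eq)
qed

end

lemma env_map_id: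
  assumes "polar_char_p K p A"
  shows "env_map K p A A (\<lambda>x\<in>carrier A. x) = (\<lambda>X\<in>carrier (envelope K p A). X)"
proof -
  interpret A: polar_char_p K p A by fact
  have id: "(\<lambda>x\<in>carrier A. x) \<in> polar_hom K p A A"
  proof -
    have "map (\<lambda>x\<in>carrier A. x) xs = xs" if "xs \<in> tuples p A" for xs
      using that by (intro map_idI) (auto simp: tuples_def)
    then show ?thesis by (simp add: polar_hom_def linear_map_def A.mu_closed)
  qed
  show ?thesis
    by (rule A.alg_hom_E_eqI[OF env_map_hom[OF assms assms id] alg_hom_id[OF A.algebra_E]])
      (simp add: env_map_gen[OF assms assms id])
qed

lemma polar_hom_compose:
  assumes "polar_algebra K p A" "\<alpha> \<in> polar_hom K p A B" "\<beta> \<in> polar_hom K p B C"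
  shows "compose (carrier A) \<beta> \<alpha> \<in> polar_hom K p A C"
proof -
  interpret A: polar_algebra K p A by fact
  note a = polar_homD[OF assms(2)] and b = polar_homD[OF assms(3)]
  note la = linear_mapD[OF a(1)] and lb = linear_mapD[OF b(1)]
  have "compose (carrier A) \<beta> \<alpha> (mu A xs) = mu C (map (compose (carrier A) \<beta> \<alpha>) xs)" if xs: "xs \<in> tuples p A" for xs
  proof -
    have "map (compose (carrier A) \<beta> \<alpha>) xs = map \<beta> (map \<alpha> xs)"
      using xs by (auto simp: tuples_def compose_eq)
    then show ?thesis
      using xs a b by (simp add: compose_eq A.mu_closed del: map_map)
  qed
  then show ?thesis
    by (auto simp: polar_hom_def linear_map_def compose_eq la lb)
qed

lemma env_map_compose:
  assumes A: "polar_char_p K p A" and B: "polar_char_p K p B" and C: "polar_char_p K p C"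
    and \<alpha>: "\<alpha> \<in> polar_hom K p A B" and \<beta>: "\<beta> \<in> polar_hom K p B C" and X: "X \<in> carrier (envelope K p A)"
  shows "env_map K p A C (compose (carrier A) \<beta> \<alpha>) X = env_map K p B C \<beta> (env_map K p A B \<alpha> X)"
proof -
  interpret A: polar_char_p K p A by fact
  note comp = polar_hom_compose[OF A.polar_algebra_axioms \<alpha> \<beta>]
  have "env_map K p A C (compose (carrier A) \<beta> \<alpha>) = compose (carrier A.E) (env_map K p B C \<beta>) (env_map K p A B \<alpha>)"
    by (rule A.alg_hom_E_eqI[OF env_map_hom[OF A C comp]
          alg_hom_compose[OF A.algebra_E env_map_hom[OF A B \<alpha>] env_map_hom[OF B C \<beta>]]])
      (simp add: compose_eq env_map_gen[OF A C comp] env_map_gen[OF A B \<alpha>] env_map_gen[OF B C \<beta>]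
        linear_mapD(1)[OF polar_homD(1)[OF \<alpha>]])
  then show ?thesis using X by (simp add: compose_eq)
qed


section \<open>The envelope of the polarization of an algebra\<close>

lemma (in comm_monoid) lprod_mset_cong:
  "\<lbrakk>mset xs = mset ys; set xs \<subseteq> carrier G\<rbrakk> \<Longrightarrow> lprod G xs = lprod G ys"
proof (induction xs arbitrary: ys)
  case (Cons x xs)
  then have "x \<in> set ys" by (metis list.set_intros(1) set_mset_mset)
  then obtain us vs where ys: "ys = us @ x # vs" by (metis split_list)
  have "set (x # xs) = set ys" using Cons.prems(1) by (metis set_mset_mset)
  then have c: "x \<in> carrier G" "set us \<subseteq> carrier G" "set vs \<subseteq> carrier G"
    using Cons.prems(2) by (auto simp: ys)
  have "lprod G xs = lprod G (us @ vs)"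
    using Cons.prems by (intro Cons.IH) (auto simp: ys)
  then show ?case using c by (simp add: ys m_ac)
qed simp

lemma pol_simps [simp]:
  "carrier (pol p R) = carrier R" "add (pol p R) = add R" "zero (pol p R) = zero R"
  "smult (pol p R) = smult R" "tuples n (pol p R) = tuples n R"
  by (simp_all add: pol_def tuples_def)

lemma linear_map_pol [simp]:
  "linear_map K (pol p R) S = linear_map K R S" "linear_map K S (pol p R) = linear_map K S R"
  by (simp_all add: linear_map_def)

lemma mu_pol: "xs \<in> tuples p R \<Longrightarrow> mu (pol p R) xs = lprod R xs"
  by (simp add: pol_def lprod_def)

text \<open>Commutativity moves the i-th entry to the front, which gives linearity in it; the
  iterated product is the product of all 2p - 1 entries and so symmetric.\<close>

lemma polar_algebra_pol:
  assumes "algebra K R" "p > 0"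
  shows "polar_algebra K p (pol p R)"
proof -
  interpret R: algebra K R by fact
  have "abelian_group (pol p R)"
    by (rule abelian_groupI) (auto simp: R.a_ac intro: R.l_neg bexI[of _ "\<ominus>\<^bsub>R\<^esub> x" for x])
  then have "Module.module K (pol p R)"
    by (intro moduleI) (simp_all add: R.R.is_cring R.smult_l_distr R.smult_r_distr R.smult_assoc1)
  moreover have "polar_algebra_axioms K p (pol p R)"
  proof
    fix xs assume "xs \<in> tuples p (pol p R)"
    then have xs: "xs \<in> tuples p R" by simp
    then show "mu (pol p R) xs \<in> carrier (pol p R)" by (simp add: mu_pol) (simp add: tuples_def)
    fix i assume i: "i < p"
    have len: "length xs = p" and c: "set xs \<subseteq> carrier R" using xs by (auto simp: tuples_def)
    have upd: "mu (pol p R) (xs[i := y]) = y \<otimes>\<^bsub>R\<^esub> lprod R (take i xs @ drop (Suc i) xs)"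
      and rest: "lprod R (take i xs @ drop (Suc i) xs) \<in> carrier R"
      if "y \<in> carrier R" for y
    proof -
      have c': "set (take i xs) \<subseteq> carrier R" "set (drop (Suc i) xs) \<subseteq> carrier R"
        using c set_take_subset set_drop_subset by fast+
      have "xs[i := y] \<in> tuples p R"
        using that c len set_update_subset_insert[of xs i y] by (auto simp: tuples_def)
      then have "mu (pol p R) (xs[i := y]) = lprod R (take i xs @ y # drop (Suc i) xs)"
        using i len by (simp add: mu_pol upd_conv_take_nth_drop)
      also have "\<dots> = y \<otimes>\<^bsub>R\<^esub> lprod R (take i xs @ drop (Suc i) xs)"
        using c' that by (simp add: R.m_lcomm)
      finally show "mu (pol p R) (xs[i := y]) = y \<otimes>\<^bsub>R\<^esub> lprod R (take i xs @ drop (Suc i) xs)" .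
      show "lprod R (take i xs @ drop (Suc i) xs) \<in> carrier R" using c' by (intro R.lprod_closed) auto
    qed
    show "mu (pol p R) (xs[i := y \<oplus>\<^bsub>pol p R\<^esub> z]) = mu (pol p R) (xs[i := y]) \<oplus>\<^bsub>pol p R\<^esub> mu (pol p R) (xs[i := z])"
      if "y \<in> carrier (pol p R)" "z \<in> carrier (pol p R)" for y z
      using that rest by (simp add: upd R.l_distr)
    show "mu (pol p R) (xs[i := a \<odot>\<^bsub>pol p R\<^esub> y]) = a \<odot>\<^bsub>pol p R\<^esub> mu (pol p R) (xs[i := y])"
      if "a \<in> carrier K" "y \<in> carrier (pol p R)" for a y
      using that rest by (simp add: upd R.smult_assoc2)
  next
    fix xs ys assume "xs \<in> tuples p (pol p R)" "ys \<in> tuples p (pol p R)" "mset xs = mset ys"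
    then show "mu (pol p R) xs = mu (pol p R) ys"
      using R.lprod_mset_cong[of xs ys] by (simp add: mu_pol) (simp add: tuples_def)
  next
    have eq: "mu (pol p R) (mu (pol p R) (take p xs) # drop p xs) = lprod R xs" if "xs \<in> tuples (2 * p - 1) R" for xs
    proof -
      have t: "take p xs \<in> tuples p R" and d: "set (drop p xs) \<subseteq> carrier R"
        using that assms(2) by (auto simp: tuples_def dest: in_set_takeD in_set_dropD)
      then have "lprod R (take p xs) # drop p xs \<in> tuples p R"
        using that assms(2) by (auto simp: tuples_def)
      then show ?thesis
        using t d R.lprod_append[of "take p xs" "drop p xs"] by (simp add: mu_pol) (simp add: tuples_def)
    qed
    fix xs ys assume "xs \<in> tuples (2 * p - 1) (pol p R)" "ys \<in> tuples (2 * p - 1) (pol p R)" "mset xs = mset ys"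
    then show "mu (pol p R) (mu (pol p R) (take p xs) # drop p xs) = mu (pol p R) (mu (pol p R) (take p ys) # drop p ys)"
      using R.lprod_mset_cong[of xs ys] by (simp add: eq) (simp add: tuples_def)
  qed
  ultimately show ?thesis by (simp add: polar_algebra_def)
qed

lemma alg_hom_polar_hom:
  assumes "algebra K R" "f \<in> alg_hom K R S"
  shows "f \<in> polar_hom K p (pol p R) (pol p S)"
proof -
  note f = alg_homD[OF assms(2)]
  have "f (lprod R xs) = mu (pol p S) (map f xs)" if "xs \<in> tuples p R" for xs
  proof -
    have "map f xs \<in> tuples p S" using that f(4) by (auto simp: tuples_def)
    then show ?thesis using alg_hom_lprod[OF assms, of xs] that by (simp add: mu_pol tuples_def)
  qed
  then show ?thesis using f by (simp add: polar_hom_def mu_pol)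
qed

section \<open>Reduction of words to a generator times a power of the image of 1\<close>

locale pol_envelope = R: algebra K R + char_p K p
  for K :: "('k, 'r) ring_scheme" and p :: nat and R :: "('k, 'a) module"
begin

lemma p_pos: "p > 0"
  using prime by (rule prime_gt_0_nat)

sublocale A: polar_char_p K p "pol p R"
  by (intro polar_char_p.intro polar_algebra_pol R.algebra_axioms p_pos char_p_axioms)

abbreviation E where "E \<equiv> A.E"
abbreviation gen where "gen \<equiv> A.gen"
abbreviation e where "e \<equiv> gen \<one>\<^bsub>R\<^esub>"

lemma gen_closed [simp]: "x \<in> carrier R \<Longrightarrow> gen x \<in> carrier E"
  using A.gen_closed by simp

lemma gen_add: "\<lbrakk>x \<in> carrier R; y \<in> carrier R\<rbrakk> \<Longrightarrow> gen (x \<oplus>\<^bsub>R\<^esub> y) = gen x \<oplus>\<^bsub>E\<^esub> gen y"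
  and gen_smult: "\<lbrakk>a \<in> carrier K; x \<in> carrier R\<rbrakk> \<Longrightarrow> gen (a \<odot>\<^bsub>R\<^esub> x) = a \<odot>\<^bsub>E\<^esub> gen x"
  using linear_mapD[OF polar_mapD(1)[OF A.gen_polar]] by simp_all

lemma gen_lprod: "xs \<in> tuples p R \<Longrightarrow> gen (lprod R xs) = lprod E (map gen xs)"
  using polar_mapD(2)[OF A.gen_polar, of xs] by (simp add: mu_pol)

lemma lprod_replicate: "x \<in> carrier E \<Longrightarrow> lprod E (replicate n x) = x [^]\<^bsub>E\<^esub> n"
  by (induction n) (simp_all add: A.E.m_comm)

lemma lprod_ones [simp]: "lprod R (replicate n \<one>\<^bsub>R\<^esub>) = \<one>\<^bsub>R\<^esub>"
  by (induction n) simp_all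

lemma replicate_one_closed: "set (replicate n \<one>\<^bsub>R\<^esub>) \<subseteq> carrier R"
  by (induction n) auto

text \<open>This is the polar relation for the tuple x, 1, ..., 1. In general e is not 1, but its
  power e^(p-1) acts as a unit on every generator.\<close>

lemma gen_e_pow:
  assumes "x \<in> carrier R"
  shows "gen x \<otimes>\<^bsub>E\<^esub> e [^]\<^bsub>E\<^esub> (p - Suc 0) = gen x"
proof -
  have "x # replicate (p - 1) \<one>\<^bsub>R\<^esub> \<in> tuples p R"
    using assms p_pos replicate_one_closed by (simp add: tuples_def)
  from gen_lprod[OF this] show ?thesis
    using assms by (simp add: lprod_replicate)
qed

text \<open>Multiply the polar relation for x, y, 1, ..., 1 by e: the p - 2 factors e on its right
  side become p - 1 and are absorbed by \<open>gen_e_pow\<close>.\<close>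

lemma gen_mult:
  assumes "x \<in> carrier R" "y \<in> carrier R"
  shows "gen x \<otimes>\<^bsub>E\<^esub> gen y = gen (x \<otimes>\<^bsub>R\<^esub> y) \<otimes>\<^bsub>E\<^esub> e"
proof -
  define q where "q = p - 2"
  have q: "Suc (Suc q) = p" "p - Suc 0 = Suc q" using prime_ge_2_nat[OF prime] by (simp_all add: q_def)
  have "x # y # replicate q \<one>\<^bsub>R\<^esub> \<in> tuples p R"
    using assms q(1) replicate_one_closed by (simp add: tuples_def)
  from gen_lprod[OF this] have "gen (x \<otimes>\<^bsub>R\<^esub> y) = gen x \<otimes>\<^bsub>E\<^esub> (gen y \<otimes>\<^bsub>E\<^esub> e [^]\<^bsub>E\<^esub> q)"
    using assms by (simp add: lprod_replicate)
  then have "gen (x \<otimes>\<^bsub>R\<^esub> y) \<otimes>\<^bsub>E\<^esub> e = gen x \<otimes>\<^bsub>E\<^esub> (gen y \<otimes>\<^bsub>E\<^esub> e [^]\<^bsub>E\<^esub> (p - Suc 0))"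
    using assms by (simp add: q(2) A.E.m_assoc)
  then show ?thesis using assms by (simp add: gen_e_pow)
qed

lemma gen_e_pow_mod:
  assumes "x \<in> carrier R"
  shows "gen x \<otimes>\<^bsub>E\<^esub> e [^]\<^bsub>E\<^esub> (k mod (p - 1)) = gen x \<otimes>\<^bsub>E\<^esub> e [^]\<^bsub>E\<^esub> k"
proof -
  have "gen x \<otimes>\<^bsub>E\<^esub> e [^]\<^bsub>E\<^esub> (j + q * (p - 1)) = gen x \<otimes>\<^bsub>E\<^esub> e [^]\<^bsub>E\<^esub> j" for j q
  proof (induction q)
    case (Suc q)
    have "gen x \<otimes>\<^bsub>E\<^esub> e [^]\<^bsub>E\<^esub> (j + Suc q * (p - 1)) = gen x \<otimes>\<^bsub>E\<^esub> (e [^]\<^bsub>E\<^esub> (p - 1) \<otimes>\<^bsub>E\<^esub> e [^]\<^bsub>E\<^esub> (j + q * (p - 1)))"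
      by (simp add: A.E.nat_pow_mult add_ac)
    also have "\<dots> = (gen x \<otimes>\<^bsub>E\<^esub> e [^]\<^bsub>E\<^esub> (p - 1)) \<otimes>\<^bsub>E\<^esub> e [^]\<^bsub>E\<^esub> (j + q * (p - 1))"
      using assms by (simp add: A.E.m_assoc)
    finally show ?case using Suc assms by (simp add: gen_e_pow)
  qed simp
  from this[of "k mod (p - 1)" "k div (p - 1)"] show ?thesis by (simp only: mod_div_mult_eq)
qed

text \<open>Each use of \<open>gen_mult\<close> merges two letters and leaves one factor e, whence
  the exponent. A word thus retains only its product and, by \<open>gen_e_pow_mod\<close>, its
  length modulo p - 1.\<close>

lemma mon_eq:
  assumes "ts \<noteq> []" "set ts \<subseteq> carrier R"
  shows "A.mon ts = gen (lprod R ts) \<otimes>\<^bsub>E\<^esub> e [^]\<^bsub>E\<^esub> (length ts - 1)"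
  using assms
proof (induction ts)
  case (Cons t ts)
  show ?case
  proof (cases "ts = []")
    case True
    then show ?thesis using Cons.prems by (simp add: A.mon_def)
  next
    case False
    have c: "t \<in> carrier R" "lprod R ts \<in> carrier R" using Cons.prems by auto
    have "A.mon (t # ts) = gen t \<otimes>\<^bsub>E\<^esub> (gen (lprod R ts) \<otimes>\<^bsub>E\<^esub> e [^]\<^bsub>E\<^esub> (length ts - 1))"
      using Cons False by (simp add: A.mon_def)
    also have "\<dots> = (gen t \<otimes>\<^bsub>E\<^esub> gen (lprod R ts)) \<otimes>\<^bsub>E\<^esub> e [^]\<^bsub>E\<^esub> (length ts - 1)"
      using c by (simp add: A.E.m_assoc)
    also have "\<dots> = gen (t \<otimes>\<^bsub>R\<^esub> lprod R ts) \<otimes>\<^bsub>E\<^esub> (e \<otimes>\<^bsub>E\<^esub> e [^]\<^bsub>E\<^esub> (length ts - 1))"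
      unfolding gen_mult[OF c] using c by (intro A.E.m_assoc) simp_all
    also have "e \<otimes>\<^bsub>E\<^esub> e [^]\<^bsub>E\<^esub> (length ts - 1) = e [^]\<^bsub>E\<^esub> length ts"
      using A.E.nat_pow_Suc2[of e "length ts - 1"] False by (cases ts) simp_all
    finally show ?thesis by simp
  qed
qed simp

text \<open>For z from 1 to p - 1 these are the projections onto the factors \<open>R\<close> of the
  envelope; e goes to z. \<open>\<pi> 1\<close> comes from the identity of \<open>R\<close> and will
  give the comparison isomorphism.\<close>

definition \<pi> :: "nat \<Rightarrow> ('k, 'a) pexpr set \<Rightarrow> 'a" where
  "\<pi> z = env_lift K p (pol p R) R (\<lambda>x. nk z \<odot>\<^bsub>R\<^esub> x)"

lemma id_polar: "(\<lambda>x. x) \<in> polar_map K p (pol p R) R"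
  by (auto simp: polar_map_def linear_map_def mu_pol)

lemma \<pi>_hom: "\<pi> z \<in> alg_hom K E R"
  unfolding \<pi>_def by (intro A.env_lift_hom R.algebra_axioms A.scale_polar_map id_polar)

lemma \<pi>_gen: "x \<in> carrier R \<Longrightarrow> \<pi> z (gen x) = nk z \<odot>\<^bsub>R\<^esub> x"
  unfolding \<pi>_def
  by (rule A.env_lift_gen[OF R.algebra_axioms A.scale_polar_map[OF R.algebra_axioms id_polar]]) simp

lemma \<pi>_\<sigma>:
  assumes "X \<in> carrier E"
  shows "\<pi> y (A.\<sigma> z X) = \<pi> (y * z) X"
proof -
  have "compose (carrier E) (\<pi> y) (A.\<sigma> z) = \<pi> (y * z)"
    by (rule A.alg_hom_E_eqI[OF alg_hom_compose[OF A.algebra_E A.\<sigma>_hom \<pi>_hom] \<pi>_hom])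
      (simp add: compose_eq A.\<sigma>_gen \<pi>_gen alg_homD[OF \<pi>_hom] nk_mult R.smult_assoc1[symmetric] R.R.m_comm)
  from fun_cong[OF this, of X] show ?thesis using assms by (simp add: compose_eq)
qed

lemma \<pi>_cong: "[y = z] (mod p) \<Longrightarrow> \<pi> y = \<pi> z"
  using nk_cong by (simp add: \<pi>_def)

lemma \<pi>_e_pow: "\<pi> z (e [^]\<^bsub>E\<^esub> n) = nk (z ^ n) \<odot>\<^bsub>R\<^esub> \<one>\<^bsub>R\<^esub>"
proof (induction n)
  case (Suc n)
  then show ?case
    by (simp add: alg_homD[OF \<pi>_hom] \<pi>_gen R.smult_assoc1[symmetric] R.smult_assoc2 nk_mult R.R.m_comm)
qed (use alg_homD(8)[OF \<pi>_hom] in simp)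

lemma \<pi>_gen_e_pow:
  assumes "x \<in> carrier R"
  shows "\<pi> z (gen x \<otimes>\<^bsub>E\<^esub> e [^]\<^bsub>E\<^esub> n) = nk (z ^ Suc n) \<odot>\<^bsub>R\<^esub> x"
proof -
  have "\<pi> z (gen x \<otimes>\<^bsub>E\<^esub> e [^]\<^bsub>E\<^esub> n) = (nk z \<odot>\<^bsub>R\<^esub> x) \<otimes>\<^bsub>R\<^esub> (nk (z ^ n) \<odot>\<^bsub>R\<^esub> \<one>\<^bsub>R\<^esub>)"
    using assms by (simp add: alg_homD[OF \<pi>_hom] \<pi>_gen \<pi>_e_pow)
  also have "\<dots> = nk (z ^ Suc n) \<odot>\<^bsub>R\<^esub> x"
  proof -
    have "nk (z ^ Suc n) = nk (z ^ n) \<otimes>\<^bsub>K\<^esub> nk z" by (simp only: power_Suc2 nk_mult)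
    then show ?thesis
      using assms by (simp add: R.smult_assoc2 R.smult_assoc2_right R.smult_assoc1 del: power_Suc)
  qed
  finally show ?thesis .
qed

end

text \<open>The number q - i + k represents k - i modulo q without leaving the naturals.\<close>

lemma dvd_sub_add_iff:
  fixes i q k :: nat
  assumes "i < q"
  shows "q dvd (q - i + k) \<longleftrightarrow> i = k mod q"
proof -
  have "int (q - i + k) = int q + (int k - int i)" using assms by simp
  then have "q dvd (q - i + k) \<longleftrightarrow> int q dvd int q + (int k - int i)"
    by (metis int_dvd_int_iff)
  also have "\<dots> \<longleftrightarrow> [int k = int i] (mod int q)" by (simp add: cong_iff_dvd_diff)
  also have "\<dots> \<longleftrightarrow> i = k mod q" using assms unfolding cong_int_iff by (auto simp: cong_def)
  finally show ?thesis .
qed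

lemma sum_list_map_upt: "sum_list (map f [m..<n]) = (\<Sum>i\<in>{m..<n}. f i :: nat)"
  by (simp add: sum_list_distinct_conv_sum_set)

section \<open>Interpolation: splitting the envelope by its components\<close>

context pol_envelope
begin

text \<open>The inclusion of the factor \<open>R\<close> with index z, by finite Fourier inversion:
  \<open>gen r\<close> times e^(j-1) has component x^j r at x, and the weights z^(p-1-j), which are
  z^(-j), filter out x = z. The factor p - 1 is the inverse of the number of units. The range starts
  at j = 1 because \<open>gen r\<close> itself contributes one degree.\<close>

definition \<iota> :: "nat \<Rightarrow> 'a \<Rightarrow> ('k, 'a) pexpr set" where
  "\<iota> z r = lsum E (map (\<lambda>j. nk ((p - 1) * z ^ (p - 1 - j)) \<odot>\<^bsub>E\<^esub> (gen r \<otimes>\<^bsub>E\<^esub> e [^]\<^bsub>E\<^esub> (j - 1))) [1..<p])"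

lemma \<iota>_linear: "\<iota> z \<in> linear_map K R E"
  unfolding linear_map_def
proof (intro CollectI conjI ballI Pi_I)
  fix x assume "x \<in> carrier R"
  then show "\<iota> z x \<in> carrier E" unfolding \<iota>_def by (intro A.E.lsum_closed) auto
next
  fix x y assume x: "x \<in> carrier R" "y \<in> carrier R"
  show "\<iota> z (x \<oplus>\<^bsub>R\<^esub> y) = \<iota> z x \<oplus>\<^bsub>E\<^esub> \<iota> z y"
    unfolding \<iota>_def using x
    by (subst A.E.lsum_add[symmetric]) (simp_all add: gen_add A.E.l_distr A.E.smult_r_distr)
next
  fix a x assume x: "a \<in> carrier K" "x \<in> carrier R"
  have "(\<lambda>X. a \<odot>\<^bsub>E\<^esub> X) \<in> linear_map K E E"
    using x by (auto simp: linear_map_def A.E.smult_r_distr A.E.smult_assoc1[symmetric] R.R.m_comm)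
  then have "a \<odot>\<^bsub>E\<^esub> \<iota> z x = lsum E (map (\<lambda>X. a \<odot>\<^bsub>E\<^esub> X)
    (map (\<lambda>j. nk ((p - 1) * z ^ (p - 1 - j)) \<odot>\<^bsub>E\<^esub> (gen x \<otimes>\<^bsub>E\<^esub> e [^]\<^bsub>E\<^esub> (j - 1))) [1..<p]))"
    unfolding \<iota>_def using x by (intro linear_map_lsum(1)[OF A.E.module A.E.module]) auto
  also have "\<dots> = \<iota> z (a \<odot>\<^bsub>R\<^esub> x)"
    unfolding \<iota>_def map_map comp_def using x
    by (simp add: gen_smult A.E.smult_assoc2 A.E.smult_assoc1[symmetric] R.R.m_comm)
  finally show "\<iota> z (a \<odot>\<^bsub>R\<^esub> x) = a \<odot>\<^bsub>E\<^esub> \<iota> z x" ..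
qed

lemma \<pi>_\<iota>:
  assumes x: "x \<in> {1..<p}" and z: "z \<in> {1..<p}" and r: "r \<in> carrier R"
  shows "\<pi> x (\<iota> z r) = (if x = z then r else \<zero>\<^bsub>R\<^esub>)"
proof -
  have "\<pi> x (\<iota> z r) = lsum R (map (\<pi> x)
    (map (\<lambda>j. nk ((p - 1) * z ^ (p - 1 - j)) \<odot>\<^bsub>E\<^esub> (gen r \<otimes>\<^bsub>E\<^esub> e [^]\<^bsub>E\<^esub> (j - 1))) [1..<p]))"
    unfolding \<iota>_def using r by (intro linear_map_lsum(1)[OF A.E.module R.module alg_homD(2)[OF \<pi>_hom]]) auto
  also have "\<dots> = lsum R (map (\<lambda>j. nk ((p - 1) * z ^ (p - 1 - j) * x ^ j) \<odot>\<^bsub>R\<^esub> r) [1..<p])"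
  proof -
    have "\<pi> x (nk ((p - 1) * z ^ (p - 1 - j)) \<odot>\<^bsub>E\<^esub> (gen r \<otimes>\<^bsub>E\<^esub> e [^]\<^bsub>E\<^esub> (j - 1))) =
      nk ((p - 1) * z ^ (p - 1 - j) * x ^ j) \<odot>\<^bsub>R\<^esub> r" if "j \<in> set [1..<p]" for j
    proof -
      have "x ^ Suc (j - 1) = x ^ j" using that by simp
      then show ?thesis
        using r by (simp only: alg_homD(7)[OF \<pi>_hom] \<pi>_gen_e_pow nk_mult[of _ "x ^ j"] R.smult_assoc1
            nk_simps gen_closed R.one_closed A.E.nat_pow_closed A.E.m_closed)
    qed
    then show ?thesis unfolding map_map by (intro arg_cong[of _ _ "lsum R"] map_cong) auto
  qed
  also have "\<dots> = nk (\<Sum>j\<in>{1..<p}. (p - 1) * z ^ (p - 1 - j) * x ^ j) \<odot>\<^bsub>R\<^esub> r"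
    by (simp only: lsum_nk[OF R.module r] sum_list_map_upt)
  also have "nk (\<Sum>j\<in>{1..<p}. (p - 1) * z ^ (p - 1 - j) * x ^ j) = nk (if x = z then 1 else 0)"
    by (rule nk_cong[OF geometric_cong[OF prime x z]])
  also have "\<dots> \<odot>\<^bsub>R\<^esub> r = (if x = z then r else \<zero>\<^bsub>R\<^esub>)" using r by simp
  finally show ?thesis .
qed

text \<open>Completeness, where \<open>\<pi>_\<iota>\<close> is orthogonality: X has component
  z^(k+1) r at z, and reassembling these components returns the one power of e that is congruent to
  k.\<close>

lemma mon_decompose:
  fixes k :: nat
  assumes r: "r \<in> carrier R"
  defines "X \<equiv> gen r \<otimes>\<^bsub>E\<^esub> e [^]\<^bsub>E\<^esub> k"
  shows "lsum E (map (\<lambda>z. \<iota> z (\<pi> z X)) [1..<p]) = X"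
proof -
  define w where "w j = gen r \<otimes>\<^bsub>E\<^esub> e [^]\<^bsub>E\<^esub> (j - 1)" for j :: nat
  have w [simp]: "w j \<in> carrier E" for j using r by (simp add: w_def)
  have exp: "p - 1 - j + Suc k = (p - 1) - (j - 1) + k" if "j \<in> set [1..<p]" for j
    using that by auto
  have "\<iota> z (\<pi> z X) = lsum E (map (\<lambda>j. nk ((p - 1) * z ^ (p - 1 - j + Suc k)) \<odot>\<^bsub>E\<^esub> w j) [1..<p])" for z
  proof -
    have "\<iota> z (\<pi> z X) = nk (z ^ Suc k) \<odot>\<^bsub>E\<^esub> \<iota> z r"
      unfolding X_def \<pi>_gen_e_pow[OF r] using r by (intro linear_mapD(3)[OF \<iota>_linear]) simp_all
    also have "\<dots> = lsum E (map (\<lambda>X. nk (z ^ Suc k) \<odot>\<^bsub>E\<^esub> X) (map (\<lambda>j. nk ((p - 1) * z ^ (p - 1 - j)) \<odot>\<^bsub>E\<^esub> w j) [1..<p]))"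
      unfolding \<iota>_def w_def[symmetric]
      by (intro linear_map_lsum(1)[OF A.E.module A.E.module])
        (auto simp: linear_map_def A.E.smult_r_distr A.E.smult_assoc1[symmetric] R.R.m_comm)
    also have "\<dots> = lsum E (map (\<lambda>j. nk ((p - 1) * z ^ (p - 1 - j + Suc k)) \<odot>\<^bsub>E\<^esub> w j) [1..<p])"
    proof -
      have "nk (z ^ Suc k) \<odot>\<^bsub>E\<^esub> (nk ((p - 1) * z ^ (p - 1 - j)) \<odot>\<^bsub>E\<^esub> w j) = nk ((p - 1) * z ^ (p - 1 - j + Suc k)) \<odot>\<^bsub>E\<^esub> w j" for j
      proof -
        have "(p - 1) * z ^ (p - 1 - j + Suc k) = z ^ Suc k * ((p - 1) * z ^ (p - 1 - j))"
          by (simp only: power_add mult_ac)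
        then show ?thesis by (simp only: nk_mult[of "z ^ Suc k"] A.E.smult_assoc1 nk_simps w)
      qed
      then show ?thesis unfolding map_map by (intro arg_cong[of _ _ "lsum E"] map_cong) auto
    qed
    finally show ?thesis .
  qed
  then have "lsum E (map (\<lambda>z. \<iota> z (\<pi> z X)) [1..<p]) =
    lsum E (map (\<lambda>z. lsum E (map (\<lambda>j. nk ((p - 1) * z ^ (p - 1 - j + Suc k)) \<odot>\<^bsub>E\<^esub> w j) [1..<p])) [1..<p])"
    by (simp only:)
  \<comment> \<open>With the sum over z innermost, \<open>power_sum_cong\<close> applies and leaves
    only the index j with j - 1 = k mod (p - 1).\<close>
  also have "\<dots> = lsum E (map (\<lambda>j. lsum E (map (\<lambda>z. nk ((p - 1) * z ^ (p - 1 - j + Suc k)) \<odot>\<^bsub>E\<^esub> w j) [1..<p])) [1..<p])"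
    by (rule A.E.lsum_swap) simp
  also have "\<dots> = lsum E (map (\<lambda>j. if j - 1 = k mod (p - 1) then w j else \<zero>\<^bsub>E\<^esub>) [1..<p])"
  proof -
    have "lsum E (map (\<lambda>z. nk ((p - 1) * z ^ (p - 1 - j + Suc k)) \<odot>\<^bsub>E\<^esub> w j) [1..<p])
      = (if j - 1 = k mod (p - 1) then w j else \<zero>\<^bsub>E\<^esub>)" if j: "j \<in> set [1..<p]" for j
    proof -
      have "lsum E (map (\<lambda>z. nk ((p - 1) * z ^ (p - 1 - j + Suc k)) \<odot>\<^bsub>E\<^esub> w j) [1..<p])
        = nk (\<Sum>z\<in>{1..<p}. (p - 1) * z ^ (p - 1 - j + Suc k)) \<odot>\<^bsub>E\<^esub> w j"
        by (simp only: lsum_nk[OF A.E.module w] sum_list_map_upt)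
      also have "nk (\<Sum>z\<in>{1..<p}. (p - 1) * z ^ (p - 1 - j + Suc k)) = nk (if (p - 1) dvd (p - 1 - j + Suc k) then 1 else 0)"
        by (rule nk_cong[OF power_sum_cong[OF prime]])
      also have "(p - 1) dvd (p - 1 - j + Suc k) \<longleftrightarrow> j - 1 = k mod (p - 1)"
        unfolding exp[OF j] using j by (intro dvd_sub_add_iff) auto
      finally show ?thesis by simp
    qed
    then show ?thesis by (intro arg_cong[of _ _ "lsum E"] map_cong) auto
  qed
  also have "\<dots> = w (Suc (k mod (p - 1)))"
  proof -
    have "k mod (p - 1) < p - 1" using prime_ge_2_nat[OF prime] by (intro mod_less_divisor) simp
    then show ?thesis
      by (subst A.E.lsum_single[of _ "Suc (k mod (p - 1))"]) auto
  qed
  also have "\<dots> = X" using gen_e_pow_mod[OF r] by (simp add: w_def X_def)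
  finally show ?thesis .
qed

lemma mon_sum_decompose:
  "tss \<in> A.mon_lists \<Longrightarrow> lsum E (map (\<lambda>z. \<iota> z (\<pi> z (A.mon_sum tss))) [1..<p]) = A.mon_sum tss"
proof (induction tss)
  case Nil
  have "\<iota> z (\<pi> z \<zero>\<^bsub>E\<^esub>) = \<zero>\<^bsub>E\<^esub>" for z
    using linear_map_lsum(2)[OF A.E.module R.module alg_homD(2)[OF \<pi>_hom]]
      linear_map_lsum(2)[OF R.module A.E.module \<iota>_linear] by simp
  moreover have "lsum E (map (\<lambda>z. \<zero>\<^bsub>E\<^esub>) zs) = \<zero>\<^bsub>E\<^esub>" for zs :: "nat list" by (induction zs) auto
  ultimately show ?case by simp
next
  case (Cons ts tss)
  then have ts: "ts \<noteq> []" "set ts \<subseteq> carrier R" and tss: "tss \<in> A.mon_lists" by auto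
  have c: "A.mon ts \<in> carrier E" "A.mon_sum tss \<in> carrier E" using ts tss by simp_all
  have "lsum E (map (\<lambda>z. \<iota> z (\<pi> z (A.mon ts \<oplus>\<^bsub>E\<^esub> A.mon_sum tss))) [1..<p]) =
    lsum E (map (\<lambda>z. \<iota> z (\<pi> z (A.mon ts)) \<oplus>\<^bsub>E\<^esub> \<iota> z (\<pi> z (A.mon_sum tss))) [1..<p])"
    using c by (simp add: alg_homD[OF \<pi>_hom] linear_mapD[OF \<iota>_linear])
  also have "\<dots> = lsum E (map (\<lambda>z. \<iota> z (\<pi> z (A.mon ts))) [1..<p]) \<oplus>\<^bsub>E\<^esub> lsum E (map (\<lambda>z. \<iota> z (\<pi> z (A.mon_sum tss))) [1..<p])"
    using c by (intro A.E.lsum_add) (simp_all add: alg_homD[OF \<pi>_hom] linear_mapD[OF \<iota>_linear])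
  also have "lsum E (map (\<lambda>z. \<iota> z (\<pi> z (A.mon ts))) [1..<p]) = A.mon ts"
    unfolding mon_eq[OF ts] using ts by (intro mon_decompose R.lprod_closed)
  finally show ?case using Cons.IH[OF tss] by simp
qed

text \<open>Together the next two lemmas say that the envelope of \<open>pol p R\<close> is \<open>K \<times> R ^ (p - 1)\<close>.\<close>

lemma E_eqI:
  assumes X: "X \<in> carrier E" and Y: "Y \<in> carrier E" and 0: "A.\<sigma> 0 X = A.\<sigma> 0 Y"
    and \<pi>: "\<And>z. z \<in> {1..<p} \<Longrightarrow> \<pi> z X = \<pi> z Y"
  shows "X = Y"
proof -
  obtain a tss where a: "a \<in> carrier K" "tss \<in> A.mon_lists" "X = a \<odot>\<^bsub>E\<^esub> \<one>\<^bsub>E\<^esub> \<oplus>\<^bsub>E\<^esub> A.mon_sum tss"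
    using X by (rule A.normal_form)
  obtain b uss where b: "b \<in> carrier K" "uss \<in> A.mon_lists" "Y = b \<odot>\<^bsub>E\<^esub> \<one>\<^bsub>E\<^esub> \<oplus>\<^bsub>E\<^esub> A.mon_sum uss"
    using Y by (rule A.normal_form)
  \<comment> \<open>\<open>\<sigma> 0\<close> isolates the constants. Once they are cancelled in
    every component, the sums of words have equal components and are recovered by
    \<open>mon_sum_decompose\<close>.\<close>
  have ab: "a \<odot>\<^bsub>E\<^esub> \<one>\<^bsub>E\<^esub> = b \<odot>\<^bsub>E\<^esub> \<one>\<^bsub>E\<^esub>" using 0 a b by (simp add: A.\<sigma>_0)
  have "\<pi> z (A.mon_sum tss) = \<pi> z (A.mon_sum uss)" if "z \<in> {1..<p}" for z
  proof -
    have "\<pi> z (b \<odot>\<^bsub>E\<^esub> \<one>\<^bsub>E\<^esub>) \<oplus>\<^bsub>R\<^esub> \<pi> z (A.mon_sum tss) = \<pi> z (b \<odot>\<^bsub>E\<^esub> \<one>\<^bsub>E\<^esub>) \<oplus>\<^bsub>R\<^esub> \<pi> z (A.mon_sum uss)"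
      using \<pi>[OF that] a(1,2) b(1,2) unfolding a(3) b(3) ab by (simp add: alg_homD(6)[OF \<pi>_hom])
    then show ?thesis using a b by (simp add: alg_homD(4)[OF \<pi>_hom])
  qed
  then have "lsum E (map (\<lambda>z. \<iota> z (\<pi> z (A.mon_sum tss))) [1..<p]) = lsum E (map (\<lambda>z. \<iota> z (\<pi> z (A.mon_sum uss))) [1..<p])"
    by (intro arg_cong[of _ _ "lsum E"] map_cong) auto
  then show ?thesis using a b ab by (simp only: mon_sum_decompose)
qed

lemma E_ex:
  assumes a: "a \<in> carrier K" and r: "\<And>z. z \<in> {1..<p} \<Longrightarrow> r z \<in> carrier R"
  obtains X where "X \<in> carrier E" "A.\<sigma> 0 X = a \<odot>\<^bsub>E\<^esub> \<one>\<^bsub>E\<^esub>" "\<And>z. z \<in> {1..<p} \<Longrightarrow> \<pi> z X = r z"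
proof
  \<comment> \<open>The constant a contributes a times 1 to every component, so it is subtracted
    beforehand.\<close>
  define s where "s z = r z \<ominus>\<^bsub>R\<^esub> a \<odot>\<^bsub>R\<^esub> \<one>\<^bsub>R\<^esub>" for z
  have s: "s z \<in> carrier R" if "z \<in> {1..<p}" for z using that a r by (simp add: s_def)
  define Y where "Y = lsum E (map (\<lambda>z. \<iota> z (s z)) [1..<p])"
  have ic: "\<iota> z (s z) \<in> carrier E" if "z \<in> set [1..<p]" for z
    using that s by (intro linear_mapD(1)[OF \<iota>_linear]) simp
  have Y: "Y \<in> carrier E" unfolding Y_def using ic by (intro A.E.lsum_closed) auto
  show "a \<odot>\<^bsub>E\<^esub> \<one>\<^bsub>E\<^esub> \<oplus>\<^bsub>E\<^esub> Y \<in> carrier E" using a Y by simp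
  have "A.\<sigma> 0 (\<iota> z x) = \<zero>\<^bsub>E\<^esub>" if "x \<in> carrier R" for z x
  proof -
    have "A.\<sigma> 0 (\<iota> z x) = lsum E (map (A.\<sigma> 0)
      (map (\<lambda>j. nk ((p - 1) * z ^ (p - 1 - j)) \<odot>\<^bsub>E\<^esub> (gen x \<otimes>\<^bsub>E\<^esub> e [^]\<^bsub>E\<^esub> (j - 1))) [1..<p]))"
      unfolding \<iota>_def using that by (intro linear_map_lsum(1)[OF A.E.module A.E.module alg_homD(2)[OF A.\<sigma>_hom]]) auto
    also have "\<dots> = lsum E (map (\<lambda>j. \<zero>\<^bsub>E\<^esub>) [1..<p])"
      using that by (simp add: alg_homD[OF A.\<sigma>_hom] A.\<sigma>_gen comp_def)
    also have "\<dots> = \<zero>\<^bsub>E\<^esub>" using A.E.lsum_single[of "[1..<p]" 1 "\<lambda>j. \<zero>\<^bsub>E\<^esub>"] prime_ge_2_nat[OF prime] by simp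
    finally show ?thesis .
  qed
  then have \<sigma>\<iota>: "A.\<sigma> 0 (\<iota> z (s z)) = \<zero>\<^bsub>E\<^esub>" if "z \<in> set [1..<p]" for z using that s by simp
  have "A.\<sigma> 0 Y = lsum E (map (A.\<sigma> 0) (map (\<lambda>z. \<iota> z (s z)) [1..<p]))"
    unfolding Y_def using ic by (intro linear_map_lsum(1)[OF A.E.module A.E.module alg_homD(2)[OF A.\<sigma>_hom]]) auto
  also have "\<dots> = lsum E (map (\<lambda>z. \<zero>\<^bsub>E\<^esub>) [1..<p])"
    unfolding map_map using \<sigma>\<iota> by (intro arg_cong[of _ _ "lsum E"] map_cong) auto
  also have "\<dots> = \<zero>\<^bsub>E\<^esub>" using A.E.lsum_single[of "[1..<p]" 1 "\<lambda>j. \<zero>\<^bsub>E\<^esub>"] prime_ge_2_nat[OF prime] by simp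
  finally show "A.\<sigma> 0 (a \<odot>\<^bsub>E\<^esub> \<one>\<^bsub>E\<^esub> \<oplus>\<^bsub>E\<^esub> Y) = a \<odot>\<^bsub>E\<^esub> \<one>\<^bsub>E\<^esub>"
    using a Y by (simp add: alg_homD[OF A.\<sigma>_hom])
  fix x assume x: "x \<in> {1..<p}"
  have "\<pi> x Y = lsum R (map (\<pi> x) (map (\<lambda>z. \<iota> z (s z)) [1..<p]))"
    unfolding Y_def using ic by (intro linear_map_lsum(1)[OF A.E.module R.module alg_homD(2)[OF \<pi>_hom]]) auto
  also have "\<dots> = lsum R (map (\<lambda>z. if x = z then s z else \<zero>\<^bsub>R\<^esub>) [1..<p])"
    unfolding map_map using \<pi>_\<iota>[OF x _ s] by (intro arg_cong[of _ _ "lsum R"] map_cong) auto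
  also have "\<dots> = s x" using x s[OF x] by (subst R.lsum_single[of _ x]) auto
  finally have "\<pi> x (a \<odot>\<^bsub>E\<^esub> \<one>\<^bsub>E\<^esub> \<oplus>\<^bsub>E\<^esub> Y) = a \<odot>\<^bsub>R\<^esub> \<one>\<^bsub>R\<^esub> \<oplus>\<^bsub>R\<^esub> (r x \<ominus>\<^bsub>R\<^esub> a \<odot>\<^bsub>R\<^esub> \<one>\<^bsub>R\<^esub>)"
    using a Y by (simp add: alg_homD[OF \<pi>_hom] s_def)
  also have "\<dots> = r x" using a r[OF x] by (simp add: R.minus_eq R.a_lcomm[of "a \<odot>\<^bsub>R\<^esub> \<one>\<^bsub>R\<^esub>" "r x"] R.r_neg)
  finally show "\<pi> x (a \<odot>\<^bsub>E\<^esub> \<one>\<^bsub>E\<^esub> \<oplus>\<^bsub>E\<^esub> Y) = r x" .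
qed

end


section \<open>Points of polar algebras\<close>

definition polar_points ::
    "('k, 'r) ring_scheme \<Rightarrow> nat \<Rightarrow> ('k, 'h) hopf \<Rightarrow> ('k, 'a) polar \<Rightarrow> ('h \<Rightarrow> ('k, 'a) pexpr set) monoid" where
  "polar_points K p H A = teich_points K p H (envelope K p A) (env_scale K p A)"

text \<open>The condition for z = 0: since p^n > 0, the exponent 0^(p^n) is 0 and the power is the
  unit of the group, that is, the counit.\<close>

lemma polar_points_counit:
  assumes A: "polar_char_p K p A" and H: "bicommutative_hopf_algebra K H"
    and f: "f \<in> carrier (polar_points K p H A)" and h: "h \<in> carrier H"
  shows "env_scale K p A 0 (f h) = counit H h \<odot>\<^bsub>envelope K p A\<^esub> \<one>\<^bsub>envelope K p A\<^esub>"
proof -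
  interpret A: polar_char_p K p A by fact
  interpret PE: hopf_points K H A.E by (simp add: hopf_points_def H A.algebra_E)
  have "\<forall>\<^sub>F n in sequentially. A.\<sigma> 0 (f h) = (f [^]\<^bsub>PE.G\<^esub> ((0::nat) ^ p ^ n)) h"
    using f h unfolding polar_points_def teich_points_simps by blast
  then obtain n where "A.\<sigma> 0 (f h) = (f [^]\<^bsub>PE.G\<^esub> ((0::nat) ^ p ^ n)) h"
    by (auto dest: eventually_happens)
  then show ?thesis using h prime_gt_0_nat[OF A.prime] by (simp add: PE.G_one zero_power)
qed

section \<open>Comparison of the eigenspace for a polarization with the points of
  \<open>R\<close>\<close>

locale pol_points = pol_envelope K p R for K :: "('k, 'r) ring_scheme" and p :: nat and R :: "('k, 'a) module" +
  fixes H :: "('k, 'h) hopf"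
  assumes padic: "H \<in> AbSch_padic K p"
begin

lemma hopf: "bicommutative_hopf_algebra K H"
  using padic by (simp add: AbSch_padic_def)

sublocale PR: padic_points K H R p
  by (intro padic_points.intro hopf_points.intro padic_points_axioms.intro hopf R.algebra_axioms prime padic)

sublocale PE: padic_points K H E p
  by (intro padic_points.intro hopf_points.intro padic_points_axioms.intro hopf A.algebra_E prime padic)

lemma map_\<pi>_pow:
  fixes n :: nat
  assumes "f \<in> alg_hom K H E" "h \<in> carrier H"
  shows "\<pi> z ((f [^]\<^bsub>PE.G\<^esub> n) h) = (points_map H (\<pi> z) f [^]\<^bsub>PR.G\<^esub> n) h"
  using points_map_pow[OF hopf A.algebra_E R.algebra_axioms \<pi>_hom assms(1), of z n] assms(2)
  by (metis points_map_apply)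

text \<open>The component at z is the component at 1 of \<open>\<sigma> z (f h)\<close>. The
  eigenspace condition turns \<open>\<sigma> z\<close> into a power, and \<open>\<pi> 1\<close>
  commutes with powers.\<close>

lemma polar_points_\<pi>:
  assumes f: "f \<in> carrier (polar_points K p H (pol p R))" and h: "h \<in> carrier H"
  shows "\<forall>\<^sub>F n in sequentially. \<pi> z (f h) = (points_map H (\<pi> 1) f [^]\<^bsub>PR.G\<^esub> (z ^ p ^ n)) h"
proof -
  have fc: "f \<in> alg_hom K H E" using f by (simp add: polar_points_def)
  have "\<forall>\<^sub>F n in sequentially. A.\<sigma> z (f h) = (f [^]\<^bsub>PE.G\<^esub> (z ^ p ^ n)) h"
    using assms unfolding polar_points_def teich_points_simps by blast
  then show ?thesis
  proof eventually_elim
    case (elim n)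
    have "\<pi> z (f h) = \<pi> 1 (A.\<sigma> z (f h))" using \<pi>_\<sigma>[of "f h" 1 z] alg_homD(4)[OF fc h] by simp
    then show ?case unfolding elim map_\<pi>_pow[OF fc h] .
  qed
qed

lemma theta_inj: "inj_on (points_map H (\<pi> 1)) (carrier (polar_points K p H (pol p R)))"
proof (rule inj_onI)
  fix f g assume f: "f \<in> carrier (polar_points K p H (pol p R))" and g: "g \<in> carrier (polar_points K p H (pol p R))"
    and eq: "points_map H (\<pi> 1) f = points_map H (\<pi> 1) g"
  have fc: "f \<in> alg_hom K H E" and gc: "g \<in> alg_hom K H E" using f g by (simp_all add: polar_points_def)
  show "f = g"
  proof (rule extensionalityI[OF alg_homD(3)[OF fc] alg_homD(3)[OF gc]])
    fix h assume h: "h \<in> carrier H"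
    show "f h = g h"
    proof (rule E_eqI)
      fix z
      \<comment> \<open>The equation does not involve n, so holding eventually means
        holding.\<close>
      have "\<forall>\<^sub>F n in sequentially. \<pi> z (f h) = \<pi> z (g h)"
        using polar_points_\<pi>[OF f h, of z] polar_points_\<pi>[OF g h, of z]
        unfolding eq by eventually_elim simp
      then show "\<pi> z (f h) = \<pi> z (g h)" by simp
    qed (use h polar_points_counit[OF A.polar_char_p_axioms hopf f h] polar_points_counit[OF A.polar_char_p_axioms hopf g h]
        alg_homD(4)[OF fc] alg_homD(4)[OF gc] in simp_all)
  qed
qed

lemma tends_pow:
  assumes F: "\<And>n. F n \<in> alg_hom K H R" "f \<in> alg_hom K H R" "PR.tends F f"
  shows "PR.tends (\<lambda>n. F n [^]\<^bsub>PR.G\<^esub> (b::nat)) (f [^]\<^bsub>PR.G\<^esub> b)"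
proof (induction b)
  case 0
  then show ?case by (simp add: PR.tends_const)
next
  case (Suc b)
  then show ?case
    unfolding nat_pow_Suc using F by (intro PR.tends_mult PR.pow_closed)
qed

text \<open>The component at z is forced to be y z, the action of the Teichmueller representative of
  z on x. With the counit as constant part these components assemble to f, and the uniqueness in
  \<open>E_eqI\<close> makes f an algebra homomorphism. The eigenspace condition becomes
  multiplicativity of Teichmueller representatives.\<close>

lemma theta_surj:
  assumes x: "x \<in> alg_hom K H R"
  shows "\<exists>f\<in>carrier (polar_points K p H (pol p R)). points_map H (\<pi> 1) f = x"
proof -
  define lim where "lim z g \<longleftrightarrow> g \<in> alg_hom K H R \<and>
    (\<forall>h n. h \<in> PR.level n \<longrightarrow> g h = (x [^]\<^bsub>PR.G\<^esub> (z ^ p ^ n)) h) \<and>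
    PR.tends (\<lambda>n. x [^]\<^bsub>PR.G\<^esub> (z ^ p ^ n)) g" for z :: nat and g
  define y where "y z = (SOME g. lim z g)" for z
  have "\<exists>g. lim z g" for z
  proof -
    obtain g where g: "g \<in> alg_hom K H R" "\<And>h n. h \<in> PR.level n \<Longrightarrow> g h = (x [^]\<^bsub>PR.G\<^esub> (z ^ p ^ n)) h"
      "PR.tends (\<lambda>n. x [^]\<^bsub>PR.G\<^esub> (z ^ p ^ n)) g"
      by (rule PR.ex_pow_limit[OF x teichmueller_cong[OF prime], of z]) (assumption, rule that)
    then show ?thesis unfolding lim_def by (intro exI[of _ g] conjI allI impI g)
  qed
  then have "lim z (y z)" for z unfolding y_def by (rule someI_ex)
  then have y: "y z \<in> alg_hom K H R"
    and y_level: "h \<in> PR.level n \<Longrightarrow> y z h = (x [^]\<^bsub>PR.G\<^esub> (z ^ p ^ n)) h"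
    and y_tends: "PR.tends (\<lambda>n. x [^]\<^bsub>PR.G\<^esub> (z ^ p ^ n)) (y z)" for z h n
    unfolding lim_def by simp_all
  \<comment> \<open>The Teichmueller representative depends only on the residue of z modulo
    p.\<close>
  have y_cong: "y z h = y z' h" if "[z = z'] (mod p)" "h \<in> carrier H" for z z' h
  proof -
    obtain n where n: "h \<in> PR.level n" using PR.level(2)[OF \<open>h \<in> carrier H\<close>] by blast
    show ?thesis
      unfolding y_level[OF n] by (rule PR.level_pow_cong[OF x n cong_pow_prime_power[OF that(1)]])
  qed
  \<comment> \<open>The representative of w z is the product of those of w and z, so acting by it on
    x amounts to acting by the representative of z on y w.\<close>
  have y_pow: "\<forall>\<^sub>F n in sequentially. y (w * z) h = (y w [^]\<^bsub>PR.G\<^esub> (z ^ p ^ n)) h"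
    if h: "h \<in> carrier H" for w z h
  proof -
    obtain N where N: "h \<in> PR.level N" using PR.level(2)[OF h] by blast
    have "\<forall>\<^sub>F m in sequentially. ((x [^]\<^bsub>PR.G\<^esub> (w ^ p ^ m)) [^]\<^bsub>PR.G\<^esub> (z ^ p ^ N)) h = (y w [^]\<^bsub>PR.G\<^esub> (z ^ p ^ N)) h"
      using tends_pow[OF _ y y_tends] x h by (simp add: PR.tends_def)
    then obtain m where m: "m \<ge> N" "((x [^]\<^bsub>PR.G\<^esub> (w ^ p ^ m)) [^]\<^bsub>PR.G\<^esub> (z ^ p ^ N)) h = (y w [^]\<^bsub>PR.G\<^esub> (z ^ p ^ N)) h"
      \<comment> \<open>The index m is late enough for the limit y w to be attained after taking
        powers, and also at least the level N, so that w^(p^m) may be replaced by w^(p^N).\<close>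
      unfolding eventually_sequentially by (metis nat_le_linear)
    have "(y w [^]\<^bsub>PR.G\<^esub> (z ^ p ^ N)) h = (x [^]\<^bsub>PR.G\<^esub> (w ^ p ^ m * z ^ p ^ N)) h"
      unfolding m(2)[symmetric] using PR.G.nat_pow_pow[of x] x by simp
    also have "\<dots> = (x [^]\<^bsub>PR.G\<^esub> ((w * z) ^ p ^ N)) h"
      unfolding power_mult_distrib
      by (intro PR.level_pow_cong[OF x N] cong_mult teichmueller_cong[OF prime m(1)] cong_refl)
    also have "\<dots> = y (w * z) h" using y_level[OF N] by simp
    finally have "y (w * z) h = (y w [^]\<^bsub>PR.G\<^esub> (z ^ p ^ n)) h" if "n \<ge> N" for n
      using PR.level_pow_cong[OF y N teichmueller_cong[OF prime that]] by simp
    then show ?thesis unfolding eventually_sequentially by blast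
  qed
  have y0: "y 0 = \<one>\<^bsub>PR.G\<^esub>"
  proof (rule PR.tends_unique[OF y_tends])
    show "PR.tends (\<lambda>n. x [^]\<^bsub>PR.G\<^esub> ((0::nat) ^ p ^ n)) \<one>\<^bsub>PR.G\<^esub>"
      using p_pos by (simp add: PR.tends_const zero_power)
  qed (use alg_homD(3)[OF y] alg_homD(3)[OF PR.one_alg_hom] in \<open>simp_all add: PR.G_one\<close>)
  define good where "good h X \<longleftrightarrow> X \<in> carrier E \<and> A.\<sigma> 0 X = counit H h \<odot>\<^bsub>E\<^esub> \<one>\<^bsub>E\<^esub> \<and> (\<forall>z\<in>{1..<p}. \<pi> z X = y z h)" for h X
  have counit: "counit H h \<in> carrier K" if "h \<in> carrier H" for h
    using ring_hom_closed[OF PR.H.counit_hom that] .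
  have ex: "\<exists>X. good h X" if h: "h \<in> carrier H" for h
  proof -
    obtain X where "X \<in> carrier E" "A.\<sigma> 0 X = counit H h \<odot>\<^bsub>E\<^esub> \<one>\<^bsub>E\<^esub>" "\<And>z. z \<in> {1..<p} \<Longrightarrow> \<pi> z X = y z h"
      by (rule E_ex[OF counit[OF h] alg_homD(4)[OF y h]]) (rule that)
    then show ?thesis unfolding good_def by (intro exI[of _ X] conjI ballI)
  qed
  have uniq: "X = Y" if "good h X" "good h Y" for h X Y
    by (rule E_eqI) (use that in \<open>simp_all add: good_def\<close>)
  define f where "f = (\<lambda>h\<in>carrier H. SOME X. good h X)"
  have good: "good h (f h)" if "h \<in> carrier H" for h
    using someI_ex[OF ex[OF that]] that by (simp add: f_def)
  note one = alg_homD[OF PE.one_alg_hom]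
  have fI: "f h = X" if "good h X" "h \<in> carrier H" for h X
    using uniq[OF good[OF that(2)] that(1)] .
  \<comment> \<open>The three conditions in \<open>good\<close> are preserved by the algebra
    operations, because \<open>\<sigma> 0\<close>, the \<open>\<pi> z\<close>, the y z and the unit
    point are algebra homomorphisms; so each operation on values of f is good for the corresponding
    element of \<open>H\<close>.\<close>
  have fc: "f \<in> alg_hom K H E"
  proof (rule alg_homI)
    show "f \<in> extensional (carrier H)" by (simp add: f_def)
    show fE: "f h \<in> carrier E" if "h \<in> carrier H" for h using good[OF that] by (simp add: good_def)
    show "f (h \<otimes>\<^bsub>H\<^esub> h') = f h \<otimes>\<^bsub>E\<^esub> f h'" if "h \<in> carrier H" "h' \<in> carrier H" for h h'
      using good[OF that(1)] good[OF that(2)] one(5)[OF that] that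
      by (intro fI) (auto simp: good_def alg_homD[OF A.\<sigma>_hom] alg_homD[OF \<pi>_hom] alg_homD[OF y])
    show "f (h \<oplus>\<^bsub>H\<^esub> h') = f h \<oplus>\<^bsub>E\<^esub> f h'" if "h \<in> carrier H" "h' \<in> carrier H" for h h'
      using good[OF that(1)] good[OF that(2)] one(6)[OF that] that
      by (intro fI) (auto simp: good_def alg_homD[OF A.\<sigma>_hom] alg_homD[OF \<pi>_hom] alg_homD[OF y])
    show "f (a \<odot>\<^bsub>H\<^esub> h) = a \<odot>\<^bsub>E\<^esub> f h" if "a \<in> carrier K" "h \<in> carrier H" for a h
      using good[OF that(2)] one(7)[OF that] that
      by (intro fI) (auto simp: good_def alg_homD[OF A.\<sigma>_hom] alg_homD[OF \<pi>_hom] alg_homD[OF y])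
    show "f \<one>\<^bsub>H\<^esub> = \<one>\<^bsub>E\<^esub>"
      using one(8) by (intro fI) (auto simp: good_def alg_homD[OF A.\<sigma>_hom] alg_homD[OF \<pi>_hom] alg_homD[OF y])
  qed
  \<comment> \<open>\<open>good\<close> speaks only of z from 1 to p - 1. The eigenspace condition
    leads to indices w z, which are arbitrary; multiples of p are handled through
    \<open>\<sigma> 0\<close>.\<close>
  have \<pi>_f: "\<pi> z (f h) = y z h" if h: "h \<in> carrier H" for z h
  proof -
    have "\<pi> (z mod p) (f h) = y (z mod p) h"
    proof (cases "z mod p = 0")
      case True
      have "\<pi> 0 (f h) = \<pi> 1 (A.\<sigma> 0 (f h))" using \<pi>_\<sigma>[of "f h" 1 0] alg_homD(4)[OF fc h] by simp
      also have "\<dots> = counit H h \<odot>\<^bsub>R\<^esub> \<one>\<^bsub>R\<^esub>"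
        using good[OF h] counit[OF h] by (simp add: good_def alg_homD[OF \<pi>_hom])
      finally show ?thesis using True h by (simp add: y0 PR.G_one)
    next
      case False
      then have "z mod p \<in> {1..<p}" using p_pos by simp
      then show ?thesis using good[OF h] by (simp add: good_def)
    qed
    then show ?thesis using \<pi>_cong[of "z mod p" z] y_cong[of "z mod p" z h] h by (simp add: cong_def)
  qed
  have map_\<pi>: "points_map H (\<pi> z) f = y z" for z
    using y[of z] by (intro extensionalityI[of _ "carrier H"]) (simp_all add: \<pi>_f alg_homD points_map_def compose_eq)
  have map_\<sigma>: "points_map H (A.\<sigma> 0) f = \<one>\<^bsub>PE.G\<^esub>"
    using good by (intro extensionalityI[of _ "carrier H"]) (simp_all add: good_def points_map_def compose_eq PE.G_one)
  have "f \<in> carrier (polar_points K p H (pol p R))"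
    unfolding polar_points_def teich_points_simps
  proof (intro conjI allI ballI fc)
    fix z h assume h: "h \<in> carrier H"
    note fE = alg_homD(4)[OF fc h]
    \<comment> \<open>There are finitely many components w, so the same n serves all of them and
      \<open>E_eqI\<close> can be applied.\<close>
    have "\<forall>\<^sub>F n in sequentially. \<forall>w\<in>{1..<p}. y (w * z) h = (y w [^]\<^bsub>PR.G\<^esub> (z ^ p ^ n)) h"
      by (intro eventually_ball_finite y_pow h ballI) simp
    then show "\<forall>\<^sub>F n in sequentially. A.\<sigma> z (f h) = (f [^]\<^bsub>PE.G\<^esub> (z ^ p ^ n)) h"
    proof eventually_elim
      case (elim n)
      have fn: "f [^]\<^bsub>PE.G\<^esub> (z ^ p ^ n) \<in> alg_hom K H E" using fc by simp
      show ?case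
      proof (rule E_eqI)
        show "A.\<sigma> z (f h) \<in> carrier E" by (rule alg_homD(4)[OF A.\<sigma>_hom fE])
        show "(f [^]\<^bsub>PE.G\<^esub> (z ^ p ^ n)) h \<in> carrier E" by (rule alg_homD(4)[OF fn h])
        have "A.\<sigma> 0 ((f [^]\<^bsub>PE.G\<^esub> (z ^ p ^ n)) h) = (points_map H (A.\<sigma> 0) f [^]\<^bsub>PE.G\<^esub> (z ^ p ^ n)) h"
          using points_map_pow[OF hopf A.algebra_E A.algebra_E A.\<sigma>_hom fc, of 0 "z ^ p ^ n"] h
          by (metis points_map_apply)
        also have "\<dots> = counit H h \<odot>\<^bsub>E\<^esub> \<one>\<^bsub>E\<^esub>"
          unfolding map_\<sigma> PE.G.nat_pow_one using h by (simp add: PE.G_one)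
        finally show "A.\<sigma> 0 (A.\<sigma> z (f h)) = A.\<sigma> 0 ((f [^]\<^bsub>PE.G\<^esub> (z ^ p ^ n)) h)"
          using good[OF h] by (simp add: A.\<sigma>_comp[OF fE] good_def)
        fix w assume "w \<in> {1..<p}"
        then show "\<pi> w (A.\<sigma> z (f h)) = \<pi> w ((f [^]\<^bsub>PE.G\<^esub> (z ^ p ^ n)) h)"
          using elim by (simp add: \<pi>_\<sigma>[OF fE] \<pi>_f[OF h] map_\<pi>_pow[OF fc h] map_\<pi>)
      qed
    qed
  qed
  moreover have "points_map H (\<pi> 1) f = x"
    unfolding map_\<pi>
  proof (rule PR.tends_unique[OF y_tends])
    have "x [^]\<^bsub>PR.G\<^esub> ((1::nat) ^ p ^ n) = x" for n
      using PR.G.nat_pow_eone[of x] x by simp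
    then show "PR.tends (\<lambda>n. x [^]\<^bsub>PR.G\<^esub> ((1::nat) ^ p ^ n)) x" by (simp only: PR.tends_const)
  qed (rule alg_homD(3)[OF y], rule alg_homD(3)[OF x])
  ultimately show ?thesis by blast
qed

lemma theta_iso: "points_map H (\<pi> 1) \<in> iso (polar_points K p H (pol p R)) PR.G"
proof (rule isoI)
  let ?P = "polar_points K p H (pol p R)"
  note hom = points_map_hom[OF hopf A.algebra_E R.algebra_axioms \<pi>_hom]
  have sub: "carrier ?P \<subseteq> carrier PE.G" and mult: "mult ?P = mult PE.G"
    by (auto simp: polar_points_def)
  show "points_map H (\<pi> 1) \<in> hom ?P PR.G"
    using hom sub mult by (auto simp: hom_def subset_iff Pi_iff simp del: PE.G_simps PR.G_simps)
  show "bij_betw (points_map H (\<pi> 1)) (carrier ?P) (carrier PR.G)"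
    unfolding bij_betw_def
  proof (intro conjI theta_inj subset_antisym subsetI)
    fix x assume "x \<in> carrier PR.G"
    then show "x \<in> points_map H (\<pi> 1) ` carrier ?P" using theta_surj by force
  qed (use hom_in_carrier[OF hom] sub in blast)
qed

end

section \<open>Functors to abelian groups\<close>

text \<open>Moves a group along an injection c into another type. The points of the envelope live in
  a type containing \<open>'k\<close>, the required values in \<open>polar_point\<close>.\<close>

definition transport :: "('g, 'z) monoid_scheme \<Rightarrow> ('g \<Rightarrow> 'h) \<Rightarrow> 'h monoid" where
  "transport G c =
     \<lparr>carrier = c ` carrier G,
      mult = (\<lambda>x y. c (inv_into (carrier G) c x \<otimes>\<^bsub>G\<^esub> inv_into (carrier G) c y)),
      one = c \<one>\<^bsub>G\<^esub>\<rparr>"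

lemma transport_iso:
  assumes "inj_on c (carrier G)"
  shows "c \<in> iso G (transport G c)"
  using assms by (intro isoI homI) (auto simp: transport_def inj_on_imp_bij_betw)

lemma transport_comm_group:
  assumes "comm_group G" "inj_on c (carrier G)"
  shows "comm_group (transport G c)"
proof -
  interpret G: comm_group G by fact
  have inv: "inv_into (carrier G) c (c x) = x" if "x \<in> carrier G" for x
    using assms(2) that by simp
  show ?thesis
    by (rule comm_groupI)
      (auto simp: transport_def inv G.m_ac intro!: bexI[of _ "inv\<^bsub>G\<^esub> x" for x])
qed

section \<open>Formal operations on functors and natural isomorphisms\<close>

lemma ab_functorD:
  assumes "ab_functor Ob Hom F Fm"
  shows "A \<in> Ob \<Longrightarrow> comm_group (F A)"
    and "\<lbrakk>A \<in> Ob; B \<in> Ob; f \<in> Hom A B\<rbrakk> \<Longrightarrow> Fm A B f \<in> hom (F A) (F B)"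
    and "\<lbrakk>A \<in> Ob; x \<in> carrier (F A)\<rbrakk> \<Longrightarrow> Fm A A (\<lambda>y\<in>carrier A. y) x = x"
    and "\<lbrakk>A \<in> Ob; B \<in> Ob; C \<in> Ob; f \<in> Hom A B; g \<in> Hom B C; x \<in> carrier (F A)\<rbrakk> \<Longrightarrow>
      Fm A C (compose (carrier A) g f) x = Fm B C g (Fm A B f x)"
  using assms unfolding ab_functor_def by blast+

lemma ab_nat_transD:
  assumes "ab_nat_trans Ob Hom F Fm F' Fm' \<eta>"
  shows "ab_functor Ob Hom F Fm" "ab_functor Ob Hom F' Fm'"
    and "A \<in> Ob \<Longrightarrow> \<eta> A \<in> hom (F A) (F' A)"
    and "\<lbrakk>A \<in> Ob; B \<in> Ob; f \<in> Hom A B; x \<in> carrier (F A)\<rbrakk> \<Longrightarrow> \<eta> B (Fm A B f x) = Fm' A B f (\<eta> A x)"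
  using assms unfolding ab_nat_trans_def by blast+

lemma ab_nat_isoD:
  assumes "ab_nat_iso Ob Hom F Fm F' Fm' \<eta>"
  shows "ab_nat_trans Ob Hom F Fm F' Fm' \<eta>" "A \<in> Ob \<Longrightarrow> \<eta> A \<in> iso (F A) (F' A)"
  using assms unfolding ab_nat_iso_def by blast+

lemma ab_nat_trans_comp:
  assumes "ab_nat_trans Ob Hom F Fm F' Fm' \<eta>" "ab_nat_trans Ob Hom F' Fm' F'' Fm'' \<theta>"
  shows "ab_nat_trans Ob Hom F Fm F'' Fm'' (\<lambda>A x. \<theta> A (\<eta> A x))"
  unfolding ab_nat_trans_def
proof (intro conjI ballI)
  note a = ab_nat_transD[OF assms(1)] and b = ab_nat_transD[OF assms(2)]
  show "ab_functor Ob Hom F Fm" "ab_functor Ob Hom F'' Fm''" by (rule a, rule b)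
  show "(\<lambda>x. \<theta> A (\<eta> A x)) \<in> hom (F A) (F'' A)" if "A \<in> Ob" for A
    using a(3)[OF that] b(3)[OF that] by (auto simp: hom_def Pi_iff)
  fix A B f x assume "A \<in> Ob" "B \<in> Ob" "f \<in> Hom A B" "x \<in> carrier (F A)"
  then show "\<theta> B (\<eta> B (Fm A B f x)) = Fm'' A B f (\<theta> A (\<eta> A x))"
    using a(4) b(4) hom_in_carrier[OF a(3)] by metis
qed

lemma ab_nat_iso_comp:
  assumes "ab_nat_iso Ob Hom F Fm F' Fm' \<eta>" "ab_nat_iso Ob Hom F' Fm' F'' Fm'' \<theta>"
  shows "ab_nat_iso Ob Hom F Fm F'' Fm'' (\<lambda>A x. \<theta> A (\<eta> A x))"
  using ab_nat_trans_comp[OF ab_nat_isoD(1)[OF assms(1)] ab_nat_isoD(1)[OF assms(2)]]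
    iso_set_trans[OF ab_nat_isoD(2)[OF assms(1)] ab_nat_isoD(2)[OF assms(2)]]
  by (simp add: ab_nat_iso_def comp_def)

lemma ab_nat_iso_inverse:
  assumes "ab_nat_iso Ob Hom F Fm F' Fm' \<eta>"
  shows "ab_nat_iso Ob Hom F' Fm' F Fm (\<lambda>A. inv_into (carrier (F A)) (\<eta> A))"
  unfolding ab_nat_iso_def ab_nat_trans_def
proof (intro conjI ballI)
  note t = ab_nat_transD[OF ab_nat_isoD(1)[OF assms]] and i = ab_nat_isoD(2)[OF assms]
  show "ab_functor Ob Hom F' Fm'" "ab_functor Ob Hom F Fm" by (rule t)+
  have bij: "bij_betw (\<eta> A) (carrier (F A)) (carrier (F' A))" if "A \<in> Ob" for A
    using i[OF that] by (simp add: iso_def)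
  show inv: "inv_into (carrier (F A)) (\<eta> A) \<in> iso (F' A) (F A)" if "A \<in> Ob" for A
    using group.iso_set_sym[OF comm_group.axioms(2)[OF ab_functorD(1)[OF t(1) that]] i[OF that]] .
  then show "inv_into (carrier (F A)) (\<eta> A) \<in> hom (F' A) (F A)" if "A \<in> Ob" for A
    using that by (simp add: iso_def)
  fix A B f x assume A: "A \<in> Ob" and B: "B \<in> Ob" and f: "f \<in> Hom A B" and x: "x \<in> carrier (F' A)"
  define y where "y = inv_into (carrier (F A)) (\<eta> A) x"
  have y: "y \<in> carrier (F A)" "\<eta> A y = x"
    using bij_betw_inv_into_right[OF bij[OF A] x] x bij[OF A]
    by (auto simp: y_def bij_betw_def intro: inv_into_into)
  have "\<eta> B (Fm A B f y) = Fm' A B f x" using t(4)[OF A B f y(1)] y(2) by simp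
  moreover have "Fm A B f y \<in> carrier (F B)"
    using hom_in_carrier[OF ab_functorD(2)[OF t(1) A B f] y(1)] .
  ultimately show "inv_into (carrier (F B)) (\<eta> B) (Fm' A B f x) = Fm A B f (inv_into (carrier (F A)) (\<eta> A) x)"
    using bij_betw_inv_into_left[OF bij[OF B]] by (metis y_def)
qed

lemma ab_nat_iso_transport:
  assumes F: "ab_functor Ob Hom F Fm" and inj: "\<And>A. A \<in> Ob \<Longrightarrow> inj_on (c A) (carrier (F A))"
  defines "Fm' \<equiv> \<lambda>A B f x. c B (Fm A B f (inv_into (carrier (F A)) (c A) x))"
  shows "ab_nat_iso Ob Hom F Fm (\<lambda>A. transport (F A) (c A)) Fm' c"
proof -
  have iso: "c A \<in> iso (F A) (transport (F A) (c A))" if "A \<in> Ob" for A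
    by (rule transport_iso[OF inj[OF that]])
  have inv: "inv_into (carrier (F A)) (c A) (c A x) = x" if "A \<in> Ob" "x \<in> carrier (F A)" for A x
    using inj that by simp
  have Fm': "Fm' A B f (c A x) = c B (Fm A B f x)" if "A \<in> Ob" "x \<in> carrier (F A)" for A B f x
    using that by (simp add: Fm'_def inv)
  have car: "carrier (transport (F A) (c A)) = c A ` carrier (F A)" for A by (simp add: transport_def)
  have mult: "c A x \<otimes>\<^bsub>transport (F A) (c A)\<^esub> c A y = c A (x \<otimes>\<^bsub>F A\<^esub> y)"
    if "A \<in> Ob" "x \<in> carrier (F A)" "y \<in> carrier (F A)" for A x y
    using that by (simp add: transport_def inv)
  note FD = ab_functorD[OF F]
  have "ab_functor Ob Hom (\<lambda>A. transport (F A) (c A)) Fm'"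
    unfolding ab_functor_def car
  proof (intro conjI ballI)
    show "comm_group (transport (F A) (c A))" if "A \<in> Ob" for A
      by (rule transport_comm_group[OF FD(1)[OF that] inj[OF that]])
    show "Fm' A B f \<in> hom (transport (F A) (c A)) (transport (F B) (c B))"
      if "A \<in> Ob" "B \<in> Ob" "f \<in> Hom A B" for A B f
    proof (rule homI; unfold car; elim imageE; clarify)
      note h = FD(2)[OF that]
      interpret FA: comm_group "F A" by (rule FD(1)[OF that(1)])
      fix x assume x: "x \<in> carrier (F A)"
      show "Fm' A B f (c A x) \<in> c B ` carrier (F B)"
        using x hom_in_carrier[OF h x] that by (simp add: Fm')
      fix y assume y: "y \<in> carrier (F A)"
      show "Fm' A B f (c A x \<otimes>\<^bsub>transport (F A) (c A)\<^esub> c A y) =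
        Fm' A B f (c A x) \<otimes>\<^bsub>transport (F B) (c B)\<^esub> Fm' A B f (c A y)"
        using x y hom_in_carrier[OF h x] hom_in_carrier[OF h y] that
        by (simp add: Fm' mult hom_mult[OF h])
    qed
    show "Fm' A A (\<lambda>y\<in>carrier A. y) x = x" if "A \<in> Ob" "x \<in> c A ` carrier (F A)" for A x
      using that by (auto simp: Fm' FD(3))
    show "Fm' A C (compose (carrier A) g f) x = Fm' B C g (Fm' A B f x)"
      if "A \<in> Ob" "B \<in> Ob" "C \<in> Ob" "f \<in> Hom A B" "g \<in> Hom B C" "x \<in> c A ` carrier (F A)" for A B C f g x
      using that hom_in_carrier[OF FD(2)[OF that(1,2,4)]] by (auto simp: Fm' FD(4))
  qed
  then show ?thesis
    using F iso by (auto simp: ab_nat_iso_def ab_nat_trans_def Fm' iso_imp_homomorphism)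
qed

text \<open>Meant for P = \<open>pol p\<close>, which changes neither carriers nor underlying
  functions; identities and \<open>compose\<close> therefore carry over literally.\<close>

lemma ab_functor_precomp:
  assumes F: "ab_functor Ob Hom F Fm"
    and P: "\<And>A. A \<in> Ob' \<Longrightarrow> P A \<in> Ob" "\<And>A. A \<in> Ob' \<Longrightarrow> carrier (P A) = carrier A"
      "\<And>A B f. \<lbrakk>A \<in> Ob'; B \<in> Ob'; f \<in> Hom' A B\<rbrakk> \<Longrightarrow> f \<in> Hom (P A) (P B)"
  shows "ab_functor Ob' Hom' (\<lambda>A. F (P A)) (\<lambda>A B. Fm (P A) (P B))"
  unfolding ab_functor_def
proof (intro conjI ballI)
  note FD = ab_functorD[OF F]
  show "comm_group (F (P A))" if "A \<in> Ob'" for A using FD(1) P(1) that .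
  show "Fm (P A) (P B) f \<in> hom (F (P A)) (F (P B))" if "A \<in> Ob'" "B \<in> Ob'" "f \<in> Hom' A B" for A B f
    using that by (intro FD(2) P)
  show "Fm (P A) (P A) (\<lambda>y\<in>carrier A. y) x = x" if "A \<in> Ob'" "x \<in> carrier (F (P A))" for A x
    using FD(3)[OF P(1)[OF that(1)] that(2)] by (simp add: P(2)[OF that(1)])
  show "Fm (P A) (P C) (compose (carrier A) g f) x = Fm (P B) (P C) g (Fm (P A) (P B) f x)"
    if "A \<in> Ob'" "B \<in> Ob'" "C \<in> Ob'" "f \<in> Hom' A B" "g \<in> Hom' B C" "x \<in> carrier (F (P A))" for A B C f g x
    using FD(4)[OF P(1)[OF that(1)] P(1)[OF that(2)] P(1)[OF that(3)] P(3)[OF that(1,2,4)] P(3)[OF that(2,3,5)] that(6)]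
    by (simp add: P(2)[OF that(1)])
qed


section \<open>The functor on polar algebras\<close>

text \<open>The constant term of \<open>f h\<close> is \<open>counit H h\<close> by the condition for \<open>z = 0\<close>, so that the monomials
  of positive length, whose coefficients can be absorbed in the factors, suffice to encode \<open>f\<close>.\<close>

definition (in polar_algebra) encode ::
    "('k, 'h) hopf \<Rightarrow> ('h \<Rightarrow> ('k, 'a) pexpr set) \<Rightarrow> ('h, 'a) polar_point" where
  "encode H f h = {tss \<in> mon_lists. f h = counit H h \<odot>\<^bsub>E\<^esub> \<one>\<^bsub>E\<^esub> \<oplus>\<^bsub>E\<^esub> mon_sum tss}"

text \<open>The constant part of a normal form of \<open>f h\<close> must be
  \<open>counit H h\<close>, so \<open>encode H f h\<close> is nonempty, and any one of its members
  recovers \<open>f h\<close>.\<close>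

lemma encode_inj:
  assumes A: "polar_char_p K p A" and H: "bicommutative_hopf_algebra K H"
  shows "inj_on (polar_algebra.encode K p A H) (carrier (polar_points K p H A))"
proof (rule inj_onI)
  interpret A: polar_char_p K p A by fact
  interpret H: bicommutative_hopf_algebra K H by fact
  fix f g assume f: "f \<in> carrier (polar_points K p H A)" and g: "g \<in> carrier (polar_points K p H A)"
    and eq: "A.encode H f = A.encode H g"
  have fc: "f \<in> alg_hom K H A.E" and gc: "g \<in> alg_hom K H A.E" using f g by (simp_all add: polar_points_def)
  show "f = g"
  proof (rule extensionalityI[OF alg_homD(3)[OF fc] alg_homD(3)[OF gc]])
    fix h assume h: "h \<in> carrier H"
    obtain a tss where a: "a \<in> carrier K" "tss \<in> A.mon_lists" "f h = a \<odot>\<^bsub>A.E\<^esub> \<one>\<^bsub>A.E\<^esub> \<oplus>\<^bsub>A.E\<^esub> A.mon_sum tss"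
      using alg_homD(4)[OF fc h] by (rule A.normal_form)
    have "a \<odot>\<^bsub>A.E\<^esub> \<one>\<^bsub>A.E\<^esub> = counit H h \<odot>\<^bsub>A.E\<^esub> \<one>\<^bsub>A.E\<^esub>"
      using polar_points_counit[OF A H f h] a by (simp add: A.\<sigma>_0)
    then have tss: "tss \<in> A.encode H f h" using a by (simp add: A.encode_def)
    then have "tss \<in> A.encode H g h" by (simp add: eq)
    with tss show "f h = g h" by (simp add: A.encode_def)
  qed
qed

section \<open>Functoriality in the polar algebra, in the algebra and in the group scheme\<close>

context char_p
begin

lemma Pol_iff: "A \<in> Pol K p \<longleftrightarrow> polar_char_p K p A"
  by (simp add: Pol_def polar_char_p_def char_p_axioms)

lemma polar_points_functor:
  assumes H: "H \<in> AbSch_padic K p"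
  shows "ab_functor (Pol K p :: ('k, 'a) polar set) (polar_hom K p) (polar_points K p H) (\<lambda>A B \<alpha>. points_map H (env_map K p A B \<alpha>))"
  unfolding ab_functor_def Pol_iff[abs_def]
proof (intro conjI ballI; unfold Pol_iff)
  have hopf: "bicommutative_hopf_algebra K H" using H by (simp add: AbSch_padic_def)
  fix A :: "('k, 'a) polar" assume A: "polar_char_p K p A"
  interpret A: polar_char_p K p A by fact
  interpret PA: padic_points K H A.E p
    by (intro padic_points.intro hopf_points.intro padic_points_axioms.intro hopf A.algebra_E prime H)
  have sub: "f \<in> alg_hom K H A.E" if "f \<in> carrier (polar_points K p H A)" for f
    using that by (simp add: polar_points_def)
  show "comm_group (polar_points K p H A)"
    unfolding polar_points_def by (rule PA.teich_comm_group[OF A.\<sigma>_hom])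
  show "points_map H (env_map K p A A (\<lambda>y\<in>carrier A. y)) x = x" if "x \<in> carrier (polar_points K p H A)" for x
    using sub[OF that] by (intro extensionalityI[of _ "carrier H"])
      (simp_all add: alg_homD env_map_id[OF A] points_map_def compose_eq)
  fix B :: "('k, 'a) polar" and \<alpha> assume B: "polar_char_p K p B" and \<alpha>: "\<alpha> \<in> polar_hom K p A B"
  interpret B: polar_char_p K p B by fact
  show "points_map H (env_map K p A B \<alpha>) \<in> hom (polar_points K p H A) (polar_points K p H B)"
    unfolding polar_points_def
    by (intro teich_points_map_hom hopf A.algebra_E B.algebra_E env_map_hom[OF A B \<alpha>] env_map_scale[OF A B \<alpha>])
  fix C :: "('k, 'a) polar" and \<beta> x assume C: "polar_char_p K p C" and \<beta>: "\<beta> \<in> polar_hom K p B C"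
    and x: "x \<in> carrier (polar_points K p H A)"
  show "points_map H (env_map K p A C (compose (carrier A) \<beta> \<alpha>)) x =
    points_map H (env_map K p B C \<beta>) (points_map H (env_map K p A B \<alpha>) x)"
    using alg_homD(4)[OF sub[OF x]] by (intro extensionalityI[of _ "carrier H"])
      (simp_all add: points_map_def compose_eq env_map_compose[OF A B C \<alpha> \<beta>])
qed

lemma points_functor:
  assumes H: "H \<in> AbSch_padic K p"
  shows "ab_functor (Alg K :: ('k, 'a) module set) (alg_hom K) (points K H) (\<lambda>R S. points_map H)"
  unfolding ab_functor_def
proof (intro conjI ballI)
  have hopf: "bicommutative_hopf_algebra K H" using H by (simp add: AbSch_padic_def)
  fix R :: "('k, 'a) module" assume "R \<in> Alg K"
  then have R: "algebra K R" by (simp add: Alg_def)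
  interpret PR: padic_points K H R p
    by (intro padic_points.intro hopf_points.intro padic_points_axioms.intro hopf R prime H)
  show "comm_group (points K H R)" by (rule PR.comm_group_G)
  show "points_map H (\<lambda>y\<in>carrier R. y) x = x" if "x \<in> carrier (points K H R)" for x
    using that by (intro extensionalityI[of _ "carrier H"]) (simp_all add: alg_homD points_map_def compose_eq)
  fix S :: "('k, 'a) module" and u assume "S \<in> Alg K" and u: "u \<in> alg_hom K R S"
  then have S: "algebra K S" by (simp add: Alg_def)
  show "points_map H u \<in> hom (points K H R) (points K H S)" by (rule points_map_hom[OF hopf R S u])
  fix T :: "('k, 'a) module" and v x assume "v \<in> alg_hom K S T" "x \<in> carrier (points K H R)"
  then show "points_map H (compose (carrier R) v u) x = points_map H v (points_map H u x)"
    by (intro extensionalityI[of _ "carrier H"]) (simp_all add: points_map_def compose_eq alg_homD(4))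
qed

lemma pol_in_Pol: "R \<in> Alg K \<Longrightarrow> pol p R \<in> Pol K p"
  using polar_algebra_pol prime_gt_0_nat[OF prime] by (auto simp: Alg_def Pol_def)

lemma pol_points_intro: "\<lbrakk>R \<in> Alg K; H \<in> AbSch_padic K p\<rbrakk> \<Longrightarrow> pol_points K p R H"
  by (simp add: pol_points_def pol_points_axioms_def pol_envelope_def char_p_axioms Alg_def)

lemma theta_nat_iso:
  assumes H: "H \<in> AbSch_padic K p"
  shows "ab_nat_iso (Alg K :: ('k, 'a) module set) (alg_hom K)
    (\<lambda>R. polar_points K p H (pol p R)) (\<lambda>R S u. points_map H (env_map K p (pol p R) (pol p S) u))
    (points K H) (\<lambda>R S. points_map H)
    (\<lambda>R. points_map H (pol_envelope.\<pi> K p R 1))"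
  unfolding ab_nat_iso_def ab_nat_trans_def
proof (intro conjI ballI)
  show "ab_functor (Alg K) (alg_hom K) (points K H) (\<lambda>R S. points_map H)" by (rule points_functor[OF H])
  show "ab_functor (Alg K) (alg_hom K)
    (\<lambda>R. polar_points K p H (pol p R)) (\<lambda>R S u. points_map H (env_map K p (pol p R) (pol p S) u))"
    by (rule ab_functor_precomp[OF polar_points_functor[OF H] pol_in_Pol])
      (auto simp: Alg_def alg_hom_polar_hom)
  fix R :: "('k, 'a) module" assume R: "R \<in> Alg K"
  interpret R: pol_points K p R H by (rule pol_points_intro[OF R H])
  show iso: "points_map H (R.\<pi> 1) \<in> iso (polar_points K p H (pol p R)) (points K H R)"
    by (rule R.theta_iso)
  then show "points_map H (R.\<pi> 1) \<in> hom (polar_points K p H (pol p R)) (points K H R)"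
    by (rule iso_imp_homomorphism)
  fix S :: "('k, 'a) module" and u x assume S: "S \<in> Alg K" and u: "u \<in> alg_hom K R S"
    and x: "x \<in> carrier (polar_points K p H (pol p R))"
  interpret S: pol_points K p S H by (rule pol_points_intro[OF S H])
  note u' = alg_hom_polar_hom[OF R.R.algebra_axioms u, of p]
  note em = env_map_hom[OF R.A.polar_char_p_axioms S.A.polar_char_p_axioms u']
  \<comment> \<open>Naturality in \<open>R\<close> reduces to the generators: both composites send
    \<open>gen x\<close> to u x, since the scaling factor at index 1 is 1.\<close>
  have comp: "compose (carrier R.E) (S.\<pi> 1) (env_map K p (pol p R) (pol p S) u) = compose (carrier R.E) u (R.\<pi> 1)"
    by (rule R.A.alg_hom_E_eqI[OF alg_hom_compose[OF R.A.algebra_E em S.\<pi>_hom]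
          alg_hom_compose[OF R.A.algebra_E R.\<pi>_hom u]])
      (simp add: compose_eq env_map_gen[OF R.A.polar_char_p_axioms S.A.polar_char_p_axioms u']
        R.\<pi>_gen S.\<pi>_gen alg_homD[OF u])
  have eq: "S.\<pi> 1 (env_map K p (pol p R) (pol p S) u X) = u (R.\<pi> 1 X)" if "X \<in> carrier R.E" for X
    using fun_cong[OF comp, of X] that by (simp add: compose_eq)
  have "x \<in> alg_hom K H R.E" using x by (simp add: polar_points_def)
  then show "points_map H (S.\<pi> 1) (points_map H (env_map K p (pol p R) (pol p S) u) x) =
    points_map H u (points_map H (R.\<pi> 1) x)"
    by (intro extensionalityI[of _ "carrier H"]) (simp_all add: points_map_def compose_eq eq[simplified] alg_homD(4))
qed

lemma pullback_nat_trans: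
  assumes H: "H \<in> AbSch_padic K p" and H': "H' \<in> AbSch_padic K p" and \<phi>: "\<phi> \<in> hopf_hom K H' H"
  shows "ab_nat_trans (Pol K p :: ('k, 'a) polar set) (polar_hom K p)
    (polar_points K p H) (\<lambda>A B \<alpha>. points_map H (env_map K p A B \<alpha>))
    (polar_points K p H') (\<lambda>A B \<alpha>. points_map H' (env_map K p A B \<alpha>))
    (\<lambda>A f. compose (carrier H') f \<phi>)"
  unfolding ab_nat_trans_def
proof (intro conjI ballI polar_points_functor H H')
  have hopf: "bicommutative_hopf_algebra K H" "bicommutative_hopf_algebra K H'"
    using H H' by (simp_all add: AbSch_padic_def)
  have \<phi>1: "\<phi> \<in> alg_hom K H' H" using \<phi> by (simp add: hopf_hom_def)
  fix A :: "('k, 'a) polar" assume "A \<in> Pol K p"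
  then interpret A: polar_char_p K p A by (simp add: Pol_iff)
  show "(\<lambda>f. compose (carrier H') f \<phi>) \<in> hom (polar_points K p H A) (polar_points K p H' A)"
    unfolding polar_points_def by (rule teich_pullback_hom[OF hopf A.algebra_E \<phi>])
  fix B :: "('k, 'a) polar" and \<alpha> f assume "f \<in> carrier (polar_points K p H A)"
  then show "compose (carrier H') (points_map H (env_map K p A B \<alpha>) f) \<phi> =
    points_map H' (env_map K p A B \<alpha>) (compose (carrier H') f \<phi>)"
    by (intro extensionalityI[of _ "carrier H'"]) (simp_all add: points_map_def compose_eq alg_homD(4)[OF \<phi>1])
qed

end

lemma char_p_perfect_field:
  assumes "perfect_field_of_char K p"
  shows "char_p K p"
proof -
  have "field K" "prime p" "has_characteristic K p" using assms by (simp_all add: perfect_field_of_char_def)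
  then show ?thesis
    by (auto simp: char_p_def char_p_axioms_def nat_in_def has_characteristic_def fieldE(1))
qed

theorem theorem1:
  fixes K :: "('k, 'r) ring_scheme" and p :: nat
  assumes "perfect_field_of_char K p"
  shows "\<exists>(Gt :: ('k, 'h) hopf \<Rightarrow> ('k, 'a) polar \<Rightarrow> ('h, 'a) polar_point monoid) Gtm \<tau> \<eta>.
    (\<forall>H \<in> AbSch_padic K p. ab_functor (Pol K p) (polar_hom K p) (Gt H) (Gtm H)) \<and>
    (\<forall>H \<in> AbSch_padic K p. \<forall>H' \<in> AbSch_padic K p. \<forall>\<phi> \<in> hopf_hom K H' H.
       ab_nat_trans (Pol K p) (polar_hom K p) (Gt H) (Gtm H) (Gt H') (Gtm H') (\<tau> H H' \<phi>)) \<and>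
    (\<forall>H \<in> AbSch_padic K p. \<forall>A \<in> Pol K p. \<forall>x \<in> carrier (Gt H A).
       \<tau> H H (\<lambda>h\<in>carrier H. h) A x = x) \<and>
    (\<forall>H \<in> AbSch_padic K p. \<forall>H' \<in> AbSch_padic K p. \<forall>H'' \<in> AbSch_padic K p.
     \<forall>\<phi> \<in> hopf_hom K H' H. \<forall>\<psi> \<in> hopf_hom K H'' H'. \<forall>A \<in> Pol K p. \<forall>x \<in> carrier (Gt H A).
       \<tau> H H'' (compose (carrier H'') \<phi> \<psi>) A x = \<tau> H' H'' \<psi> A (\<tau> H H' \<phi> A x)) \<and>
    (\<forall>H \<in> AbSch_padic K p.
       ab_nat_iso (Alg K) (alg_hom K)
         (points K H) (\<lambda>R S. points_map H)
         (\<lambda>R. Gt H (pol p R)) (\<lambda>R S. Gtm H (pol p R) (pol p S))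
         (\<eta> H)) \<and>
    (\<forall>H \<in> AbSch_padic K p. \<forall>H' \<in> AbSch_padic K p. \<forall>\<phi> \<in> hopf_hom K H' H.
     \<forall>R \<in> Alg K. \<forall>x \<in> carrier (points K H R).
       \<eta> H' R (compose (carrier H') x \<phi>) = \<tau> H H' \<phi> (pol p R) (\<eta> H R x))"
proof -
  interpret char_p K p by (rule char_p_perfect_field[OF assms])
  define F :: "('k, 'h) hopf \<Rightarrow> ('k, 'a) polar \<Rightarrow> ('h \<Rightarrow> ('k, 'a) pexpr set) monoid"
    where "F = polar_points K p"
  define Fm :: "('k, 'h) hopf \<Rightarrow> ('k, 'a) polar \<Rightarrow> ('k, 'a) polar \<Rightarrow> ('a \<Rightarrow> 'a) \<Rightarrow> _ \<Rightarrow> _"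
    where "Fm = (\<lambda>H A B \<alpha>. points_map H (env_map K p A B \<alpha>))"
  define c :: "('k, 'h) hopf \<Rightarrow> ('k, 'a) polar \<Rightarrow> _ \<Rightarrow> ('h, 'a) polar_point"
    where "c = (\<lambda>H A. polar_algebra.encode K p A H)"
  \<comment> \<open>Decoding. Morphisms and natural transformations for \<open>Gt\<close> are
    obtained by decoding, acting on points of the envelope, and encoding again.\<close>
  define d where "d = (\<lambda>H A. inv_into (carrier (F H A)) (c H A))"
  define Gt where "Gt = (\<lambda>H A. transport (F H A) (c H A))"
  define Gtm where "Gtm = (\<lambda>H A B \<alpha> x. c H B (Fm H A B \<alpha> (d H A x)))"
  define \<tau> where "\<tau> = (\<lambda>(H :: ('k, 'h) hopf) H' \<phi> A x. c H' A (compose (carrier H') (d H A x) \<phi>))"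
  define \<theta> where "\<theta> = (\<lambda>(H :: ('k, 'h) hopf) (R :: ('k, 'a) module). points_map H (pol_envelope.\<pi> K p R 1))"
  \<comment> \<open>The comparison \<open>\<theta>\<close> goes from the eigenspace to the points of
    \<open>R\<close>, so it is inverted before encoding.\<close>
  define \<eta> where "\<eta> = (\<lambda>H R x. c H (pol p R) (inv_into (carrier (F H (pol p R))) (\<theta> H R) x))"
  have hopf: "bicommutative_hopf_algebra K H" if "H \<in> AbSch_padic K p" for H :: "('k, 'h) hopf"
    using that by (simp add: AbSch_padic_def)
  have inj: "inj_on (c H A) (carrier (F H A))" if "H \<in> AbSch_padic K p" "A \<in> Pol K p" for H A
    unfolding c_def F_def using that hopf by (intro encode_inj) (simp_all add: Pol_iff)
  have dc: "d H A (c H A f) = f" if "H \<in> AbSch_padic K p" "A \<in> Pol K p" "f \<in> carrier (F H A)" for H A f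
    using inj[OF that(1,2)] that(3) by (simp add: d_def)
  have Gt_carrier: "carrier (Gt H A) = c H A ` carrier (F H A)" for H A
    by (simp add: Gt_def transport_def)
  have F: "ab_functor (Pol K p) (polar_hom K p) (F H) (Fm H)" if "H \<in> AbSch_padic K p" for H
    unfolding F_def Fm_def by (rule polar_points_functor[OF that])
  have c_iso: "ab_nat_iso (Pol K p) (polar_hom K p) (F H) (Fm H) (Gt H) (Gtm H) (c H)"
    if "H \<in> AbSch_padic K p" for H
    unfolding Gt_def Gtm_def d_def using F[OF that] inj[OF that] by (rule ab_nat_iso_transport)
  have pb: "ab_nat_trans (Pol K p) (polar_hom K p) (F H) (Fm H) (F H') (Fm H') (\<lambda>A f. compose (carrier H') f \<phi>)"
    if "H \<in> AbSch_padic K p" "H' \<in> AbSch_padic K p" "\<phi> \<in> hopf_hom K H' H" for H H' \<phi>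
    unfolding F_def Fm_def by (rule pullback_nat_trans[OF that])
  have pb_closed: "compose (carrier H') f \<phi> \<in> carrier (F H' A)"
    if "H \<in> AbSch_padic K p" "H' \<in> AbSch_padic K p" "\<phi> \<in> hopf_hom K H' H" "A \<in> Pol K p" "f \<in> carrier (F H A)"
    for H H' \<phi> A f
    using hom_in_carrier[OF ab_nat_transD(3)[OF pb[OF that(1-3)] that(4)] that(5)] .
  have F_hom: "f \<in> alg_hom K H (envelope K p A)" if "f \<in> carrier (F H A)" for f H A
    using that by (simp add: F_def polar_points_def)
  show ?thesis
  proof (intro exI[of _ Gt] exI[of _ Gtm] exI[of _ \<tau>] exI[of _ \<eta>] conjI ballI)
    show "ab_functor (Pol K p) (polar_hom K p) (Gt H) (Gtm H)" if "H \<in> AbSch_padic K p" for H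
      by (rule ab_nat_transD(2)[OF ab_nat_isoD(1)[OF c_iso[OF that]]])
    show "ab_nat_trans (Pol K p) (polar_hom K p) (Gt H) (Gtm H) (Gt H') (Gtm H') (\<tau> H H' \<phi>)"
      if "H \<in> AbSch_padic K p" "H' \<in> AbSch_padic K p" "\<phi> \<in> hopf_hom K H' H" for H H' \<phi>
      unfolding \<tau>_def d_def
      by (rule ab_nat_trans_comp[OF ab_nat_trans_comp[OF
              ab_nat_isoD(1)[OF ab_nat_iso_inverse[OF c_iso[OF that(1)]]] pb[OF that]] ab_nat_isoD(1)[OF c_iso[OF that(2)]]])
    show "\<tau> H H (\<lambda>h\<in>carrier H. h) A x = x"
      if "H \<in> AbSch_padic K p" "A \<in> Pol K p" and x: "x \<in> carrier (Gt H A)" for H A x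
    proof -
      obtain f where f: "f \<in> carrier (F H A)" "x = c H A f" using x by (auto simp: Gt_carrier)
      have "compose (carrier H) f (\<lambda>h\<in>carrier H. h) = f"
        using alg_homD(3)[OF F_hom[OF f(1)]] by (intro extensionalityI[of _ "carrier H"]) (simp_all add: compose_eq)
      then show ?thesis using that f by (simp add: \<tau>_def dc)
    qed
    show "\<tau> H H'' (compose (carrier H'') \<phi> \<psi>) A x = \<tau> H' H'' \<psi> A (\<tau> H H' \<phi> A x)"
      if "H \<in> AbSch_padic K p" "H' \<in> AbSch_padic K p" "H'' \<in> AbSch_padic K p" "\<phi> \<in> hopf_hom K H' H"
        "\<psi> \<in> hopf_hom K H'' H'" "A \<in> Pol K p" and x: "x \<in> carrier (Gt H A)" for H H' H'' \<phi> \<psi> A x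
    proof -
      obtain f where f: "f \<in> carrier (F H A)" "x = c H A f" using x by (auto simp: Gt_carrier)
      have "\<psi> \<in> alg_hom K H'' H'" using that(5) by (simp add: hopf_hom_def)
      then have "compose (carrier H'') f (compose (carrier H'') \<phi> \<psi>) =
        compose (carrier H'') (compose (carrier H') f \<phi>) \<psi>"
        by (intro extensionalityI[of _ "carrier H''"]) (simp_all add: compose_eq alg_homD(4))
      then show ?thesis
        using that f pb_closed[OF that(1,2,4,6) f(1)] by (simp add: \<tau>_def dc)
    qed
    have \<theta>: "ab_nat_iso (Alg K) (alg_hom K) (\<lambda>R. F H (pol p R)) (\<lambda>R S. Fm H (pol p R) (pol p S))
      (points K H) (\<lambda>R S. points_map H) (\<theta> H)" if "H \<in> AbSch_padic K p" for H
      unfolding F_def Fm_def \<theta>_def by (rule theta_nat_iso[OF that])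
    show "ab_nat_iso (Alg K) (alg_hom K) (points K H) (\<lambda>R S. points_map H)
      (\<lambda>R. Gt H (pol p R)) (\<lambda>R S. Gtm H (pol p R) (pol p S)) (\<eta> H)" if "H \<in> AbSch_padic K p" for H
    proof -
      have "ab_nat_iso (Alg K) (alg_hom K) (\<lambda>R. F H (pol p R)) (\<lambda>R S. Fm H (pol p R) (pol p S))
        (\<lambda>R. Gt H (pol p R)) (\<lambda>R S. Gtm H (pol p R) (pol p S)) (\<lambda>R. c H (pol p R))"
        unfolding Gt_def Gtm_def d_def
        by (rule ab_nat_iso_transport[OF ab_nat_transD(1)[OF ab_nat_isoD(1)[OF \<theta>[OF that]]] inj[OF that pol_in_Pol]])
      then show ?thesis
        unfolding \<eta>_def by (rule ab_nat_iso_comp[OF ab_nat_iso_inverse[OF \<theta>[OF that]]])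
    qed
    show "\<eta> H' R (compose (carrier H') x \<phi>) = \<tau> H H' \<phi> (pol p R) (\<eta> H R x)"
      if "H \<in> AbSch_padic K p" "H' \<in> AbSch_padic K p" "\<phi> \<in> hopf_hom K H' H" "R \<in> Alg K"
        and x: "x \<in> carrier (points K H R)" for H H' \<phi> R x
    proof -
      note R = pol_in_Pol[OF that(4)]
      have bij: "bij_betw (\<theta> H R) (carrier (F H (pol p R))) (carrier (points K H R))"
        if "H \<in> AbSch_padic K p" for H
        using ab_nat_isoD(2)[OF \<theta>[OF that] \<open>R \<in> Alg K\<close>] by (simp add: iso_def)
      \<comment> \<open>Naturality in the group scheme is checked on x =
        \<open>\<theta> H R f\<close>: there \<open>\<theta>\<close> is postcomposition with
        \<open>\<pi> 1\<close> and the pullback is precomposition with \<open>\<phi>\<close>, and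
        these commute.\<close>
      obtain f where f: "f \<in> carrier (F H (pol p R))" "x = \<theta> H R f"
        using bij[OF \<open>H \<in> AbSch_padic K p\<close>] x by (auto simp: bij_betw_def)
      have \<phi>1: "\<phi> \<in> alg_hom K H' H" using that(3) by (simp add: hopf_hom_def)
      have "compose (carrier H') x \<phi> = \<theta> H' R (compose (carrier H') f \<phi>)"
        by (intro extensionalityI[of _ "carrier H'"]) (simp_all add: f(2) \<theta>_def points_map_def compose_eq alg_homD(4)[OF \<phi>1])
      then have 1: "inv_into (carrier (F H' (pol p R))) (\<theta> H' R) (compose (carrier H') x \<phi>) = compose (carrier H') f \<phi>"
        using bij_betw_inv_into_left[OF bij[OF that(2)] pb_closed[OF that(1-3) R f(1)]] by simp
      have 2: "inv_into (carrier (F H (pol p R))) (\<theta> H R) x = f"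
        using bij_betw_inv_into_left[OF bij[OF that(1)] f(1)] f(2) by simp
      show ?thesis unfolding \<eta>_def \<tau>_def 1 2 dc[OF that(1) R f(1)] ..
    qed
  qed
qed

end
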